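(* Let $\varepsilon\in[0,1]$, $\delta\in[0,1]$ and let $w_0\in Y$ satisfy $\hat K^\delta(w_0)\in L^1(\Omega)$. Then the following hold. (III-A) The problem $(\mathrm{OP})^{(\varepsilon,\delta)}$ (with initial data $w_0$) has at least one optimal control $u^*\in\mathbb{X}$, i.e. $\mathcal{J}^{(\varepsilon,\delta)}(u^* )=\min\{\mathcal{J}^{(\varepsilon,\delta)}(u)\mid u\in\mathbb{X}\}$. (III-B) Let $\{\varepsilon_m\}_{m\in\mathbb{N}}\subset(0,1]$, $\{\delta_m\}_{m\in\mathbb{N}}\subset(0,1]$ and $\{w_0^m\}_{m\in\mathbb{N}}\subset Y$ satisfy $\varepsilon_m\to\varepsilon$, $\delta_m\to\delta$, $w_0^m\to w_0$ weakly in $Y$ as $m\to\infty$, and $\sup_{m\in\mathbb{N}}\int_\Omega\hat K^{\delta_m}(w_0^m)\,dx<\infty$. For each $m\in\mathbb{N}$ let $u^{( *,m)}\in\mathbb{X}$ be an optimal control of $(\mathrm{OP})^{(\varepsilon_m,\delta_m)}$ in the case when the initial data of the corresponding state-system $(\mathrm{AC})^{(\varepsilon_m,\delta_m)}$ is $w_0^m$. Then there exist a subsequence $\{m_k\}_{k\in\mathbb{N}}\subset\{m\}$ and $u^{**}\in\mathbb{X}$ such that $M_u u^{( *,m_k)}\to M_u u^{**}$ weakly in $\mathbb{X}$ as $k\to\infty$, and $u^{**}$ is an optimal control of $(\mathrm{OP})^{(\varepsilon,\delta)}$ (with initial data $w_0$).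
   Context: Let $0<L,T<\infty$, $\Omega := (-L,L)$, $X := L^2(\Omega)$, $Y := H^1(\Omega)\ (\subset C(\overline\Omega))$, $n\in\mathbb{N}$, $\mathbb{X} := [X]^n$; $\partial_x$ is the distributional derivative. $\nu>0$, $M_u\ge 0$, $M_w\ge 0$ are fixed constants, and $w^{\mathrm{ad}}=[w_1^{\mathrm{ad}},\dots,w_n^{\mathrm{ad}}]\in\mathbb{X}$ is a fixed target profile. Mosco convergence: for proper l.s.c. convex functions $\psi_n,\psi$ on a Hilbert space $H$, $\psi_n \to \psi$ in the sense of Mosco iff (M1) $\liminf_n \psi_n(w_n) \ge \psi(w)$ whenever $w_n \to w$ weakly in $H$; (M2) for every $w \in D(\psi)$ there are $w_n \to w$ in $H$ with $\psi_n(w_n) \to \psi(w)$. For a family with a continuous parameter, convergence is meant along every sequence of parameters converging to the given limit. Assumption on $f^\varepsilon$: $f^0(r) := |r|$; $\{f^\varepsilon\}_{\varepsilon\in(0,1]} \subset C^2(\mathbb{R})$ are convex functions with $f^\varepsilon(0)=0$, $f^\varepsilon \ge 0$ on $\mathbb{R}$; for every $\varepsilon_0 \in [0,1]$, as $\varepsilon \to \varepsilon_0$, $f^\varepsilon(r) \to f^{\varepsilon_0}(r)$ for every $r\in\mathbb{R}$ and $f^\varepsilon \to f^{\varepsilon_0}$ on $\mathbb{R}$ in the sense of Mosco; there is $C_0>0$ independent of $\varepsilon$ with $|(f^\varepsilon)'(r)| \le C_0(1+|r|)$ for all $r \in \mathbb{R}$, $\varepsilon\in(0,1]$; and for every $\lambda>0$,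 $(f^\varepsilon)'' \to 0$ uniformly on $\{|r| \ge \lambda\}$ as $\varepsilon \to 0$. For $\varepsilon\in(0,1]$, $\partial f^\varepsilon(r) = \{(f^\varepsilon)'(r)\}$; $\partial f^0(r) = \{r/|r|\}$ if $r\neq 0$, $\partial f^0(0)=[-1,1]$. Assumption on $g$: $g\in C^1(\mathbb{R})$, there is $C_g>0$ such that $r\mapsto g(r)+C_g r$ is monotone (nondecreasing), and $g$ has a nonnegative primitive $0\le G\in C^2(\mathbb{R})$, $G'=g$. Assumption on $K^\delta$: $\hat K^0 := I_{[-1,1]}$ (equal to $0$ on $[-1,1]$ and $+\infty$ elsewhere) and $K^0 := \partial I_{[-1,1]}$ (set-valued subdifferential). $\{\hat K^\delta\}_{\delta\in(0,1]} \subset C^2(\mathbb{R})$ and $\{K^\delta\}_{\delta\in(0,1]} \subset C^1(\mathbb{R})$ satisfy: $K^\delta = (\hat K^\delta)'$ and $\hat K^\delta \equiv 0$ on $[-1,1]$ for all $\delta\in(0,1]$; for each $\delta\in(0,1]$ there is $C_K^\delta>0$ with $0 \le (K^\delta)' \le C_K^\delta$ on $\mathbb{R}$; for every $\delta_0\in[0,1]$, $\hat K^\delta \to \hat K^{\delta_0}$ on $\mathbb{R}$ in the sense of Mosco as $\delta\to\delta_0$, and if $\delta_0 \in (0,1]$ also $\hat K^\delta \to \hat K^{\delta_0}$ in $C_{\mathrm{loc}}(\mathbb{R})$. Time step: $\tau := T/n$ with $0<\tau<\tau^* := \frac{1}{8(C_g+1)}$. Functional: for $\varepsilon,\delta\in[0,1]$,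 $\Psi^{(\varepsilon,\delta)}(z) := \int_\Omega f^\varepsilon(\partial_x z)\,dx + \frac{\nu^2}{2}\int_\Omega |\partial_x z|^2\,dx + \int_\Omega \hat K^\delta(z)\,dx$ if $z\in Y$, and $:=\infty$ if $z\in X\setminus Y$; $D(\Psi^{(\varepsilon,\delta)})$ is its effective domain. State-system $(\mathrm{AC})^{(\varepsilon,\delta)}$ for forcing $u\in\mathbb{X}$ and initial value $w_0\in Y$ with $\hat K^\delta(w_0)\in L^1(\Omega)$: find $w=[w_1,\dots,w_n]$ with $$\frac1\tau(w_i-w_{i-1}) - \partial_x\big(\partial f^\varepsilon(\partial_x w_i)+\nu^2\partial_x w_i\big) + K^\delta(w_i) + g(w_i) \ni M_u u_i \text{ in } \Omega,\quad \partial_x w_i(\pm L)=0,\quad i=1,\dots,n.$$ Being a solution means: $w_i\in D(\Psi^{(\varepsilon,\delta)})$ and, for all $z\in D(\Psi^{(\varepsilon,\delta)})$ and $i=1,\dots,n$, $$\frac1\tau(w_i-w_{i-1},w_i-z)_X+(g(w_i)-M_uu_i,w_i-z)_X+\Psi^{(\varepsilon,\delta)}(w_i)-\Psi^{(\varepsilon,\delta)}(z)\le 0.$$ A unique solution exists, and it belongs to $[H^2(\Omega)]^n$. Optimal control problem $(\mathrm{OP})^{(\varepsilon,\delta)}$: for given initial data, find $u^*\in\mathbb{X}$ (an optimal control) minimizing over $\mathbb{X}$ the cost $$\mathcal{J}^{(\varepsilon,\delta)}(u) := \frac{M_w}{2}|w-w^{\mathrm{ad}}|_{\mathbb{X}}^2+\frac{M_u}{2}|u|_{\mathbb{X}}^2,$$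 where $w$ is the solution to $(\mathrm{AC})^{(\varepsilon,\delta)}$ for the forcing term $u$ and the given initial data. *)

theory Defs
  imports "HOL-Analysis.Analysis"
begin

text \<open>
  Elements of function spaces over the interval \<open>(-L, L)\<close> are represented by functions on
  \<open>real\<close>, of which only the values almost everywhere on the interval matter.
\<close>

abbreviation Om :: "real \<Rightarrow> real measure" where
  "Om L \<equiv> lebesgue_on {-L<..<L}"

definition L2 :: "real \<Rightarrow> (real \<Rightarrow> real) set" where
  "L2 L = {z. z \<in> borel_measurable (Om L) \<and> integrable (Om L) (\<lambda>x. (z x)\<^sup>2)}"

definition L2_inner :: "real \<Rightarrow> (real \<Rightarrow> real) \<Rightarrow> (real \<Rightarrow> real) \<Rightarrow> real" where
  "L2_inner L y z = (LINT x|Om L. y x * z x)"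

text \<open>Smooth functions with compact support in \<open>(-L, L)\<close>.\<close>

definition test_functions :: "real \<Rightarrow> (real \<Rightarrow> real) set" where
  "test_functions L = {\<phi>. (\<forall>k x. (deriv ^^ k) \<phi> differentiable (at x)) \<and>
     (\<exists>S. compact S \<and> S \<subseteq> {-L<..<L} \<and> (\<forall>x. x \<notin> S \<longrightarrow> \<phi> x = 0))}"

definition has_distr_deriv :: "real \<Rightarrow> (real \<Rightarrow> real) \<Rightarrow> (real \<Rightarrow> real) \<Rightarrow> bool" where
  "has_distr_deriv L z v \<longleftrightarrow>
     (\<forall>\<phi>\<in>test_functions L. (LINT x|Om L. z x * deriv \<phi> x) = - (LINT x|Om L. v x * \<phi> x))"

definition H1 :: "real \<Rightarrow> (real \<Rightarrow> real) set" where
  "H1 L = {z \<in> L2 L. \<exists>v\<in>L2 L. has_distr_deriv L z v}"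

text \<open>A representative of the distributional derivative, which is unique almost everywhere.\<close>

definition ddx :: "real \<Rightarrow> (real \<Rightarrow> real) \<Rightarrow> real \<Rightarrow> real" where
  "ddx L z = (SOME v. v \<in> L2 L \<and> has_distr_deriv L z v)"

definition H1_inner :: "real \<Rightarrow> (real \<Rightarrow> real) \<Rightarrow> (real \<Rightarrow> real) \<Rightarrow> real" where
  "H1_inner L y z = L2_inner L y z + L2_inner L (ddx L y) (ddx L z)"

definition H1_weak_lim :: "real \<Rightarrow> (nat \<Rightarrow> real \<Rightarrow> real) \<Rightarrow> (real \<Rightarrow> real) \<Rightarrow> bool" where
  "H1_weak_lim L z z0 \<longleftrightarrow> (\<forall>y\<in>H1 L. (\<lambda>m. H1_inner L (z m) y) \<longlonglongrightarrow> H1_inner L z0 y)"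

text \<open>The product space \<open>L2(-L,L)^n\<close>; only the components with index in \<open>{1..n}\<close> matter.\<close>

definition XX :: "real \<Rightarrow> nat \<Rightarrow> (nat \<Rightarrow> real \<Rightarrow> real) set" where
  "XX L n = {u. \<forall>i\<in>{1..n}. u i \<in> L2 L}"

definition XX_inner :: "real \<Rightarrow> nat \<Rightarrow> (nat \<Rightarrow> real \<Rightarrow> real) \<Rightarrow> (nat \<Rightarrow> real \<Rightarrow> real) \<Rightarrow> real" where
  "XX_inner L n u v = (\<Sum>i=1..n. L2_inner L (u i) (v i))"

definition XX_weak_lim ::
    "real \<Rightarrow> nat \<Rightarrow> (nat \<Rightarrow> nat \<Rightarrow> real \<Rightarrow> real) \<Rightarrow> (nat \<Rightarrow> real \<Rightarrow> real) \<Rightarrow> bool" where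
  "XX_weak_lim L n u u0 \<longleftrightarrow> (\<forall>v\<in>XX L n. (\<lambda>m. XX_inner L n (u m) v) \<longlonglongrightarrow> XX_inner L n u0 v)"

definition weak_lim :: "(nat \<Rightarrow> 'a::real_inner) \<Rightarrow> 'a \<Rightarrow> bool" where
  "weak_lim x x0 \<longleftrightarrow> (\<forall>v. (\<lambda>k. inner (x k) v) \<longlonglongrightarrow> inner x0 v)"

definition mosco_lim :: "(nat \<Rightarrow> 'a::real_inner \<Rightarrow> ereal) \<Rightarrow> ('a \<Rightarrow> ereal) \<Rightarrow> bool" where
  "mosco_lim \<psi> \<psi>0 \<longleftrightarrow>
     (\<forall>x x0. weak_lim x x0 \<longrightarrow> \<psi>0 x0 \<le> liminf (\<lambda>k. \<psi> k (x k))) \<and>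
     (\<forall>x0. \<psi>0 x0 < \<infinity> \<longrightarrow> (\<exists>x. x \<longlonglongrightarrow> x0 \<and> (\<lambda>k. \<psi> k (x k)) \<longlonglongrightarrow> \<psi>0 x0))"

definition mosco_within :: "(real \<Rightarrow> 'a::real_inner \<Rightarrow> ereal) \<Rightarrow> real \<Rightarrow> real set \<Rightarrow> bool" where
  "mosco_within \<psi> a S \<longleftrightarrow>
     (\<forall>s. (\<forall>k::nat. s k \<in> S) \<longrightarrow> s \<longlonglongrightarrow> a \<longrightarrow> mosco_lim (\<lambda>k. \<psi> (s k)) (\<psi> a))"

definition C2 :: "(real \<Rightarrow> real) \<Rightarrow> bool" where
  "C2 h \<longleftrightarrow> (\<forall>x. h differentiable (at x)) \<and> deriv h C1_differentiable_on UNIV"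

definition f_family :: "(real \<Rightarrow> real \<Rightarrow> real) \<Rightarrow> bool" where
  "f_family f \<longleftrightarrow>
     (\<forall>r. f 0 r = \<bar>r\<bar>) \<and>
     (\<forall>\<epsilon>\<in>{0<..1}. C2 (f \<epsilon>) \<and> convex_on UNIV (f \<epsilon>) \<and> f \<epsilon> 0 = 0 \<and> (\<forall>r. 0 \<le> f \<epsilon> r)) \<and>
     (\<forall>\<epsilon>0\<in>{0..1}. (\<forall>r. ((\<lambda>\<epsilon>. f \<epsilon> r) \<longlongrightarrow> f \<epsilon>0 r) (at \<epsilon>0 within {0..1})) \<and>
        mosco_within (\<lambda>\<epsilon> r. ereal (f \<epsilon> r)) \<epsilon>0 {0..1}) \<and>
     (\<exists>C0>0. \<forall>\<epsilon>\<in>{0<..1}. \<forall>r. \<bar>deriv (f \<epsilon>) r\<bar> \<le> C0 * (1 + \<bar>r\<bar>)) \<and>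
     (\<forall>\<rho>>0. uniform_limit {r. \<rho> \<le> \<bar>r\<bar>} (\<lambda>\<epsilon>. deriv (deriv (f \<epsilon>))) (\<lambda>_. 0) (at 0 within {0<..1}))"

definition g_assms :: "(real \<Rightarrow> real) \<Rightarrow> real \<Rightarrow> bool" where
  "g_assms g Cg \<longleftrightarrow>
     g C1_differentiable_on UNIV \<and> 0 < Cg \<and> mono (\<lambda>r. g r + Cg * r) \<and>
     (\<exists>G. C2 G \<and> (\<forall>r. 0 \<le> G r) \<and> (\<forall>r. (G has_real_derivative g r) (at r)))"

text \<open>
  The potentials for parameters in \<open>(0,1]\<close> are real-valued and given by \<open>Kh\<close>; for the
  parameter 0 the value of \<open>Kh\<close> is ignored in favour of the indicator function of \<open>[-1,1]\<close>.
\<close>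

definition Khat :: "(real \<Rightarrow> real \<Rightarrow> real) \<Rightarrow> real \<Rightarrow> real \<Rightarrow> ereal" where
  "Khat Kh \<delta> r = (if \<delta> = 0 then (if r \<in> {-1..1} then 0 else \<infinity>) else ereal (Kh \<delta> r))"

definition K_family :: "(real \<Rightarrow> real \<Rightarrow> real) \<Rightarrow> (real \<Rightarrow> real \<Rightarrow> real) \<Rightarrow> bool" where
  "K_family Kh K \<longleftrightarrow>
     (\<forall>\<delta>\<in>{0<..1}. C2 (Kh \<delta>) \<and> K \<delta> C1_differentiable_on UNIV \<and>
        (\<forall>r. (Kh \<delta> has_real_derivative K \<delta> r) (at r)) \<and>
        (\<forall>r\<in>{-1..1}. Kh \<delta> r = 0) \<and>
        (\<exists>C>0. \<forall>r. 0 \<le> deriv (K \<delta>) r \<and> deriv (K \<delta>) r \<le> C)) \<and>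
     (\<forall>\<delta>0\<in>{0..1}. mosco_within (Khat Kh) \<delta>0 {0..1}) \<and>
     (\<forall>\<delta>0\<in>{0<..1}. \<forall>S. compact S \<longrightarrow> uniform_limit S Kh (Kh \<delta>0) (at \<delta>0 within {0<..1}))"

text \<open>
  The integrands below are nonnegative: the potentials in \<open>K_family\<close> are convex and vanish on
  \<open>[-1,1]\<close>. Hence they may be integrated as \<open>ennreal\<close>-valued functions, and integrability of
  \<open>Khat Kh \<delta> \<circ> z\<close> means that its integral is finite.
\<close>

definition Khat_integral :: "real \<Rightarrow> (real \<Rightarrow> real \<Rightarrow> real) \<Rightarrow> real \<Rightarrow> (real \<Rightarrow> real) \<Rightarrow> ennreal" where
  "Khat_integral L Kh \<delta> z = (\<integral>\<^sup>+x. e2ennreal (Khat Kh \<delta> (z x)) \<partial>Om L)"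

definition Psi :: "real \<Rightarrow> real \<Rightarrow> (real \<Rightarrow> real \<Rightarrow> real) \<Rightarrow> (real \<Rightarrow> real \<Rightarrow> real) \<Rightarrow>
    real \<Rightarrow> real \<Rightarrow> (real \<Rightarrow> real) \<Rightarrow> ereal" where
  "Psi L \<nu> f Kh \<epsilon> \<delta> z =
     (if z \<in> H1 L then
        enn2ereal ((\<integral>\<^sup>+x. ennreal (f \<epsilon> (ddx L z x)) \<partial>Om L) +
          ennreal (\<nu>\<^sup>2 / 2) * (\<integral>\<^sup>+x. ennreal (\<bar>ddx L z x\<bar>\<^sup>2) \<partial>Om L) +
          Khat_integral L Kh \<delta> z)
      else \<infinity>)"

definition D_Psi :: "real \<Rightarrow> real \<Rightarrow> (real \<Rightarrow> real \<Rightarrow> real) \<Rightarrow> (real \<Rightarrow> real \<Rightarrow> real) \<Rightarrow>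
    real \<Rightarrow> real \<Rightarrow> (real \<Rightarrow> real) set" where
  "D_Psi L \<nu> f Kh \<epsilon> \<delta> = {z \<in> L2 L. Psi L \<nu> f Kh \<epsilon> \<delta> z < \<infinity>}"

text \<open>The component \<open>w 0\<close> is not part of the solution; it is overwritten by the initial value.\<close>

definition AC_solution :: "real \<Rightarrow> real \<Rightarrow> nat \<Rightarrow> real \<Rightarrow> real \<Rightarrow>
    (real \<Rightarrow> real \<Rightarrow> real) \<Rightarrow> (real \<Rightarrow> real) \<Rightarrow> (real \<Rightarrow> real \<Rightarrow> real) \<Rightarrow> real \<Rightarrow> real \<Rightarrow>
    (real \<Rightarrow> real) \<Rightarrow> (nat \<Rightarrow> real \<Rightarrow> real) \<Rightarrow> (nat \<Rightarrow> real \<Rightarrow> real) \<Rightarrow> bool" where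
  "AC_solution L T n \<nu> Mu f g Kh \<epsilon> \<delta> w0 u w \<longleftrightarrow>
     (let \<tau> = T / real n; wp = w(0 := w0) in
      \<forall>i\<in>{1..n}. w i \<in> D_Psi L \<nu> f Kh \<epsilon> \<delta> \<and>
        (\<forall>z\<in>D_Psi L \<nu> f Kh \<epsilon> \<delta>.
           ereal (1 / \<tau> * L2_inner L (\<lambda>x. w i x - wp (i - 1) x) (\<lambda>x. w i x - z x) +
                  L2_inner L (\<lambda>x. g (w i x) - Mu * u i x) (\<lambda>x. w i x - z x)) +
           Psi L \<nu> f Kh \<epsilon> \<delta> (w i) - Psi L \<nu> f Kh \<epsilon> \<delta> z \<le> 0))"

text \<open>
  The solution is unique up to null sets, so that the cost does not depend on the representative
  chosen here.
\<close>

definition AC_state :: "real \<Rightarrow> real \<Rightarrow> nat \<Rightarrow> real \<Rightarrow> real \<Rightarrow>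
    (real \<Rightarrow> real \<Rightarrow> real) \<Rightarrow> (real \<Rightarrow> real) \<Rightarrow> (real \<Rightarrow> real \<Rightarrow> real) \<Rightarrow> real \<Rightarrow> real \<Rightarrow>
    (real \<Rightarrow> real) \<Rightarrow> (nat \<Rightarrow> real \<Rightarrow> real) \<Rightarrow> (nat \<Rightarrow> real \<Rightarrow> real)" where
  "AC_state L T n \<nu> Mu f g Kh \<epsilon> \<delta> w0 u = (SOME w. AC_solution L T n \<nu> Mu f g Kh \<epsilon> \<delta> w0 u w)"

definition cost :: "real \<Rightarrow> real \<Rightarrow> nat \<Rightarrow> real \<Rightarrow> real \<Rightarrow> real \<Rightarrow> (nat \<Rightarrow> real \<Rightarrow> real) \<Rightarrow>
    (real \<Rightarrow> real \<Rightarrow> real) \<Rightarrow> (real \<Rightarrow> real) \<Rightarrow> (real \<Rightarrow> real \<Rightarrow> real) \<Rightarrow> real \<Rightarrow> real \<Rightarrow>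
    (real \<Rightarrow> real) \<Rightarrow> (nat \<Rightarrow> real \<Rightarrow> real) \<Rightarrow> real" where
  "cost L T n \<nu> Mu Mw wad f g Kh \<epsilon> \<delta> w0 u =
     (let e = (\<lambda>i x. AC_state L T n \<nu> Mu f g Kh \<epsilon> \<delta> w0 u i x - wad i x)
      in Mw / 2 * XX_inner L n e e + Mu / 2 * XX_inner L n u u)"

definition optimal_control :: "real \<Rightarrow> real \<Rightarrow> nat \<Rightarrow> real \<Rightarrow> real \<Rightarrow> real \<Rightarrow>
    (nat \<Rightarrow> real \<Rightarrow> real) \<Rightarrow> (real \<Rightarrow> real \<Rightarrow> real) \<Rightarrow> (real \<Rightarrow> real) \<Rightarrow> (real \<Rightarrow> real \<Rightarrow> real) \<Rightarrow>
    real \<Rightarrow> real \<Rightarrow> (real \<Rightarrow> real) \<Rightarrow> (nat \<Rightarrow> real \<Rightarrow> real) \<Rightarrow> bool" where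
  "optimal_control L T n \<nu> Mu Mw wad f g Kh \<epsilon> \<delta> w0 u \<longleftrightarrow>
     is_arg_min (cost L T n \<nu> Mu Mw wad f g Kh \<epsilon> \<delta> w0) (\<lambda>v. v \<in> XX L n) u"

end

theory Submission
  imports Defs "HOL-Library.Function_Algebras" "HOL-Library.Diagonal_Subsequence"
begin

text \<open>
  Both parts are instances of the direct method, and both rest on one stability property: if the
  parameters converge, the initial data and the controls converge weakly, and all of these are
  bounded, then the states converge strongly in \<open>L\<^sup>2\<close> (\<open>state_stable\<close>). The tracking
  term of the cost is then continuous and the control term is weakly lower semicontinuous, while the
  costs of a fixed competitor converge. Hence any weak limit of almost optimal controls is optimal
  for the limit data (\<open>almost_optimal_controls_converge\<close>). A minimizing sequence for fixed data gives
  existence of an optimal control, and a sequence of optimal controls for converging data gives the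
  second part; weak limits exist because the control term of the cost bounds the controls when
  \<open>Mu > 0\<close>. For \<open>Mu = 0\<close> neither the cost nor the state depends on the control.

  The state system is a chain of variational inequalities, each forced by the preceding step. Since
  the time step is small, the reaction \<open>r / \<tau> + g r\<close> is strongly monotone although \<open>g\<close> need not be
  monotone, so a step has at most one solution (\<open>step_unique\<close>) and solutions with bounded forcing
  are bounded in \<open>H\<^sup>1\<close> (\<open>step_bound\<close>). In one dimension a sequence bounded in \<open>H\<^sup>1\<close> has a subsequence that
  converges boundedly almost everywhere, with weakly convergent derivatives (\<open>H1_compact\<close>). This
  strong convergence makes the product with the merely weakly convergent forcing converge. The
  energies are treated by their Mosco convergence: the liminf inequality (\<open>energy_liminf\<close>) needs only
  the convergences just listed, and for recovery a constant sequence is enough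
  (\<open>energy_recovery\<close>). So the limit solves the limit inequality, and uniqueness identifies it
  (\<open>step_stable\<close>). Existence for one step (\<open>step_exists\<close>) uses the same compactness and liminf
  inequality for a minimizing sequence.

  Elements of \<open>L\<^sup>2\<close>, of \<open>H\<^sup>1\<close> and of the space of controls are functions, not classes of functions.
  The Hilbert space arguments (Riesz representation, weak sequential compactness, uniform
  boundedness) are therefore carried out for complete semi-inner products and then interpreted in the
  three spaces. Uniform boundedness and Riesz representation in \<open>H\<^sup>1\<close> turn weak \<open>H\<^sup>1\<close> convergence of
  the initial data into bounded weak \<open>L\<^sup>2\<close> convergence. The structure of \<open>H\<^sup>1\<close> functions comes from
  testing with smooth bumps built from \<open>exp (- 1 / x)\<close>: weak derivatives are unique, and a function
  is a constant plus the primitive of its weak derivative (\<open>H1_representation\<close>).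
\<close>

section \<open>Semi-inner product spaces\<close>

text \<open>
  Pointwise operations, so that subspaces and spans are available in spaces of functions.
\<close>

instantiation "fun" :: (type, real_vector) real_vector
begin

definition scaleR_fun :: "real \<Rightarrow> ('a \<Rightarrow> 'b) \<Rightarrow> 'a \<Rightarrow> 'b" where
  "scaleR_fun r f = (\<lambda>x. r *\<^sub>R f x)"

instance
  by standard (auto simp: scaleR_fun_def plus_fun_def scaleR_add_left scaleR_add_right)

end

lemma scaleR_fun_apply [simp]: "(r *\<^sub>R f) x = r *\<^sub>R f x"
  by (simp add: scaleR_fun_def)

lemma null_if_abs_le:
  fixes a b :: "nat \<Rightarrow> real"
  assumes "b \<longlonglongrightarrow> c" and "\<And>k. \<bar>a k\<bar> \<le> b k" and "c = 0"
  shows "a \<longlonglongrightarrow> 0"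
  by (rule Lim_null_comparison[of a b]) (use assms in auto)

lemma tendsto_zero_by_subsequences:
  fixes a :: "nat \<Rightarrow> real"
  assumes "\<And>r::nat \<Rightarrow> nat. strict_mono r \<Longrightarrow> \<exists>s. strict_mono s \<and> (\<lambda>k. a (r (s k))) \<longlonglongrightarrow> 0"
  shows "a \<longlonglongrightarrow> 0"
proof (rule ccontr)
  assume "\<not> a \<longlonglongrightarrow> 0"
  then obtain e where e: "e > 0" "\<And>N. \<exists>k\<ge>N. \<bar>a k\<bar> \<ge> e" by (auto simp: LIMSEQ_def dist_real_def not_less)
  have "infinite {k. \<bar>a k\<bar> \<ge> e}"
    unfolding infinite_nat_iff_unbounded_le using e(2) by auto
  then obtain r :: "nat \<Rightarrow> nat" where r: "strict_mono r" "\<And>k. r k \<in> {k. \<bar>a k\<bar> \<ge> e}" using infinite_enumerate by blast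
  obtain s where "(\<lambda>k. a (r (s k))) \<longlonglongrightarrow> 0" using assms[OF r(1)] by blast
  then have "\<forall>\<^sub>F k in sequentially. \<bar>a (r (s k))\<bar> < e" using e(1) by (auto dest!: tendstoD simp: dist_real_def)
  then show False using r(2) by (auto simp: eventually_sequentially not_less[symmetric])
qed

text \<open>
  The form is only semidefinite because functions that agree almost everywhere are not identified;
  limits are therefore unique up to null vectors.
\<close>

locale semi_hilbert =
  fixes V :: "'a::real_vector set" and ip :: "'a \<Rightarrow> 'a \<Rightarrow> real"
  assumes sub: "subspace V"
    and ip_sym: "x \<in> V \<Longrightarrow> y \<in> V \<Longrightarrow> ip x y = ip y x"
    and ip_add_left: "x \<in> V \<Longrightarrow> y \<in> V \<Longrightarrow> z \<in> V \<Longrightarrow> ip (x + y) z = ip x z + ip y z"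
    and ip_scale_left: "x \<in> V \<Longrightarrow> y \<in> V \<Longrightarrow> ip (r *\<^sub>R x) y = r * ip x y"
    and ip_nonneg: "x \<in> V \<Longrightarrow> 0 \<le> ip x x"
    and complete: "(\<And>k. X k \<in> V) \<Longrightarrow>
      (\<And>e. e > 0 \<Longrightarrow> \<exists>N. \<forall>i\<ge>N. \<forall>j\<ge>N. ip (X i - X j) (X i - X j) < e) \<Longrightarrow>
      \<exists>x\<in>V. (\<lambda>k. ip (X k - x) (X k - x)) \<longlonglongrightarrow> 0"
begin

lemma V_closed [simp, intro]:
  shows "0 \<in> V"
    and "x \<in> V \<Longrightarrow> y \<in> V \<Longrightarrow> x + y \<in> V"
    and "x \<in> V \<Longrightarrow> y \<in> V \<Longrightarrow> x - y \<in> V"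
    and "x \<in> V \<Longrightarrow> r *\<^sub>R x \<in> V"
  using sub by (auto simp: subspace_0 subspace_add subspace_diff subspace_scale)

lemma ip_add_right: "x \<in> V \<Longrightarrow> y \<in> V \<Longrightarrow> z \<in> V \<Longrightarrow> ip z (x + y) = ip z x + ip z y"
  by (metis V_closed(2) ip_add_left ip_sym)

lemma ip_scale_right: "x \<in> V \<Longrightarrow> y \<in> V \<Longrightarrow> ip y (r *\<^sub>R x) = r * ip y x"
  by (metis V_closed(4) ip_scale_left ip_sym)

lemma ip_diff_left: "x \<in> V \<Longrightarrow> y \<in> V \<Longrightarrow> z \<in> V \<Longrightarrow> ip (x - y) z = ip x z - ip y z"
  by (metis V_closed(3) add_diff_cancel_right' diff_add_cancel ip_add_left)

lemma ip_diff_right: "x \<in> V \<Longrightarrow> y \<in> V \<Longrightarrow> z \<in> V \<Longrightarrow> ip z (x - y) = ip z x - ip z y"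
  by (metis V_closed(3) ip_diff_left ip_sym)

lemma ip_zero_right [simp]: "x \<in> V \<Longrightarrow> ip x 0 = 0"
  using ip_scale_right[of x x 0] by simp

lemmas ip_simps = ip_add_left ip_add_right ip_scale_left ip_scale_right ip_diff_left ip_diff_right

lemma Cauchy_Schwarz:
  assumes x: "x \<in> V" and y: "y \<in> V"
  shows "(ip x y)\<^sup>2 \<le> ip x x * ip y y"
proof (cases "ip y y = 0")
  case True
  have "ip x y = 0"
  proof (rule ccontr)
    assume n: "ip x y \<noteq> 0"
    define t where "t = - (ip x x + 1) / (2 * ip x y)"
    have "0 \<le> ip (x + t *\<^sub>R y) (x + t *\<^sub>R y)" using x y by (intro ip_nonneg) auto
    also have "\<dots> = ip x x + 2 * t * ip x y"
      using x y True by (simp add: ip_simps ip_sym[of y x])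
    also have "\<dots> = -1" using n by (simp add: t_def field_simps)
    finally show False by simp
  qed
  then show ?thesis using ip_nonneg[OF x] True by simp
next
  case False
  then have pos: "ip y y > 0" using ip_nonneg[OF y] by simp
  define t where "t = - ip x y / ip y y"
  have "0 \<le> ip (x + t *\<^sub>R y) (x + t *\<^sub>R y)" using x y by (intro ip_nonneg) auto
  also have "\<dots> = ip x x + 2 * t * ip x y + t\<^sup>2 * ip y y"
    using x y by (simp add: ip_simps ip_sym[of y x] power2_eq_square algebra_simps)
  also have "\<dots> = ip x x - (ip x y)\<^sup>2 / ip y y"
    using pos by (simp add: t_def field_simps power2_eq_square)
  finally show ?thesis using pos by (simp add: field_simps)
qed

lemma Cauchy_Schwarz_abs:
  assumes "x \<in> V" and "y \<in> V"
  shows "\<bar>ip x y\<bar> \<le> sqrt (ip x x) * sqrt (ip y y)"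
  using Cauchy_Schwarz[OF assms] by (metis real_sqrt_abs real_sqrt_le_iff real_sqrt_mult)

lemma sqrt_ip_triangle:
  assumes x: "x \<in> V" and y: "y \<in> V"
  shows "sqrt (ip (x + y) (x + y)) \<le> sqrt (ip x x) + sqrt (ip y y)"
proof (rule real_le_lsqrt)
  have "ip (x + y) (x + y) = ip x x + 2 * ip x y + ip y y"
    using x y by (simp add: ip_simps ip_sym[of y x])
  also have "\<dots> \<le> ip x x + 2 * (sqrt (ip x x) * sqrt (ip y y)) + ip y y"
    using Cauchy_Schwarz_abs[OF x y] by linarith
  also have "\<dots> = (sqrt (ip x x) + sqrt (ip y y))\<^sup>2"
    using ip_nonneg[OF x] ip_nonneg[OF y] by (simp add: power2_sum)
  finally show "ip (x + y) (x + y) \<le> (sqrt (ip x x) + sqrt (ip y y))\<^sup>2" .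
qed (use x y in \<open>auto simp: ip_nonneg\<close>)

lemma tendsto_ip_left:
  assumes X: "\<And>k. X k \<in> V" and x: "x \<in> V" and y: "y \<in> V"
    and lim: "(\<lambda>k. ip (X k - x) (X k - x)) \<longlonglongrightarrow> 0"
  shows "(\<lambda>k. ip (X k) y) \<longlonglongrightarrow> ip x y"
proof -
  have "(\<lambda>k. sqrt (ip (X k - x) (X k - x)) * sqrt (ip y y)) \<longlonglongrightarrow> sqrt 0 * sqrt (ip y y)"
    by (intro tendsto_intros lim)
  moreover have "\<bar>ip (X k) y - ip x y\<bar> \<le> sqrt (ip (X k - x) (X k - x)) * sqrt (ip y y)" for k
    using Cauchy_Schwarz_abs[of "X k - x" y] X x y by (simp add: ip_diff_left)
  ultimately have "(\<lambda>k. ip (X k) y - ip x y) \<longlonglongrightarrow> 0"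
    by (rule null_if_abs_le) simp
  then show ?thesis by (rule LIM_zero_cancel)
qed

text \<open>
  Riesz representation on a possibly non-closed subspace \<open>S\<close>: the quadratic functional
  \<open>s \<mapsto> ip s s - 2 * l s\<close> is bounded below on \<open>S\<close>, by the parallelogram identity its minimizing
  sequences are Cauchy, and stationarity of their limit is the representation.
\<close>

lemma Riesz_on_subspace:
  assumes S: "subspace S" "S \<subseteq> V"
    and add: "\<And>x y. x \<in> S \<Longrightarrow> y \<in> S \<Longrightarrow> l (x + y) = l x + l y"
    and scale: "\<And>r x. x \<in> S \<Longrightarrow> l (r *\<^sub>R x) = r * l x"
    and bound: "\<And>x. x \<in> S \<Longrightarrow> \<bar>l x\<bar> \<le> M * sqrt (ip x x)"
  obtains u X where "u \<in> V" "\<And>k. X k \<in> S" "(\<lambda>k. ip (X k - u) (X k - u)) \<longlonglongrightarrow> 0"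
    "\<And>s. s \<in> S \<Longrightarrow> ip u s = l s"
proof -
  define J where "J s = ip s s - 2 * l s" for s
  define j where "j = Inf (J ` S)"
  have SV: "s \<in> V" if "s \<in> S" for s using S that by auto
  have J_lower: "- M\<^sup>2 \<le> J s" if "s \<in> S" for s
  proof -
    have "2 * l s \<le> 2 * (M * sqrt (ip s s))" using bound[OF that] by linarith
    also have "\<dots> \<le> M\<^sup>2 + (sqrt (ip s s))\<^sup>2" using sum_squares_bound[of M "sqrt (ip s s)"] by (simp add: mult.assoc)
    finally show ?thesis using ip_nonneg[OF SV[OF that]] by (simp add: J_def)
  qed
  have bdd: "bdd_below (J ` S)" using J_lower by (auto intro!: bdd_belowI2)
  have j_le: "j \<le> J s" if "s \<in> S" for s
    unfolding j_def using bdd that by (rule cINF_lower)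
  have "\<exists>s\<in>S. J s < j + 1 / real (Suc k)" for k
  proof -
    have "0 \<in> S" using S by (simp add: subspace_0)
    then have "J ` S \<noteq> {}" by blast
    from cInf_lessD[OF this, of "j + 1 / real (Suc k)"] show ?thesis by (auto simp: j_def)
  qed
  then obtain X where X: "\<And>k. X k \<in> S" and JX: "\<And>k. J (X k) < j + 1 / real (Suc k)" by metis
  define q where "q k = 1 / real (Suc k)" for k
  have Jq: "J (X k) < j + q k" for k using JX by (simp add: q_def)
  have "ip (X i - X k) (X i - X k) \<le> 2 * q i + 2 * q k" for i k
  proof -
    let ?m = "(1/2) *\<^sub>R (X i + X k)"
    have m: "?m \<in> S" using S X by (intro subspace_scale subspace_add)
    have Jm: "J ?m = (ip (X i) (X i) + 2 * ip (X i) (X k) + ip (X k) (X k)) / 4 - l (X i) - l (X k)"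
      using X SV S by (simp add: J_def scale add subspace_add subspace_scale ip_simps ip_sym[of "X k" "X i"] field_simps)
    have "ip (X i - X k) (X i - X k) = 2 * J (X i) + 2 * J (X k) - 4 * J ?m"
      unfolding Jm using X SV by (simp add: J_def ip_simps ip_sym[of "X k" "X i"] field_simps)
    also have "\<dots> \<le> 2 * q i + 2 * q k"
      using Jq[of i] Jq[of k] j_le[OF m] by linarith
    finally show ?thesis .
  qed note cauchy = this
  have "\<exists>N. \<forall>i\<ge>N. \<forall>k\<ge>N. ip (X i - X k) (X i - X k) < e" if e: "e > 0" for e
  proof -
    obtain N where N: "1 / real (Suc N) < e / 4"
      by (rule nat_approx_posE[of "e / 4"]) (use e in auto)
    have q: "q i < e / 4" if "i \<ge> N" for i
    proof -
      have "q i \<le> 1 / real (Suc N)" unfolding q_def using that by (intro divide_left_mono) auto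
      then show ?thesis using N by (rule le_less_trans)
    qed
    have "ip (X i - X k) (X i - X k) < e" if "i \<ge> N" "k \<ge> N" for i k
      using q[OF that(1)] q[OF that(2)] cauchy[of i k] by linarith
    then show ?thesis by blast
  qed
  then obtain u where u: "u \<in> V" and lim: "(\<lambda>k. ip (X k - u) (X k - u)) \<longlonglongrightarrow> 0"
    using complete[of X] X SV by blast
  have "ip u s = l s" if s: "s \<in> S" for s
  proof -
    have ineq: "0 \<le> 2 * t * (ip u s - l s) + t\<^sup>2 * ip s s" for t
    proof (rule LIMSEQ_le[of "\<lambda>_. 0" 0 "\<lambda>k. 2 * t * (ip (X k) s - l s) + t\<^sup>2 * ip s s + 1 / real (Suc k)"])
      show "(\<lambda>k. 2 * t * (ip (X k) s - l s) + t\<^sup>2 * ip s s + 1 / real (Suc k))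
          \<longlonglongrightarrow> 2 * t * (ip u s - l s) + t\<^sup>2 * ip s s"
      proof -
        have "(\<lambda>k. ip (X k) s) \<longlonglongrightarrow> ip u s"
          using X SV u s lim by (intro tendsto_ip_left) auto
        then have "(\<lambda>k. 2 * t * (ip (X k) s - l s) + t\<^sup>2 * ip s s + 1 / real (Suc k))
          \<longlonglongrightarrow> 2 * t * (ip u s - l s) + t\<^sup>2 * ip s s + 0"
          by (intro tendsto_intros lim_1_over_n[THEN LIMSEQ_Suc])
        then show ?thesis by simp
      qed
      have "0 \<le> 2 * t * (ip (X k) s - l s) + t\<^sup>2 * ip s s + 1 / real (Suc k)" for k
      proof -
        have "X k + t *\<^sub>R s \<in> S" using S X s by (intro subspace_scale subspace_add)
        then have "j \<le> J (X k + t *\<^sub>R s)" by (rule j_le)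
        also have "\<dots> = J (X k) + 2 * t * (ip (X k) s - l s) + t\<^sup>2 * ip s s"
          using X s SV S by (simp add: J_def add scale subspace_scale ip_simps ip_sym[of s "X k"] power2_eq_square algebra_simps)
        finally show ?thesis using JX[of k] by linarith
      qed
      then show "\<exists>N. \<forall>n\<ge>N. 0 \<le> 2 * t * (ip (X n) s - l s) + t\<^sup>2 * ip s s + 1 / real (Suc n)" by blast
    qed simp
    show ?thesis
    proof (rule ccontr)
      assume n: "ip u s \<noteq> l s"
      define d where "d = ip u s - l s"
      define a where "a = ip s s + 1"
      have a: "a > 0" "ip s s < a" using ip_nonneg[OF SV[OF s]] by (auto simp: a_def)
      have "0 \<le> 2 * (- d / a) * d + (- d / a)\<^sup>2 * ip s s" using ineq[of "- d / a"] by (simp add: d_def)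
      also have "\<dots> \<le> 2 * (- d / a) * d + (- d / a)\<^sup>2 * a" using a by (intro add_left_mono mult_left_mono) auto
      also have "\<dots> = - d\<^sup>2 / a" using a by (simp add: field_simps power2_eq_square)
      finally have "d\<^sup>2 \<le> 0" using a by (simp add: field_simps)
      then show False using n by (simp add: d_def)
    qed
  qed
  with u X lim show ?thesis by (rule that)
qed

definition weakly :: "(nat \<Rightarrow> 'a) \<Rightarrow> 'a \<Rightarrow> bool" where
  "weakly X x \<longleftrightarrow> (\<forall>y\<in>V. (\<lambda>k. ip (X k) y) \<longlonglongrightarrow> ip x y)"

lemma weakly_subseq: "weakly X x \<Longrightarrow> strict_mono r \<Longrightarrow> weakly (\<lambda>k. X (r k)) x"
  unfolding weakly_def using LIMSEQ_subseq_LIMSEQ[of _ _ r] by (fastforce simp: o_def)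

lemma weakly_lower_semicontinuous:
  assumes X: "\<And>k. X k \<in> V" and x: "x \<in> V" and w: "weakly X x" and e: "e > 0"
  shows "\<forall>\<^sub>F k in sequentially. ip x x - e < ip (X k) (X k)"
proof -
  have "(\<lambda>k. 2 * ip (X k) x - ip x x) \<longlonglongrightarrow> 2 * ip x x - ip x x"
    using w x unfolding weakly_def by (intro tendsto_intros) auto
  then have "\<forall>\<^sub>F k in sequentially. 2 * ip (X k) x - ip x x > ip x x - e"
    by (rule order_tendstoD) (use e in simp)
  then show ?thesis
  proof eventually_elim
    case (elim k)
    have "0 \<le> ip (X k - x) (X k - x)" using X x by (intro ip_nonneg) auto
    then show ?case using elim X x by (simp add: ip_simps ip_sym[of x "X k"])
  qed
qed

text \<open>
  By Cauchy-Schwarz, the norm bound on the weakly convergent factor makes the error of the strongly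
  convergent factor harmless.
\<close>

lemma weakly_strongly:
  assumes X: "\<And>k. X k \<in> V" and x: "x \<in> V" and w: "weakly X x" and B: "\<And>k. ip (X k) (X k) \<le> B"
    and Y: "\<And>k. Y k \<in> V" and y: "y \<in> V" and lim: "(\<lambda>k. ip (Y k - y) (Y k - y)) \<longlonglongrightarrow> 0"
  shows "(\<lambda>k. ip (X k) (Y k)) \<longlonglongrightarrow> ip x y"
proof -
  have "(\<lambda>k. sqrt B * sqrt (ip (Y k - y) (Y k - y))) \<longlonglongrightarrow> sqrt B * sqrt 0"
    by (intro tendsto_intros lim)
  moreover have "\<bar>ip (X k) (Y k - y)\<bar> \<le> sqrt B * sqrt (ip (Y k - y) (Y k - y))" for k
  proof -
    have "\<bar>ip (X k) (Y k - y)\<bar> \<le> sqrt (ip (X k) (X k)) * sqrt (ip (Y k - y) (Y k - y))"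
      using Cauchy_Schwarz_abs[of "X k" "Y k - y"] X Y y by simp
    also have "\<dots> \<le> sqrt B * sqrt (ip (Y k - y) (Y k - y))"
      using B[of k] Y y by (intro mult_right_mono) (auto simp: ip_nonneg)
    finally show ?thesis .
  qed
  ultimately have "(\<lambda>k. ip (X k) (Y k - y)) \<longlonglongrightarrow> 0"
    by (rule null_if_abs_le) simp
  moreover have "(\<lambda>k. ip (X k) y) \<longlonglongrightarrow> ip x y" using w y by (simp add: weakly_def)
  ultimately have "(\<lambda>k. ip (X k) (Y k - y) + ip (X k) y) \<longlonglongrightarrow> 0 + ip x y" by (rule tendsto_add)
  then show ?thesis using X Y y by (simp add: ip_diff_right)
qed

lemma strongly_imp_bounded:
  fixes X :: "nat \<Rightarrow> 'a"
  assumes X: "\<And>k. X k \<in> V" and x: "x \<in> V" and lim: "(\<lambda>k. ip (X k - x) (X k - x)) \<longlonglongrightarrow> 0"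
  obtains B where "\<And>k. ip (X k) (X k) \<le> B"
proof -
  obtain C where C: "\<And>k. \<bar>ip (X k - x) (X k - x)\<bar> \<le> C"
    using convergent_imp_Bseq[OF convergentI[OF lim]] by (auto simp: Bseq_def)
  have "ip (X k) (X k) \<le> 2 * C + 2 * ip x x" for k
  proof -
    have "0 \<le> ip (X k - x - x) (X k - x - x)" using X x by (intro ip_nonneg) auto
    then have "ip (X k) (X k) \<le> 2 * ip (X k - x) (X k - x) + 2 * ip x x"
      using X x by (simp add: ip_simps ip_sym[of x "X k"])
    then show ?thesis using C[of k] by linarith
  qed
  then show ?thesis by (rule that)
qed

lemma strongly_imp_weakly:
  assumes "\<And>k. X k \<in> V" "x \<in> V" "(\<lambda>k. ip (X k - x) (X k - x)) \<longlonglongrightarrow> 0"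
  shows "weakly X x"
  unfolding weakly_def using assms by (auto intro: tendsto_ip_left)

lemma tendsto_ip:
  assumes X: "\<And>k. X k \<in> V" "x \<in> V" "(\<lambda>k. ip (X k - x) (X k - x)) \<longlonglongrightarrow> 0"
    and Y: "\<And>k. Y k \<in> V" "y \<in> V" "(\<lambda>k. ip (Y k - y) (Y k - y)) \<longlonglongrightarrow> 0"
  shows "(\<lambda>k. ip (X k) (Y k)) \<longlonglongrightarrow> ip x y"
proof -
  obtain B where "\<And>k. ip (X k) (X k) \<le> B" using strongly_imp_bounded[OF X] by blast
  then show ?thesis using X Y strongly_imp_weakly[OF X] by (intro weakly_strongly) auto
qed

text \<open>
  Along a diagonal subsequence the inner products with the members of the sequence itself converge,
  hence so do those with their span \<open>S\<close>, and the limit functional is represented by some \<open>u\<close> in the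
  closure of \<open>S\<close>. A general vector is replaced by its projection onto the closure of \<open>S\<close>, which is
  again a Riesz representation; neither \<open>u\<close> nor the sequence sees the difference.
\<close>

theorem weak_sequential_compactness:
  fixes X :: "nat \<Rightarrow> 'a"
  assumes X: "\<And>k. X k \<in> V" and B: "\<And>k. ip (X k) (X k) \<le> B"
  obtains r x where "strict_mono r" "x \<in> V" "weakly (\<lambda>k. X (r k)) x"
proof -
  define P where "P n s \<longleftrightarrow> convergent (\<lambda>k. ip (X (s k)) (X n))" for n :: nat and s :: "nat \<Rightarrow> nat"
  have bound: "\<bar>ip (X k) y\<bar> \<le> sqrt B * sqrt (ip y y)" if "y \<in> V" for k y
  proof -
    have "\<bar>ip (X k) y\<bar> \<le> sqrt (ip (X k) (X k)) * sqrt (ip y y)"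
      using Cauchy_Schwarz_abs[OF X that] .
    also have "\<dots> \<le> sqrt B * sqrt (ip y y)"
      using B[of k] that by (intro mult_right_mono) (auto simp: ip_nonneg)
    finally show ?thesis .
  qed
  interpret subseqs P
  proof
    fix n and s :: "nat \<Rightarrow> nat"
    have "bounded (range (\<lambda>k. ip (X (s k)) (X n)))"
      using bound[OF X] by (auto simp: bounded_iff)
    then obtain l r where "strict_mono r" "((\<lambda>k. ip (X (s k)) (X n)) \<circ> r) \<longlonglongrightarrow> l"
      using bounded_imp_convergent_subsequence by blast
    then show "\<exists>r'. strict_mono r' \<and> P n (s \<circ> r')"
      by (auto simp: P_def convergent_def o_def)
  qed
  define r where "r = diagseq"
  have r: "strict_mono r" using subseq_diagseq by (simp add: r_def)
  have conv_gen: "convergent (\<lambda>k. ip (X (r k)) (X n))" for n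
  proof -
    have "P n (diagseq \<circ> (+) (Suc n))"
    proof (rule diagseq_holds)
      fix q s :: "nat \<Rightarrow> nat" and n
      assume q: "strict_mono q" and "P n s"
      then obtain l where "(\<lambda>k. ip (X (s k)) (X n)) \<longlonglongrightarrow> l" by (auto simp: P_def convergent_def)
      from LIMSEQ_subseq_LIMSEQ[OF this q] show "P n (s \<circ> q)"
        by (auto simp: P_def convergent_def o_def)
    qed
    then obtain l where "(\<lambda>k. ip (X (r (Suc n + k))) (X n)) \<longlonglongrightarrow> l"
      by (auto simp: P_def convergent_def r_def o_def)
    then have "(\<lambda>k. ip (X (r (k + Suc n))) (X n)) \<longlonglongrightarrow> l" by (simp add: add.commute)
    then have "(\<lambda>k. ip (X (r k)) (X n)) \<longlonglongrightarrow> l" by (rule LIMSEQ_offset)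
    then show ?thesis by (auto simp: convergent_def)
  qed
  define S where "S = span (range X)"
  have S: "subspace S" "S \<subseteq> V"
    using X span_minimal[OF _ sub, of "range X"] by (auto simp: S_def)
  have XS: "X k \<in> S" for k by (auto simp: S_def intro: span_base)
  have SV: "s \<in> V" if "s \<in> S" for s using S that by auto
  have "s \<in> V \<and> convergent (\<lambda>k. ip (X (r k)) s)" if "s \<in> S" for s
    using that unfolding S_def
  proof (induction rule: span_induct_alt)
    case base
    then show ?case using X by (simp add: convergent_const)
  next
    case (step c x y)
    then obtain n where n: "x = X n" by auto
    have "ip (X (r k)) (c *\<^sub>R x + y) = c * ip (X (r k)) (X n) + ip (X (r k)) y" for k
      using X step by (simp add: n ip_simps)
    then show ?case using step conv_gen[of n] X
      by (simp add: n convergent_add convergent_mult convergent_const)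
  qed
  then have conv: "convergent (\<lambda>k. ip (X (r k)) s)" if "s \<in> S" for s
    using that by blast
  define l where "l s = lim (\<lambda>k. ip (X (r k)) s)" for s
  have l: "(\<lambda>k. ip (X (r k)) s) \<longlonglongrightarrow> l s" if "s \<in> S" for s
    using conv[OF that] by (simp add: l_def convergent_LIMSEQ_iff)
  obtain u Z where u: "u \<in> V" "\<And>k. Z k \<in> S" "(\<lambda>k. ip (Z k - u) (Z k - u)) \<longlonglongrightarrow> 0"
    "\<And>s. s \<in> S \<Longrightarrow> ip u s = l s"
  proof (rule Riesz_on_subspace[OF S, of l "sqrt B"])
    fix x y assume xy: "x \<in> S" "y \<in> S"
    have "(\<lambda>k. ip (X (r k)) (x + y)) \<longlonglongrightarrow> l x + l y"
      using tendsto_add[OF l[OF xy(1)] l[OF xy(2)]] X xy SV by (simp add: ip_simps)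
    then show "l (x + y) = l x + l y" unfolding l_def[of "x + y"] by (rule limI)
  next
    fix x c assume x: "x \<in> S"
    have "(\<lambda>k. ip (X (r k)) (c *\<^sub>R x)) \<longlonglongrightarrow> c * l x"
      using tendsto_mult_left[OF l[OF x]] X x SV by (simp add: ip_simps)
    then show "l (c *\<^sub>R x) = c * l x" unfolding l_def[of "c *\<^sub>R x"] by (rule limI)
  next
    fix x assume x: "x \<in> S"
    show "\<bar>l x\<bar> \<le> sqrt B * sqrt (ip x x)"
      by (rule LIMSEQ_le_const2[OF tendsto_rabs[OF l[OF x]]]) (use bound SV[OF x] in blast)
  qed blast
  have "weakly (\<lambda>k. X (r k)) u"
    unfolding weakly_def
  proof
    fix v assume v: "v \<in> V"
    obtain p Y where p: "p \<in> V" "\<And>k. Y k \<in> S" "(\<lambda>k. ip (Y k - p) (Y k - p)) \<longlonglongrightarrow> 0"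
      "\<And>s. s \<in> S \<Longrightarrow> ip p s = ip v s"
    proof (rule Riesz_on_subspace[OF S, of "ip v" "sqrt (ip v v)"])
      show "\<bar>ip v x\<bar> \<le> sqrt (ip v v) * sqrt (ip x x)" if "x \<in> S" for x
        using Cauchy_Schwarz_abs[OF v SV[OF that]] .
    qed (use v SV in \<open>auto simp: ip_simps\<close>)
    have eqX: "ip (X k) v = ip (X k) p" for k
      using p XS X v by (metis ip_sym)
    have equ: "ip u v = ip u p"
    proof (rule LIMSEQ_unique)
      show "(\<lambda>k. ip (Z k) v) \<longlonglongrightarrow> ip u v" using u v SV by (intro tendsto_ip_left) auto
      have "ip (Z k) v = ip (Z k) p" for k using p(1,4) u(2) SV v by (metis ip_sym)
      then show "(\<lambda>k. ip (Z k) v) \<longlonglongrightarrow> ip u p" using u p SV tendsto_ip_left[of Z u p] by auto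
    qed
    have "(\<lambda>k. ip (X (r k)) p) \<longlonglongrightarrow> ip u p"
    proof (rule LIMSEQ_I)
      fix e :: real assume e: "e > 0"
      define b where "b = sqrt B + sqrt (ip u u) + 1"
      have b: "b > 0" "sqrt B \<le> b" "sqrt (ip u u) \<le> b"
        using order_trans[OF ip_nonneg[OF X] B] ip_nonneg[OF u(1)] by (auto simp: b_def add_nonneg_pos)
      have "(\<lambda>i. sqrt (ip (Y i - p) (Y i - p))) \<longlonglongrightarrow> sqrt 0" by (intro tendsto_intros p)
      then have "\<forall>\<^sub>F i in sequentially. sqrt (ip (Y i - p) (Y i - p)) < e / (3 * b)"
        by (rule order_tendstoD) (use e b in auto)
      then obtain i where i: "sqrt (ip (Y i - p) (Y i - p)) < e / (3 * b)"
        by (auto simp: eventually_sequentially)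
      have YV: "Y i \<in> V" using p SV by auto
      have small: "\<bar>ip a (Y i - p)\<bar> < e / 3" if "a \<in> V" "sqrt (ip a a) \<le> b" for a
      proof -
        have "\<bar>ip a (Y i - p)\<bar> \<le> sqrt (ip a a) * sqrt (ip (Y i - p) (Y i - p))"
          using that YV p by (intro Cauchy_Schwarz_abs) auto
        also have "\<dots> \<le> b * sqrt (ip (Y i - p) (Y i - p))"
          using that YV p by (intro mult_right_mono) (auto simp: ip_nonneg)
        also have "\<dots> < b * (e / (3 * b))" using i b by (intro mult_strict_left_mono) auto
        finally show ?thesis using b by simp
      qed
      have "(\<lambda>k. ip (X (r k)) (Y i)) \<longlonglongrightarrow> ip u (Y i)" using l[OF p(2)] u(4)[OF p(2)] by simp
      then obtain N where N: "\<And>k. k \<ge> N \<Longrightarrow> norm (ip (X (r k)) (Y i) - ip u (Y i)) < e / 3"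
        using LIMSEQ_D[of _ _ "e/3"] e by (metis divide_pos_pos zero_less_numeral)
      show "\<exists>no. \<forall>n\<ge>no. norm (ip (X (r n)) p - ip u p) < e"
      proof (intro exI[of _ N] allI impI)
        fix k assume "k \<ge> N"
        have "\<bar>ip (X (r k)) (Y i - p)\<bar> < e / 3"
          using X B[of "r k"] b by (intro small) (auto intro: order_trans[OF real_sqrt_le_mono])
        moreover have "\<bar>ip u (Y i - p)\<bar> < e / 3" using u b by (intro small) auto
        ultimately show "norm (ip (X (r k)) p - ip u p) < e"
          using N[OF \<open>k \<ge> N\<close>] X u p YV unfolding real_norm_def ip_diff_right[OF YV p(1) X] ip_diff_right[OF YV p(1) u(1)]
          by linarith
      qed
    qed
    then show "(\<lambda>k. ip (X (r k)) v) \<longlonglongrightarrow> ip u v" by (simp add: eqX equ)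
  qed
  with r u(1) show ?thesis by (rule that)
qed

text \<open>
  Sokal's proof of uniform boundedness: if the norms were unbounded, one could add corrections of
  size \<open>3\<^sup>-\<^sup>j\<close> to build a vector whose products with a subsequence grow at least like \<open>(4/3)\<^sup>j\<close>.
\<close>

theorem uniform_boundedness:
  fixes X :: "nat \<Rightarrow> 'a"
  assumes X: "\<And>k. X k \<in> V" and bdd: "\<And>y. y \<in> V \<Longrightarrow> \<exists>C. \<forall>k. \<bar>ip (X k) y\<bar> \<le> C"
  shows "\<exists>B. \<forall>k. ip (X k) (X k) \<le> B"
proof (rule ccontr)
  define nrm where "nrm x = sqrt (ip x x)" for x
  assume "\<nexists>B. \<forall>k. ip (X k) (X k) \<le> B"
  then have "\<exists>k. ip (X k) (X k) > (4 ^ j)\<^sup>2" for j :: nat by (meson not_le)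
  then obtain m where m: "\<And>j. ip (X (m j)) (X (m j)) > (4 ^ j)\<^sup>2" by metis
  have N: "nrm (X (m j)) > 4 ^ j" for j
    unfolding nrm_def using m[of j] by (rule real_less_rsqrt)
  have step: "\<exists>x'\<in>V. nrm (x' - x) \<le> (1/3) ^ j \<and> (1/3) ^ j * nrm (X (m j)) \<le> \<bar>ip (X (m j)) x'\<bar>" if x: "x \<in> V" for x j
  proof -
    let ?u = "X (m j)"
    define c where "c = (1/3) ^ j / nrm ?u"
    have pos: "nrm ?u > 0" using N[of j] by (meson less_trans zero_less_numeral zero_less_power)
    then have sq: "ip ?u ?u = nrm ?u * nrm ?u" by (simp add: nrm_def)
    have c: "c > 0" using pos by (simp add: c_def)
    have size: "nrm (a *\<^sub>R ?u) \<le> (1/3) ^ j" if "\<bar>a\<bar> = c" for a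
    proof -
      have "nrm (a *\<^sub>R ?u) = \<bar>a\<bar> * nrm ?u"
        unfolding nrm_def using X by (simp add: ip_simps real_sqrt_mult flip: mult.assoc)
      then show ?thesis using pos that by (simp add: c_def)
    qed
    have big: "c * ip ?u ?u = (1/3) ^ j * nrm ?u" using pos by (simp add: c_def sq)
    have "ip ?u (x + c *\<^sub>R ?u) = ip ?u x + c * ip ?u ?u" "ip ?u (x + (-c) *\<^sub>R ?u) = ip ?u x - c * ip ?u ?u"
      using X x by (auto simp: ip_add_right ip_scale_right simp del: scaleR_minus_left)
    then have "(1/3) ^ j * nrm ?u \<le> \<bar>ip ?u (x + c *\<^sub>R ?u)\<bar> \<or> (1/3) ^ j * nrm ?u \<le> \<bar>ip ?u (x + (-c) *\<^sub>R ?u)\<bar>"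
      using big by linarith
    then obtain a where "\<bar>a\<bar> = c" "(1/3) ^ j * nrm ?u \<le> \<bar>ip ?u (x + a *\<^sub>R ?u)\<bar>" using c by (metis abs_minus_cancel abs_of_pos)
    then show ?thesis using size[of a] x X by (intro bexI[of _ "x + a *\<^sub>R ?u"]) auto
  qed
  define h where "h j x = (SOME x'. x' \<in> V \<and> nrm (x' - x) \<le> (1/3) ^ j \<and>
      (1/3) ^ j * nrm (X (m j)) \<le> \<bar>ip (X (m j)) x'\<bar>)" for j x
  have h: "h j x \<in> V" "nrm (h j x - x) \<le> (1/3) ^ j" "(1/3) ^ j * nrm (X (m j)) \<le> \<bar>ip (X (m j)) (h j x)\<bar>"
    if "x \<in> V" for j x
    using someI_ex[OF step[OF that, of j, unfolded Bex_def], folded h_def] by auto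
  define Y where "Y = rec_nat 0 h"
  have Y_Suc: "Y (Suc j) = h j (Y j)" for j by (simp add: Y_def)
  have YV: "Y j \<in> V" for j by (induction j) (auto simp: Y_def h(1))
  have tri: "nrm (a - c) \<le> nrm (a - b) + nrm (b - c)" if "a \<in> V" "b \<in> V" "c \<in> V" for a b c
    using sqrt_ip_triangle[of "a - b" "b - c"] that by (simp add: nrm_def)
  have dist: "nrm (Y (j + p) - Y j) \<le> 3/2 * (1/3) ^ j * (1 - (1/3) ^ p)" for j p
  proof (induction p)
    case 0
    then show ?case by (simp add: nrm_def)
  next
    case (Suc p)
    have "nrm (Y (j + Suc p) - Y j) \<le> nrm (Y (j + Suc p) - Y (j + p)) + nrm (Y (j + p) - Y j)"
      using YV by (intro tri)
    also have "nrm (Y (j + Suc p) - Y (j + p)) \<le> (1/3) ^ (j + p)"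
      using h(2)[OF YV, of "j + p" "j + p"] by (simp add: Y_Suc)
    also note Suc
    finally show ?case by (simp add: power_add field_simps)
  qed
  have dist': "nrm (Y i - Y j) \<le> 3/2 * (1/3) ^ j" if "j \<le> i" for i j
  proof -
    have "nrm (Y i - Y j) \<le> 3/2 * (1/3) ^ j * (1 - (1/3) ^ (i - j))" using dist[of j "i - j"] that by simp
    also have "\<dots> \<le> 3/2 * (1/3) ^ j * 1" by (intro mult_left_mono) auto
    finally show ?thesis by simp
  qed
  have "\<exists>x\<in>V. (\<lambda>k. ip (Y k - x) (Y k - x)) \<longlonglongrightarrow> 0"
  proof (rule complete[OF YV])
    fix e :: real assume e: "e > 0"
    have "(\<lambda>j. 3 * (1/3) ^ j) \<longlonglongrightarrow> 3 * (0::real)" by (intro tendsto_intros LIMSEQ_power_zero) auto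
    then have "\<forall>\<^sub>F j in sequentially. 3 * (1/3) ^ j < sqrt e" by (rule order_tendstoD) (use e in simp)
    then obtain j :: nat where j: "3 * (1/3) ^ j < sqrt e" by (auto simp: eventually_sequentially)
    have "ip (Y i - Y k) (Y i - Y k) < e" if "i \<ge> j" "k \<ge> j" for i k
    proof -
      have "nrm (Y i - Y k) \<le> nrm (Y i - Y j) + nrm (Y j - Y k)" using YV by (intro tri)
      also have "nrm (Y j - Y k) = nrm (Y k - Y j)"
        using YV by (simp add: nrm_def ip_simps ip_sym[of "Y j" "Y k"])
      finally have "nrm (Y i - Y k) < sqrt e" using dist'[OF that(1)] dist'[OF that(2)] j by linarith
      then show ?thesis by (simp add: nrm_def)
    qed
    then show "\<exists>N. \<forall>i\<ge>N. \<forall>k\<ge>N. ip (Y i - Y k) (Y i - Y k) < e" by blast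
  qed
  then obtain x where x: "x \<in> V" and lim: "(\<lambda>k. ip (Y k - x) (Y k - x)) \<longlonglongrightarrow> 0" by blast
  have close: "nrm (x - Y j) \<le> 3/2 * (1/3) ^ j" for j
  proof (rule LIMSEQ_le_const)
    have "(\<lambda>k. nrm (Y k - x) + 3/2 * (1/3) ^ j) \<longlonglongrightarrow> sqrt 0 + 3/2 * (1/3) ^ j"
      unfolding nrm_def by (intro tendsto_intros lim)
    then show "(\<lambda>k. nrm (Y k - x) + 3/2 * (1/3) ^ j) \<longlonglongrightarrow> 3/2 * (1/3) ^ j" by simp
    have "nrm (x - Y j) \<le> nrm (Y k - x) + 3/2 * (1/3) ^ j" if "k \<ge> j" for k
    proof -
      have "nrm (x - Y j) \<le> nrm (x - Y k) + nrm (Y k - Y j)" using YV x by (intro tri)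
      also have "nrm (x - Y k) = nrm (Y k - x)"
        using YV x by (simp add: nrm_def ip_simps ip_sym[of x "Y k"])
      finally show ?thesis using dist'[OF that] by linarith
    qed
    then show "\<exists>N. \<forall>n\<ge>N. nrm (x - Y j) \<le> nrm (Y n - x) + 3/2 * (1/3) ^ j" by blast
  qed
  obtain C where C: "\<And>k. \<bar>ip (X k) x\<bar> \<le> C" using bdd[OF x] by blast
  obtain M :: nat where "2 * C < (4/3) ^ M" using real_arch_pow[of "4/3" "2 * C"] by auto
  then have M: "C < 1/2 * (4/3) ^ M" by simp
  have "1/2 * (4/3) ^ j \<le> C" for j :: nat
  proof -
    let ?u = "X (m j)"
    have "(1/3) ^ j * nrm ?u \<le> \<bar>ip ?u (Y (Suc j))\<bar>" using h(3)[OF YV] by (simp add: Y_Suc)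
    also have "ip ?u (Y (Suc j)) = ip ?u x - ip ?u (x - Y (Suc j))" using X x YV by (simp add: ip_diff_right)
    also have "\<bar>ip ?u x - ip ?u (x - Y (Suc j))\<bar> \<le> \<bar>ip ?u x\<bar> + \<bar>ip ?u (x - Y (Suc j))\<bar>" by linarith
    also have "\<bar>ip ?u (x - Y (Suc j))\<bar> \<le> nrm ?u * nrm (x - Y (Suc j))"
      unfolding nrm_def using X x YV by (intro Cauchy_Schwarz_abs) auto
    also have "\<dots> \<le> nrm ?u * (3/2 * (1/3) ^ Suc j)"
      using X by (intro mult_left_mono close) (simp add: nrm_def ip_nonneg)
    finally have "1/2 * ((1/3) ^ j * nrm ?u) \<le> \<bar>ip ?u x\<bar>" by (simp add: field_simps)
    then have le_C: "1/2 * ((1/3) ^ j * nrm ?u) \<le> C" using C by (rule order_trans)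
    have "1/2 * (4/3::real) ^ j = 1/2 * ((1/3) ^ j * 4 ^ j)" by (simp flip: power_mult_distrib)
    also have "\<dots> \<le> 1/2 * ((1/3) ^ j * nrm ?u)"
      using N[of j] by (intro mult_left_mono) auto
    also note le_C
    finally show ?thesis .
  qed
  with M show False by (meson not_le)
qed

end

section \<open>The space of square integrable functions\<close>

abbreviation L2_sq :: "real \<Rightarrow> (real \<Rightarrow> real) \<Rightarrow> real" where
  "L2_sq L z \<equiv> L2_inner L z z"

lemma finite_measure_Om: "finite_measure (Om L)"
  by (rule finite_measure_lebesgue_on) (simp add: lmeasurable_interval)

lemma space_Om [simp]: "space (Om L) = {-L<..<L}"
  by simp

lemma integrable_Om_bounded:
  assumes "h \<in> borel_measurable (Om L)" and "AE x in Om L. \<bar>h x\<bar> \<le> (B::real)"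
  shows "integrable (Om L) h"
  by (rule finite_measure.integrable_const_bound[OF finite_measure_Om, where B=B]) (use assms in auto)

lemma L2_measurable [measurable_dest]: "z \<in> L2 L \<Longrightarrow> z \<in> borel_measurable (Om L)"
  by (simp add: L2_def)

lemma L2_integrable_mult:
  assumes "y \<in> L2 L" and "z \<in> L2 L"
  shows "integrable (Om L) (\<lambda>x. y x * z x)"
proof (rule Bochner_Integration.integrable_bound)
  show "integrable (Om L) (\<lambda>x. (y x)\<^sup>2 + (z x)\<^sup>2)" using assms by (simp add: L2_def)
  show "(\<lambda>x. y x * z x) \<in> borel_measurable (Om L)"
    using assms[THEN L2_measurable] by measurable
  have "\<bar>a * b\<bar> \<le> a\<^sup>2 + b\<^sup>2" for a b :: real
  proof -
    have "2 * \<bar>a * b\<bar> \<le> a\<^sup>2 + b\<^sup>2"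
      using sum_squares_bound[of "\<bar>a\<bar>" "\<bar>b\<bar>"] by (simp add: abs_mult mult.assoc)
    then show ?thesis using abs_ge_zero[of "a * b"] by linarith
  qed
  then show "AE x in Om L. norm (y x * z x) \<le> norm ((y x)\<^sup>2 + (z x)\<^sup>2)" by simp
qed

lemma L2_square_integrable: "z \<in> L2 L \<Longrightarrow> integrable (Om L) (\<lambda>x. (z x)\<^sup>2)"
  by (simp add: L2_def)

lemma L2_bounded:
  assumes "z \<in> borel_measurable (Om L)" and "AE x in Om L. \<bar>z x\<bar> \<le> (B::real)"
  shows "z \<in> L2 L"
proof -
  have "integrable (Om L) (\<lambda>x. (z x)\<^sup>2)"
  proof (rule integrable_Om_bounded)
    show "AE x in Om L. \<bar>(z x)\<^sup>2\<bar> \<le> B\<^sup>2"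
      using assms(2) by eventually_elim (simp add: abs_le_square_iff[symmetric])
  qed (use assms in measurable)
  then show ?thesis using assms by (simp add: L2_def)
qed

lemma L2_const [simp]: "(\<lambda>x. c) \<in> L2 L"
  by (rule L2_bounded[of _ _ "\<bar>c\<bar>"]) auto

lemma L2_scale [simp]: "z \<in> L2 L \<Longrightarrow> (\<lambda>x. c * z x) \<in> L2 L"
  by (auto simp: L2_def power_mult_distrib)

lemma L2_divide [simp]: "z \<in> L2 L \<Longrightarrow> (\<lambda>x. z x / c) \<in> L2 L"
  using L2_scale[of z L "inverse c"] by (simp add: field_simps)

lemma L2_add [simp]: 
  assumes "y \<in> L2 L" "z \<in> L2 L"
  shows "(\<lambda>x. y x + z x) \<in> L2 L"
proof -
  have "integrable (Om L) (\<lambda>x. (y x)\<^sup>2 + (z x)\<^sup>2 + 2 * (y x * z x))"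
    using assms L2_integrable_mult[OF assms] by (simp add: L2_def)
  then show ?thesis using assms by (auto simp: L2_def power2_sum mult.assoc)
qed

lemma L2_diff [simp]: "y \<in> L2 L \<Longrightarrow> z \<in> L2 L \<Longrightarrow> (\<lambda>x. y x - z x) \<in> L2 L"
  using L2_add[of y L "\<lambda>x. (-1) * z x"] L2_scale[of z L "-1"] by simp

lemma L2_uminus [simp]: "z \<in> L2 L \<Longrightarrow> (\<lambda>x. - z x) \<in> L2 L"
  using L2_scale[of z L "-1"] by simp

lemma L2_integrable: "z \<in> L2 L \<Longrightarrow> integrable (Om L) z"
  using L2_integrable_mult[of z L "\<lambda>_. 1"] by simp

lemma L2_inner_cong_AE:
  assumes "y \<in> L2 L" "z \<in> L2 L" "y' \<in> L2 L" "z' \<in> L2 L"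
    and "AE x in Om L. y x = y' x" "AE x in Om L. z x = z' x"
  shows "L2_inner L y z = L2_inner L y' z'"
  unfolding L2_inner_def
proof (rule integral_cong_AE)
  show "AE x in Om L. y x * z x = y' x * z' x" using assms(5,6) by eventually_elim simp
qed (use assms in measurable)

lemma L2_subspace: "subspace (L2 L)"
  by (auto simp: subspace_def plus_fun_def zero_fun_def scaleR_fun_def)

lemma L2_inner_simps:
  assumes "y \<in> L2 L" "z \<in> L2 L" "w \<in> L2 L"
  shows "L2_inner L (\<lambda>x. y x + z x) w = L2_inner L y w + L2_inner L z w"
    and "L2_inner L (\<lambda>x. y x - z x) w = L2_inner L y w - L2_inner L z w"
    and "L2_inner L w (\<lambda>x. y x + z x) = L2_inner L w y + L2_inner L w z"
    and "L2_inner L w (\<lambda>x. y x - z x) = L2_inner L w y - L2_inner L w z"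
    and "L2_inner L (\<lambda>x. c * y x) w = c * L2_inner L y w"
    and "L2_inner L w (\<lambda>x. c * y x) = c * L2_inner L w y"
  using assms by (simp_all add: L2_inner_def L2_integrable_mult algebra_simps)

lemma L2_inner_sym: "L2_inner L y z = L2_inner L z y"
  by (simp add: L2_inner_def mult.commute)

lemma L2_inner_self_nonneg: "0 \<le> L2_sq L z"
  by (simp add: L2_inner_def)

lemma nn_integral_Fatou_AE:
  fixes u :: "nat \<Rightarrow> 'a \<Rightarrow> ennreal"
  assumes "\<And>i. u i \<in> borel_measurable M" and "AE x in M. v x \<le> liminf (\<lambda>i. u i x)"
  shows "(\<integral>\<^sup>+x. v x \<partial>M) \<le> liminf (\<lambda>i. \<integral>\<^sup>+x. u i x \<partial>M)"
  using nn_integral_mono_AE[OF assms(2)] nn_integral_liminf[of u M, OF assms(1)] by (rule order_trans)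

text \<open>
  An \<open>L\<^sup>2\<close>-Cauchy sequence is \<open>L\<^sup>1\<close>-Cauchy on the bounded interval, hence converges almost
  everywhere along a subsequence, and Fatou's lemma turns the pointwise limit into an \<open>L\<^sup>2\<close>-limit.
\<close>

lemma L2_complete:
  assumes X: "\<And>k. X k \<in> L2 L"
    and cauchy: "\<And>e. e > 0 \<Longrightarrow>
      \<exists>N. \<forall>i\<ge>N. \<forall>j\<ge>N. L2_sq L (\<lambda>x. X i x - X j x) < e"
  shows "\<exists>z\<in>L2 L. (\<lambda>k. L2_sq L (\<lambda>x. X k x - z x)) \<longlonglongrightarrow> 0"
proof -
  define D where "D i j = (LINT x|Om L. (X i x - X j x)\<^sup>2)" for i j
  have cauchy: "\<exists>N. \<forall>i\<ge>N. \<forall>j\<ge>N. D i j < e" if "e > 0" for e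
    using cauchy[OF that] by (simp add: L2_inner_def D_def power2_eq_square)
  have mX [measurable]: "X k \<in> borel_measurable (Om L)" for k using X by measurable
  have "\<exists>N. \<forall>i\<ge>N. \<forall>j\<ge>N. (LINT x|Om L. norm (X i x - X j x)) < e" if e: "e > 0" for e
  proof -
    define m where "m = measure (Om L) (space (Om L)) + 1"
    have m: "m > 0" "measure (Om L) (space (Om L)) < m" by (auto simp: m_def add_nonneg_pos)
    (* Young's inequality with weight a bounds the L1 norm by a * m / 2 plus a multiple of D. *)
    define a where "a = e / m"
    have a: "a > 0" using e m by (simp add: a_def)
    obtain N where N: "\<And>i j. i \<ge> N \<Longrightarrow> j \<ge> N \<Longrightarrow> D i j < a * e" using cauchy[of "a * e"] a e by auto
    have "(LINT x|Om L. norm (X i x - X j x)) < e" if "i \<ge> N" "j \<ge> N" for i j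
    proof -
      have int: "integrable (Om L) (\<lambda>x. a / 2 + (X i x - X j x)\<^sup>2 / (2 * a))"
        using L2_square_integrable[OF L2_diff[OF X[of i] X[of j]]] finite_measure.integrable_const[OF finite_measure_Om]
        by (intro Bochner_Integration.integrable_add) auto
      have "(LINT x|Om L. norm (X i x - X j x)) \<le> (LINT x|Om L. a / 2 + (X i x - X j x)\<^sup>2 / (2 * a))"
      proof (rule integral_mono[OF _ int])
        show "integrable (Om L) (\<lambda>x. norm (X i x - X j x))"
          using X by (intro integrable_norm L2_integrable L2_diff)
        show "norm (X i x - X j x) \<le> a / 2 + (X i x - X j x)\<^sup>2 / (2 * a)" for x
          using sum_squares_bound[of a "\<bar>X i x - X j x\<bar>"] a by (simp add: field_simps power2_eq_square)
      qed
      also have "\<dots> = measure (Om L) (space (Om L)) * (a / 2) + D i j / (2 * a)"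
        using L2_square_integrable[OF L2_diff[OF X[of i] X[of j]]] finite_measure.integrable_const[OF finite_measure_Om]
        by (subst Bochner_Integration.integral_add) (auto simp: D_def)
      also have "\<dots> < m * (a / 2) + (a * e) / (2 * a)"
        using m a N[OF that] by (intro add_strict_mono mult_strict_right_mono divide_strict_right_mono) auto
      also have "\<dots> = e" using m a by (simp add: a_def)
      finally show ?thesis .
    qed
    then show ?thesis by blast
  qed
  then obtain r where r: "strict_mono r" "AE x in Om L. Cauchy (\<lambda>i. X (r i) x)"
    using cauchy_L1_AE_cauchy_subseq[of "Om L" X] X L2_integrable by blast
  define z where "z x = lim (\<lambda>i. X (r i) x)" for x
  have mz [measurable]: "z \<in> borel_measurable (Om L)"
    unfolding z_def by (rule borel_measurable_lim_metric) simp
  have lim: "AE x in Om L. (\<lambda>i. X (r i) x) \<longlonglongrightarrow> z x"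
    using r(2) by eventually_elim (simp add: z_def Cauchy_convergent convergent_LIMSEQ_iff[symmetric])
  have est: "(\<integral>\<^sup>+x. ennreal ((X k x - z x)\<^sup>2) \<partial>Om L) \<le> ennreal e"
    if N: "\<forall>i\<ge>N. \<forall>j\<ge>N. D i j < e" and k: "k \<ge> N" for e N k
  proof -
    have "(\<integral>\<^sup>+x. ennreal ((X k x - z x)\<^sup>2) \<partial>Om L)
        \<le> liminf (\<lambda>i. \<integral>\<^sup>+x. ennreal ((X k x - X (r i) x)\<^sup>2) \<partial>Om L)"
    proof (rule nn_integral_Fatou_AE)
      show "AE x in Om L. ennreal ((X k x - z x)\<^sup>2) \<le> liminf (\<lambda>i. ennreal ((X k x - X (r i) x)\<^sup>2))"
        using lim
      proof eventually_elim
        case (elim x)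
        have "(\<lambda>i. ennreal ((X k x - X (r i) x)\<^sup>2)) \<longlonglongrightarrow> ennreal ((X k x - z x)\<^sup>2)"
          by (intro tendsto_ennrealI tendsto_intros elim)
        from lim_imp_Liminf[OF sequentially_bot this] show ?case by (metis order_refl)
      qed
    qed measurable
    also have "\<dots> \<le> limsup (\<lambda>i. \<integral>\<^sup>+x. ennreal ((X k x - X (r i) x)\<^sup>2) \<partial>Om L)"
      by (rule Liminf_le_Limsup) simp
    also have "\<dots> \<le> ennreal e"
    proof (rule Limsup_bounded)
      show "\<forall>\<^sub>F i in sequentially. (\<integral>\<^sup>+x. ennreal ((X k x - X (r i) x)\<^sup>2) \<partial>Om L) \<le> ennreal e"
        using eventually_ge_at_top[of N]
      proof eventually_elim
        case (elim i)
        have "r i \<ge> N" using seq_suble[OF r(1), of i] elim by linarith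
        then have "D k (r i) \<le> e" using N k by (simp add: less_imp_le)
        moreover have "(\<integral>\<^sup>+x. ennreal ((X k x - X (r i) x)\<^sup>2) \<partial>Om L) = ennreal (D k (r i))"
          unfolding D_def using L2_square_integrable[OF L2_diff[OF X[of k] X[of "r i"]]]
          by (intro nn_integral_eq_integral) auto
        ultimately show ?case by (simp add: ennreal_leI)
      qed
    qed
    finally show ?thesis .
  qed
  have diff: "(\<lambda>x. X k x - z x) \<in> L2 L" if N: "\<forall>i\<ge>N. \<forall>j\<ge>N. D i j < e" and k: "k \<ge> N" for e N k
  proof -
    have "integrable (Om L) (\<lambda>x. (X k x - z x)\<^sup>2)"
    proof (rule integrableI_bounded)
      have "(\<integral>\<^sup>+x. ennreal (norm ((X k x - z x)\<^sup>2)) \<partial>Om L) \<le> ennreal e" using est[OF that] by simp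
      also have "\<dots> < \<infinity>" by simp
      finally show "(\<integral>\<^sup>+x. ennreal (norm ((X k x - z x)\<^sup>2)) \<partial>Om L) < \<infinity>" .
    qed measurable
    then show ?thesis by (simp add: L2_def)
  qed
  obtain N1 where N1: "\<forall>i\<ge>N1. \<forall>j\<ge>N1. D i j < 1" using cauchy[of 1] by auto
  have z: "z \<in> L2 L"
    using L2_diff[OF X[of N1] diff[OF N1 order_refl]] by simp
  have "(\<lambda>k. L2_sq L (\<lambda>x. X k x - z x)) \<longlonglongrightarrow> 0"
  proof (rule LIMSEQ_I)
    fix e :: real assume e: "e > 0"
    obtain N where N: "\<forall>i\<ge>N. \<forall>j\<ge>N. D i j < e / 2" using cauchy[of "e/2"] e by auto
    have "norm (L2_sq L (\<lambda>x. X k x - z x) - 0) < e" if "k \<ge> N" for k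
    proof -
      have "ennreal (LINT x|Om L. (X k x - z x)\<^sup>2) \<le> ennreal (e / 2)"
        using est[OF N that] L2_square_integrable[OF L2_diff[OF X[of k] z]]
        by (subst nn_integral_eq_integral[symmetric]) auto
      then have "(LINT x|Om L. (X k x - z x)\<^sup>2) \<le> e / 2" using e by (simp add: ennreal_le_iff)
      moreover have "0 \<le> (LINT x|Om L. (X k x - z x)\<^sup>2)" by simp
      ultimately show ?thesis using e by (simp add: L2_inner_def power2_eq_square)
    qed
    then show "\<exists>no. \<forall>n\<ge>no. norm (L2_sq L (\<lambda>x. X n x - z x) - 0) < e" by blast
  qed
  with z show ?thesis by blast
qed

interpretation L2: semi_hilbert "L2 L" "L2_inner L" for L
proof
  show "subspace (L2 L)" by (rule L2_subspace)
  show "L2_inner L x y = L2_inner L y x" for x y by (rule L2_inner_sym)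
  show "0 \<le> L2_sq L x" for x by (rule L2_inner_self_nonneg)
next
  fix X :: "nat \<Rightarrow> real \<Rightarrow> real" and L assume "\<And>k. X k \<in> L2 L"
    and "\<And>e. e > 0 \<Longrightarrow> \<exists>N. \<forall>i\<ge>N. \<forall>j\<ge>N. L2_sq L (X i - X j) < e"
  then show "\<exists>x\<in>L2 L. (\<lambda>k. L2_sq L (X k - x)) \<longlonglongrightarrow> 0"
    unfolding fun_diff_def by (rule L2_complete)
qed (simp_all add: plus_fun_def scaleR_fun_def L2_inner_simps)

text \<open>On a bounded interval a uniform bound is an integrable majorant.\<close>

lemma L2_bounded_convergence:
  assumes X: "\<And>k. X k \<in> borel_measurable (Om L)" and z: "z \<in> borel_measurable (Om L)"
    and B: "\<And>k. AE x in Om L. \<bar>X k x\<bar> \<le> (B::real)"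
    and lim: "AE x in Om L. (\<lambda>k. X k x) \<longlonglongrightarrow> z x"
  shows "AE x in Om L. \<bar>z x\<bar> \<le> B"
    and "(\<lambda>k. L2_sq L (\<lambda>x. X k x - z x)) \<longlonglongrightarrow> 0"
proof -
  have all: "AE x in Om L. \<forall>k. \<bar>X k x\<bar> \<le> B" using B by (simp add: AE_all_countable)
  show zB: "AE x in Om L. \<bar>z x\<bar> \<le> B"
    using all lim
  proof eventually_elim
    case (elim x)
    from tendsto_rabs[OF elim(2)] show ?case by (rule LIMSEQ_le_const2) (use elim in auto)
  qed
  have "(\<lambda>k. LINT x|Om L. (X k x - z x)\<^sup>2) \<longlonglongrightarrow> (LINT x|Om L. 0)"
  proof (rule integral_dominated_convergence[where w="\<lambda>_. (2 * B)\<^sup>2"])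
    show "integrable (Om L) (\<lambda>_. (2 * B)\<^sup>2)"
      by (rule finite_measure.integrable_const[OF finite_measure_Om])
    show "AE x in Om L. (\<lambda>k. (X k x - z x)\<^sup>2) \<longlonglongrightarrow> 0"
      using lim
    proof eventually_elim
      case (elim x)
      have "(\<lambda>k. (X k x - z x)\<^sup>2) \<longlonglongrightarrow> (z x - z x)\<^sup>2" by (intro tendsto_intros elim)
      then show ?case by simp
    qed
    show "AE x in Om L. norm ((X k x - z x)\<^sup>2) \<le> (2 * B)\<^sup>2" for k
      using B[of k] zB
    proof eventually_elim
      case (elim x)
      then have "\<bar>X k x - z x\<bar> \<le> \<bar>2 * B\<bar>" by linarith
      then show ?case by (simp add: abs_le_square_iff)
    qed
  qed (use X z in measurable)
  then show "(\<lambda>k. L2_sq L (\<lambda>x. X k x - z x)) \<longlonglongrightarrow> 0"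
    by (simp add: L2_inner_def power2_eq_square)
qed

section \<open>Test functions and uniqueness of the weak derivative\<close>

text \<open>
  Differentiability of finite order, so that closure under sums, products and affine substitution
  follows by induction on the order.
\<close>

primrec times_differentiable :: "nat \<Rightarrow> (real \<Rightarrow> real) \<Rightarrow> bool" where
  "times_differentiable 0 f \<longleftrightarrow> (\<forall>x. f differentiable (at x))"
| "times_differentiable (Suc n) f \<longleftrightarrow> (\<forall>x. f differentiable (at x)) \<and> times_differentiable n (deriv f)"

lemma times_differentiable_Suc_imp: "times_differentiable (Suc n) f \<Longrightarrow> times_differentiable n f"
  by (induction n arbitrary: f) auto

lemma smooth_iff_times_differentiable:
  "(\<forall>k x. (deriv ^^ k) f differentiable (at x)) \<longleftrightarrow> (\<forall>n. times_differentiable n f)"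
proof -
  have "times_differentiable n f \<longleftrightarrow> (\<forall>k\<le>n. \<forall>x. (deriv ^^ k) f differentiable (at x))" for n
  proof (induction n arbitrary: f)
    case (Suc n)
    have "(\<forall>k\<le>Suc n. P k) \<longleftrightarrow> P 0 \<and> (\<forall>k\<le>n. P (Suc k))" for P
      by (metis Suc_le_mono le0 not0_implies_Suc)
    then show ?case by (simp only: times_differentiable.simps Suc funpow_Suc_right o_def funpow_0)
  qed simp
  then show ?thesis by blast
qed

lemma real_differentiable_DERIV:
  "(f :: real \<Rightarrow> real) differentiable (at x) \<Longrightarrow> (f has_real_derivative deriv f x) (at x)"
  by (simp add: DERIV_deriv_iff_real_differentiable)

lemma times_differentiable_add:
  "times_differentiable n f \<Longrightarrow> times_differentiable n g \<Longrightarrow> times_differentiable n (\<lambda>x. f x + g x)"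
proof (induction n arbitrary: f g)
  case (Suc n)
  have "deriv (\<lambda>x. f x + g x) = (\<lambda>x. deriv f x + deriv g x)"
    using Suc.prems by (auto intro!: ext DERIV_imp_deriv derivative_intros real_differentiable_DERIV)
  then show ?case using Suc by (auto intro!: derivative_intros)
qed (auto intro!: derivative_intros)

lemma times_differentiable_mult:
  "times_differentiable n f \<Longrightarrow> times_differentiable n g \<Longrightarrow> times_differentiable n (\<lambda>x. f x * g x)"
proof (induction n arbitrary: f g)
  case (Suc n)
  have "deriv (\<lambda>x. f x * g x) = (\<lambda>x. f x * deriv g x + deriv f x * g x)"
    using Suc.prems by (auto intro!: ext DERIV_imp_deriv DERIV_mult' real_differentiable_DERIV)
  moreover have "times_differentiable n (\<lambda>x. f x * deriv g x + deriv f x * g x)"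
    using Suc.prems times_differentiable_Suc_imp
    by (intro times_differentiable_add Suc.IH) auto
  ultimately show ?case using Suc.prems by (auto intro!: differentiable_mult)
qed (auto intro!: differentiable_mult)

lemma times_differentiable_const: "times_differentiable n (\<lambda>x. c)"
proof (induction n arbitrary: c)
  case (Suc n)
  have "deriv (\<lambda>x. c) = (\<lambda>x. 0)" by (auto intro!: ext DERIV_imp_deriv)
  with Suc show ?case by auto
qed auto

lemma times_differentiable_affine:
  "times_differentiable n f \<Longrightarrow> times_differentiable n (\<lambda>x. f (c * x + d))"
proof (induction n arbitrary: f)
  case 0
  then have "((\<lambda>x. f (c * x + d)) has_real_derivative deriv f (c * x + d) * c) (at x)" for x
    by (intro DERIV_chain2[of f]) (auto intro!: derivative_eq_intros real_differentiable_DERIV)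
  then show ?case by (auto simp: real_differentiable_def)
next
  case (Suc n)
  have D: "((\<lambda>x. f (c * x + d)) has_real_derivative deriv f (c * x + d) * c) (at x)" for x
    using Suc.prems
    by (intro DERIV_chain2[of f]) (auto intro!: derivative_eq_intros real_differentiable_DERIV)
  have "deriv (\<lambda>x. f (c * x + d)) = (\<lambda>x. deriv f (c * x + d) * c)"
    using D by (auto intro!: ext DERIV_imp_deriv)
  moreover have "times_differentiable n (\<lambda>x. deriv f (c * x + d) * c)"
    using Suc by (intro times_differentiable_mult times_differentiable_const) auto
  ultimately show ?case using D by (auto simp: real_differentiable_def)
qed

text \<open>The derivatives of \<open>x \<mapsto> exp (- 1 / x)\<close> are combinations of these functions.\<close>

definition exp_flat :: "nat \<Rightarrow> real \<Rightarrow> real" where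
  "exp_flat j x = (if x > 0 then exp (- 1 / x) / x ^ j else 0)"

text \<open>
  The exponential beats every power of \<open>1 / x\<close>; a quadratic bound is what differentiability at \<open>0\<close>
  requires.
\<close>

lemma exp_flat_le: "\<bar>exp_flat j x\<bar> \<le> real (j + 2) ^ (j + 2) * x\<^sup>2"
proof (cases "x > 0")
  case True
  define n where "n = j + 2"
  have n: "n \<ge> 1" "real n > 0" by (auto simp: n_def)
  have "((1 / x) / n) ^ n \<le> (1 + (1 / x) / n) ^ n" using True n by (intro power_mono) auto
  also have "\<dots> \<le> exp (1 / x)"
    using True n by (intro exp_ge_one_plus_x_over_n_power_n) (auto simp: order_trans[of _ 0])
  finally have "(1 / (x * n)) ^ n \<le> exp (1 / x)" by simp
  then have "1 \<le> exp (1 / x) * (x * n) ^ n" using True n by (simp add: power_one_over field_simps)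
  then have "exp (- 1 / x) \<le> (x * n) ^ n"
    by (simp add: exp_minus field_simps)
  then have "exp (- 1 / x) / x ^ j \<le> (x * n) ^ n / x ^ j" using True by (intro divide_right_mono) auto
  also have "\<dots> = real n ^ n * x\<^sup>2"
  proof -
    have "x ^ n = x ^ j * x\<^sup>2" by (simp add: n_def power_add power2_eq_square)
    then show ?thesis using True by (simp add: power_mult_distrib)
  qed
  finally show ?thesis using True by (simp add: exp_flat_def n_def)
qed (simp add: exp_flat_def)

lemma exp_flat_DERIV:
  "(exp_flat j has_real_derivative exp_flat (j + 2) x - real j * exp_flat (j + 1) x) (at x)"
proof -
  consider "x > 0" | "x < 0" | "x = 0" by linarith
  then show ?thesis
  proof cases
    case 1
    have "((\<lambda>x. exp (- 1 / x) / x ^ j) has_real_derivative exp_flat (j + 2) x - real j * exp_flat (j + 1) x) (at x)"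
      using 1
      apply (auto intro!: derivative_eq_intros simp: exp_flat_def)
      apply (cases j) apply (auto simp: field_simps power2_eq_square power_add)
      done
    then show ?thesis
      by (rule has_field_derivative_transform_within_open[of _ _ _ "{0<..}"]) (use 1 in \<open>auto simp: exp_flat_def\<close>)
  next
    case 2
    have "((\<lambda>_. 0) has_real_derivative 0) (at x)" by simp
    then have "(exp_flat j has_real_derivative 0) (at x)"
      by (rule has_field_derivative_transform_within_open[of _ _ _ "{..<0}"]) (use 2 in \<open>auto simp: exp_flat_def\<close>)
    then show ?thesis using 2 by (simp add: exp_flat_def)
  next
    case 3
    define C where "C = real (j + 2) ^ (j + 2)"
    have "((\<lambda>t. exp_flat j t / t) \<longlongrightarrow> 0) (at 0)"
    proof (rule Lim_null_comparison)
      show "((\<lambda>t. C * \<bar>t\<bar>) \<longlongrightarrow> 0) (at 0)" by (auto intro!: tendsto_eq_intros)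
      show "\<forall>\<^sub>F t in at 0. norm (exp_flat j t / t) \<le> C * \<bar>t\<bar>"
      proof (rule eventually_at_filter[THEN iffD2, OF always_eventually], intro allI impI)
        fix t :: real assume "t \<noteq> 0"
        have "norm (exp_flat j t / t) \<le> C * t\<^sup>2 / \<bar>t\<bar>"
          using exp_flat_le[of j t] by (simp add: C_def divide_right_mono)
        also have "\<dots> = C * \<bar>t\<bar>" using \<open>t \<noteq> 0\<close> by (cases "t > 0") (auto simp: power2_eq_square)
        finally show "norm (exp_flat j t / t) \<le> C * \<bar>t\<bar>" .
      qed
    qed
    then show ?thesis using 3 by (simp add: DERIV_def exp_flat_def)
  qed
qed

lemma times_differentiable_exp_flat: "times_differentiable n (exp_flat j)"
proof (induction n arbitrary: j)
  case 0
  then show ?case using exp_flat_DERIV by (auto simp: real_differentiable_def)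
next
  case (Suc n)
  have "deriv (exp_flat j) = (\<lambda>x. exp_flat (j + 2) x + (- real j) * exp_flat (j + 1) x)"
    using exp_flat_DERIV by (auto intro!: ext DERIV_imp_deriv)
  then have "times_differentiable n (deriv (exp_flat j))"
    by (simp only:) (intro times_differentiable_add times_differentiable_mult times_differentiable_const Suc)
  then show ?case using exp_flat_DERIV by (auto simp: real_differentiable_def)
qed

text \<open>
  The factor \<open>k\<close> steepens the flanks, so that the bumps fill the interval \<open>(a, b)\<close> as \<open>k\<close> grows.
\<close>

definition bump :: "real \<Rightarrow> real \<Rightarrow> nat \<Rightarrow> real \<Rightarrow> real" where
  "bump a b k x = exp_flat 0 (real k * (x - a)) * exp_flat 0 (real k * (b - x))"

lemma bump_test_function:
  assumes "-L < a" and "b < L"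
  shows "bump a b k \<in> test_functions L"
proof -
  have "times_differentiable n (bump a b k)" for n
  proof -
    have "bump a b k = (\<lambda>x. exp_flat 0 (real k * x + (- real k * a)) * exp_flat 0 ((- real k) * x + real k * b))"
      by (auto simp: bump_def algebra_simps)
    moreover have "times_differentiable n (\<lambda>x. exp_flat 0 (real k * x + (- real k * a)) * exp_flat 0 ((- real k) * x + real k * b))"
      by (intro times_differentiable_mult times_differentiable_affine times_differentiable_exp_flat)
    ultimately show ?thesis by simp
  qed
  moreover have "bump a b k x = 0" if "x \<notin> {a..b}" for x
    using that by (auto simp: bump_def exp_flat_def zero_less_mult_iff)
  ultimately show ?thesis
    using assms unfolding test_functions_def smooth_iff_times_differentiable
    by (intro CollectI conjI exI[of _ "{a..b}"]) auto
qed

lemma bump_le_1: "\<bar>bump a b k x\<bar> \<le> 1"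
proof -
  have "\<bar>exp_flat 0 t\<bar> \<le> 1" for t by (auto simp: exp_flat_def)
  then show ?thesis unfolding bump_def abs_mult by (intro mult_le_one) auto
qed

lemma bump_tendsto: "(\<lambda>k. bump a b k x) \<longlonglongrightarrow> indicator {a<..<b} x"
proof -
  have *: "(\<lambda>k. exp_flat 0 (real k * t)) \<longlonglongrightarrow> indicator {0<..} t" for t
  proof (cases "t > 0")
    case True
    have "(\<lambda>k. exp (- inverse t * inverse (real k))) \<longlonglongrightarrow> exp (- inverse t * 0)"
      by (intro tendsto_intros LIMSEQ_inverse_real_of_nat[THEN LIMSEQ_imp_Suc])
    moreover have "\<forall>\<^sub>F k in sequentially. exp_flat 0 (real k * t) = exp (- inverse t * inverse (real k))"
      using eventually_gt_at_top[of 0]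
      by eventually_elim (use True in \<open>auto simp: exp_flat_def field_simps\<close>)
    ultimately show ?thesis using True by (simp add: tendsto_cong)
  next
    case False
    then have "exp_flat 0 (real k * t) = 0" for k by (auto simp: exp_flat_def zero_less_mult_iff)
    then show ?thesis using False by simp
  qed
  have "(\<lambda>k. bump a b k x) \<longlonglongrightarrow> indicator {0<..} (x - a) * indicator {0<..} (b - x)"
    unfolding bump_def by (intro tendsto_intros *)
  also have "indicator {0<..} (x - a) * indicator {0<..} (b - x) = (indicator {a<..<b} x :: real)"
    by (auto simp: indicator_def)
  finally show ?thesis .
qed

lemma test_function_continuous: "\<phi> \<in> test_functions L \<Longrightarrow> continuous_on A \<phi>"
  by (auto simp: test_functions_def intro!: continuous_at_imp_continuous_on differentiable_imp_continuous_within
      dest: spec[of _ 0])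

lemma test_function_DERIV: "\<phi> \<in> test_functions L \<Longrightarrow> (\<phi> has_real_derivative deriv \<phi> x) (at x)"
  by (intro real_differentiable_DERIV) (auto simp: test_functions_def dest: spec[of _ 0])

lemma test_function_deriv:
  assumes "\<phi> \<in> test_functions L"
  shows "deriv \<phi> \<in> test_functions L"
proof -
  obtain S where S: "compact S" "S \<subseteq> {-L<..<L}" "\<And>x. x \<notin> S \<Longrightarrow> \<phi> x = 0"
    using assms by (auto simp: test_functions_def)
  have "deriv \<phi> x = 0" if "x \<notin> S" for x
  proof -
    have "((\<lambda>_. 0) has_real_derivative 0) (at x)" by simp
    then have "(\<phi> has_real_derivative 0) (at x)"
      by (rule has_field_derivative_transform_within_open[of _ _ _ "- S"])
        (use S that in \<open>auto simp: compact_imp_closed open_Compl\<close>)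
    then show ?thesis by (rule DERIV_imp_deriv)
  qed
  moreover have "(deriv ^^ k) (deriv \<phi>) differentiable (at x)" for k x
    using assms unfolding test_functions_def
    by (metis (mono_tags, lifting) comp_apply funpow_Suc_right mem_Collect_eq)
  ultimately show ?thesis using S by (auto simp: test_functions_def)
qed

lemma test_function_L2:
  assumes "\<phi> \<in> test_functions L"
  shows "\<phi> \<in> L2 L"
proof -
  obtain S where S: "compact S" "\<And>x. x \<notin> S \<Longrightarrow> \<phi> x = 0"
    using assms by (auto simp: test_functions_def)
  have "compact (\<phi> ` S)" using S test_function_continuous[OF assms] by (intro compact_continuous_image)
  then obtain B where "\<And>x. x \<in> S \<Longrightarrow> \<bar>\<phi> x\<bar> \<le> B" "B > 0" using bounded_pos[of "\<phi> ` S"] compact_imp_bounded by auto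
  then have "\<bar>\<phi> x\<bar> \<le> B" for x using S(2)[of x] by (cases "x \<in> S") auto
  moreover have "\<phi> \<in> borel_measurable (Om L)"
    using test_function_continuous[OF assms] by (intro continuous_imp_measurable_on_sets_lebesgue) auto
  ultimately show ?thesis by (intro L2_bounded) auto
qed

text \<open>
  Testing with bumps shows that the integral over every subinterval vanishes; the function itself
  is then recovered almost everywhere by Lebesgue differentiation.
\<close>

lemma fundamental_lemma:
  assumes v: "v \<in> L2 L" and test: "\<And>\<phi>. \<phi> \<in> test_functions L \<Longrightarrow> (LINT x|Om L. v x * \<phi> x) = 0"
  shows "AE x in Om L. v x = 0"
proof -
  have [measurable]: "(\<lambda>x. x) \<in> borel_measurable (Om L)"
    by (intro continuous_imp_measurable_on_sets_lebesgue) auto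
  have vint: "integrable (Om L) v" using v by (rule L2_integrable)
  have zero: "(LINT x|Om L. v x * indicator {a<..<b} x) = 0" if "-L < a" "b < L" for a b
  proof -
    have "(\<lambda>k. LINT x|Om L. v x * bump a b k x) \<longlonglongrightarrow> (LINT x|Om L. v x * indicator {a<..<b} x)"
    proof (rule integral_dominated_convergence[where w="\<lambda>x. \<bar>v x\<bar>"])
      show "AE x in Om L. (\<lambda>k. v x * bump a b k x) \<longlonglongrightarrow> v x * indicator {a<..<b} x"
        by (intro AE_I2 tendsto_intros bump_tendsto)
      show "AE x in Om L. norm (v x * bump a b k x) \<le> \<bar>v x\<bar>" for k
        using bump_le_1 by (auto simp: abs_mult intro!: AE_I2 mult_left_le)
      show "(\<lambda>x. v x * bump a b k x) \<in> borel_measurable (Om L)" for k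
        using v test_function_L2[OF bump_test_function[OF that]] by measurable
      show "(\<lambda>x. v x * indicator {a<..<b} x) \<in> borel_measurable (Om L)"
        using v by measurable
    qed (use vint in auto)
    moreover have "(LINT x|Om L. v x * bump a b k x) = 0" for k
      by (rule test[OF bump_test_function[OF that]])
    ultimately show ?thesis by (simp add: LIMSEQ_const_iff)
  qed
  define F where "F x = indicator {-L<..<L} x * v x" for x
  have F: "integrable lebesgue F"
    using vint unfolding F_def by (simp add: integrable_restrict_space)
  have Fabs: "F absolutely_integrable_on A" if "A \<in> sets lebesgue" for A
    using integrable_mult_indicator[OF that F] by (simp add: set_integrable_def)
  have Fint: "integral (cbox a b) F = 0" if "-L < a" "b < L" for a b
  proof -
    have "integral (cbox a b) F = integral (box a b) F" by (rule integral_open_interval[symmetric])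
    also have "\<dots> = (LINT x:box a b|lebesgue. F x)"
      using Fabs[of "box a b"] by (simp add: set_lebesgue_integral_eq_integral(2))
    also have "\<dots> = (LINT x|Om L. v x * indicator {a<..<b} x)"
      by (simp add: set_lebesgue_integral_def F_def integral_restrict_space box_real mult_ac)
    finally show ?thesis using zero[OF that] by simp
  qed
  obtain N where N: "negligible N" and diff: "\<And>x e. \<lbrakk>x \<notin> N; 0 < e\<rbrakk> \<Longrightarrow> \<exists>d>0. \<forall>h. 0 < h \<and> h < d \<longrightarrow>
      norm (integral (cbox x (x + h *\<^sub>R One)) F /\<^sub>R h ^ DIM(real) - F x) < e"
  proof (rule integrable_ccontinuous_explicit[of F])
    show "F integrable_on cbox a b" for a b
      using Fabs[of "cbox a b"] by (simp add: set_lebesgue_integral_eq_integral(1))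
  qed blast
  have "v x = 0" if x: "x \<notin> N" "-L < x" "x < L" for x
  proof (rule ccontr)
    assume "v x \<noteq> 0"
    then obtain d where d: "d > 0" "\<And>h. 0 < h \<Longrightarrow> h < d \<Longrightarrow>
        norm (integral (cbox x (x + h *\<^sub>R One)) F /\<^sub>R h ^ DIM(real) - F x) < \<bar>v x\<bar>"
      using diff[of x "\<bar>v x\<bar>"] x by auto
    define h where "h = min d (L - x) / 2"
    have h: "0 < h" "h < d" "x + h < L" using d x by (auto simp: h_def min_def field_simps)
    have "norm (integral (cbox x (x + h)) F /\<^sub>R h - F x) < \<bar>v x\<bar>" using d(2)[OF h(1,2)] by simp
    moreover have "integral (cbox x (x + h)) F = 0" using x h by (intro Fint)
    ultimately show False using x by (simp add: F_def)
  qed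
  moreover have "AE x in lebesgue. x \<notin> N"
    using N by (intro AE_not_in) (simp add: negligible_iff_null_sets)
  ultimately have "AE x in lebesgue. x \<in> {-L<..<L} \<longrightarrow> v x = 0"
    by (auto elim!: eventually_mono)
  then show ?thesis by (subst AE_restrict_space_iff) auto
qed

lemma distr_deriv_unique:
  assumes v: "v \<in> L2 L" "v' \<in> L2 L" and z: "has_distr_deriv L z v" "has_distr_deriv L z v'"
  shows "AE x in Om L. v x = v' x"
proof -
  have "AE x in Om L. v x - v' x = 0"
  proof (rule fundamental_lemma[OF L2_diff[OF v]])
    fix \<phi> assume \<phi>: "\<phi> \<in> test_functions L"
    then have "(LINT x|Om L. v x * \<phi> x) = (LINT x|Om L. v' x * \<phi> x)"
      using z[unfolded has_distr_deriv_def, THEN bspec, of \<phi>] by simp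
    then show "(LINT x|Om L. (v x - v' x) * \<phi> x) = 0"
      using v \<phi> by (simp add: left_diff_distrib L2_integrable_mult test_function_L2)
  qed
  then show ?thesis by simp
qed

lemma ddx_spec:
  assumes "z \<in> H1 L"
  shows "ddx L z \<in> L2 L" and "has_distr_deriv L z (ddx L z)"
proof -
  have "\<exists>v. v \<in> L2 L \<and> has_distr_deriv L z v" using assms by (auto simp: H1_def)
  from someI_ex[OF this] show "ddx L z \<in> L2 L" "has_distr_deriv L z (ddx L z)" by (auto simp: ddx_def)
qed

lemma H1_L2: "z \<in> H1 L \<Longrightarrow> z \<in> L2 L"
  by (simp add: H1_def)

lemma ddx_eq:
  assumes "z \<in> L2 L" "v \<in> L2 L" "has_distr_deriv L z v"
  shows "z \<in> H1 L" and "AE x in Om L. ddx L z x = v x"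
proof -
  show z: "z \<in> H1 L" using assms by (auto simp: H1_def)
  show "AE x in Om L. ddx L z x = v x"
    using ddx_spec[OF z] assms by (intro distr_deriv_unique)
qed

section \<open>Weakly differentiable functions of one variable\<close>

lemma Om_integral_interval:
  assumes h: "continuous_on {-L..L} (h :: real \<Rightarrow> real)" and ab: "-L \<le> a" "b \<le> L"
  shows "(LINT x|Om L. indicator {a<..<b} x * h x) = integral {a..b} h"
proof -
  have "continuous_on {a..b} h" using h ab by (auto intro: continuous_on_subset)
  then have "h absolutely_integrable_on {a..b}" by (rule absolutely_integrable_continuous_real)
  then have abs: "h absolutely_integrable_on {a<..<b}"
    by (rule set_integrable_subset) auto
  have "integral {a..b} h = integral {a<..<b} h" by (simp add: integral_open_interval_real)
  also have "\<dots> = (LINT x:{a<..<b}|lebesgue. h x)"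
    using abs by (simp add: set_lebesgue_integral_eq_integral(2))
  also have "\<dots> = (LINT x|lebesgue. indicator {-L<..<L} x * (indicator {a<..<b} x * h x))"
    unfolding set_lebesgue_integral_def using ab
    by (intro Bochner_Integration.integral_cong) (auto simp: indicator_def)
  also have "\<dots> = (LINT x|Om L. indicator {a<..<b} x * h x)"
    by (simp add: integral_restrict_space)
  finally show ?thesis by simp
qed

lemma test_function_lincomb:
  assumes "\<phi> \<in> test_functions L" and "\<psi> \<in> test_functions L"
  shows "(\<lambda>x. \<phi> x + c * \<psi> x) \<in> test_functions L"
proof -
  obtain S where S: "compact S" "S \<subseteq> {-L<..<L}" "\<And>x. x \<notin> S \<Longrightarrow> \<phi> x = 0"
    using assms by (auto simp: test_functions_def)
  obtain S' where S': "compact S'" "S' \<subseteq> {-L<..<L}" "\<And>x. x \<notin> S' \<Longrightarrow> \<psi> x = 0"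
    using assms by (auto simp: test_functions_def)
  have "times_differentiable n (\<lambda>x. \<phi> x + c * \<psi> x)" for n
    using assms unfolding test_functions_def smooth_iff_times_differentiable
    by (intro times_differentiable_add times_differentiable_mult times_differentiable_const) auto
  then show ?thesis unfolding test_functions_def smooth_iff_times_differentiable
    using S S' by (intro CollectI conjI exI[of _ "S \<union> S'"]) auto
qed

lemma test_function_support:
  assumes "\<phi> \<in> test_functions L" and "0 < L"
  obtains a b where "-L < a" "a \<le> b" "b < L" "\<And>x. x \<notin> {a..b} \<Longrightarrow> \<phi> x = 0"
proof -
  obtain S where S: "compact S" "S \<subseteq> {-L<..<L}" "\<And>x. x \<notin> S \<Longrightarrow> \<phi> x = 0"
    using assms by (auto simp: test_functions_def)
  show ?thesis
  proof (cases "S = {}")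
    case True
    then show ?thesis using that[of 0 0] S assms by auto
  next
    case False
    obtain a where a: "a \<in> S" "\<And>x. x \<in> S \<Longrightarrow> a \<le> x" using compact_attains_inf[OF S(1) False] by blast
    obtain b where b: "b \<in> S" "\<And>x. x \<in> S \<Longrightarrow> x \<le> b" using compact_attains_sup[OF S(1) False] by blast
    show ?thesis
    proof (rule that[of a b])
      show "\<phi> x = 0" if "x \<notin> {a..b}" for x using that a b S(3)[of x] by auto
    qed (use a b S in auto)
  qed
qed

lemma test_function_boundary:
  assumes "\<phi> \<in> test_functions L"
  shows "\<phi> L = 0" and "\<phi> (-L) = 0"
proof -
  obtain S where S: "S \<subseteq> {-L<..<L}" "\<And>x. x \<notin> S \<Longrightarrow> \<phi> x = 0"
    using assms by (auto simp: test_functions_def)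
  have "L \<notin> S" "-L \<notin> S" using S(1) by auto
  then show "\<phi> L = 0" and "\<phi> (-L) = 0" by (simp_all add: S(2))
qed

lemma test_function_integral_deriv:
  assumes \<phi>: "\<phi> \<in> test_functions L" and y: "-L \<le> y" "y \<le> L"
  shows "(LINT x|Om L. indicator {y<..<L} x * deriv \<phi> x) = - \<phi> y"
proof -
  have "(deriv \<phi> has_integral (\<phi> L - \<phi> y)) {y..L}"
    using y by (intro fundamental_theorem_of_calculus)
      (auto simp flip: has_real_derivative_iff_has_vector_derivative
        intro!: DERIV_subset[OF test_function_DERIV[OF \<phi>]])
  then have "integral {y..L} (deriv \<phi>) = - \<phi> y"
    using test_function_boundary(1)[OF \<phi>] by (simp add: integral_unique)
  moreover have "continuous_on {-L..L} (deriv \<phi>)"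
    by (rule test_function_continuous[OF test_function_deriv[OF \<phi>]])
  ultimately show ?thesis using y by (simp add: Om_integral_interval)
qed

lemma test_function_integral_deriv_zero:
  assumes \<phi>: "\<phi> \<in> test_functions L" and "0 < L"
  shows "(LINT x|Om L. deriv \<phi> x) = 0"
proof -
  have "(LINT x|Om L. deriv \<phi> x) = (LINT x|Om L. indicator {-L<..<L} x * deriv \<phi> x)"
    by (rule Bochner_Integration.integral_cong) auto
  then show ?thesis
    using test_function_integral_deriv[OF \<phi>, of "-L"] test_function_boundary(2)[OF \<phi>] \<open>0 < L\<close> by simp
qed

text \<open>
  An antiderivative of \<open>\<psi>\<close> is constant on either side of the support, and the two constants agree
  because the integral of \<open>\<psi>\<close> vanishes.
\<close>

lemma test_function_antiderivative:
  assumes \<psi>: "\<psi> \<in> test_functions L" and L: "0 < L" and zero: "(LINT x|Om L. \<psi> x) = 0"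
  shows "\<exists>\<phi>\<in>test_functions L. deriv \<phi> = \<psi>"
proof -
  obtain a b where ab: "-L < a" "a \<le> b" "b < L" and supp: "\<And>x. x \<notin> {a..b} \<Longrightarrow> \<psi> x = 0"
    using test_function_support[OF \<psi> L] by blast
  have cont: "continuous_on A \<psi>" for A by (rule test_function_continuous[OF \<psi>])
  have "\<exists>F. \<forall>x::real. -\<infinity> < ereal x \<longrightarrow> ereal x < \<infinity> \<longrightarrow> (F has_vector_derivative \<psi> x) (at x)"
    using cont[of UNIV] by (intro einterval_antiderivative) (auto simp: continuous_on_eq_continuous_at)
  then obtain F where F: "\<And>x. (F has_real_derivative \<psi> x) (at x)"
    by (auto simp: has_real_derivative_iff_has_vector_derivative)
  have const: "F y = F x" if "x < y" "\<And>t. x < t \<Longrightarrow> t < y \<Longrightarrow> \<psi> t = 0" for x y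
  proof (rule DERIV_isconst_end[OF that(1)])
    show "continuous_on {x..y} F"
      using F by (intro DERIV_continuous_on) (rule DERIV_subset[OF _ subset_UNIV])
    show "DERIV F t :> 0" if "x < t" "t < y" for t using F[of t] that \<open>\<And>t. x < t \<Longrightarrow> t < y \<Longrightarrow> \<psi> t = 0\<close> by simp
  qed
  have left: "F x = F a" if "x < a" for x using const[of x a] supp that by auto
  have right: "F x = F b" if "b < x" for x using const[of b x] supp that by auto
  have "(\<psi> has_integral (F L - F (-L))) {-L..L}"
    using L F by (intro fundamental_theorem_of_calculus)
      (auto simp flip: has_real_derivative_iff_has_vector_derivative intro!: DERIV_subset[OF F])
  then have "F L - F (-L) = integral {-L..L} \<psi>" by (simp add: integral_unique)
  also have "\<dots> = (LINT x|Om L. indicator {-L<..<L} x * \<psi> x)"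
    by (rule Om_integral_interval[symmetric]) (auto intro: cont)
  also have "\<dots> = (LINT x|Om L. \<psi> x)"
    by (rule Bochner_Integration.integral_cong) auto
  finally have Fab: "F b = F a" using zero left[of "-L"] right[of L] ab by simp
  define \<phi> where "\<phi> x = F x - F a" for x
  have D: "(\<phi> has_real_derivative \<psi> x) (at x)" for x
    unfolding \<phi>_def by (auto intro!: derivative_eq_intros F)
  then have deriv: "deriv \<phi> = \<psi>" by (auto intro!: ext DERIV_imp_deriv)
  have "times_differentiable n \<phi>" for n
  proof -
    have "times_differentiable n \<psi>" for n
      using \<psi> by (auto simp: test_functions_def smooth_iff_times_differentiable)
    then show ?thesis using D by (cases n) (auto simp: deriv real_differentiable_def)
  qed
  moreover have "\<phi> x = 0" if "x \<notin> {a..b}" for x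
    using that left[of x] right[of x] Fab by (auto simp: \<phi>_def not_le)
  ultimately have "\<phi> \<in> test_functions L"
    unfolding test_functions_def smooth_iff_times_differentiable
    using ab by (intro CollectI conjI exI[of _ "{a..b}"]) auto
  then show ?thesis using deriv by blast
qed

text \<open>
  The du Bois-Reymond lemma: subtracting from a test function a multiple of a fixed one leaves
  the derivative of a test function.
\<close>

lemma distr_deriv_zero_imp_const:
  assumes q: "q \<in> L2 L" and L: "0 < L" and zero: "has_distr_deriv L q (\<lambda>_. 0)"
  obtains c where "AE x in Om L. q x = c"
proof -
  (* If every test function had integral 0, the fundamental lemma would say 1 = 0 a.e. *)
  obtain \<psi>0 where \<psi>0: "\<psi>0 \<in> test_functions L" "(LINT x|Om L. \<psi>0 x) \<noteq> 0"
  proof (rule ccontr)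
    assume "\<not> thesis"
    with that have "(LINT x|Om L. 1 * \<psi> x) = 0" if "\<psi> \<in> test_functions L" for \<psi> using that by auto
    then have "AE x in Om L. (1::real) = 0" by (intro fundamental_lemma) auto
    then have "emeasure (Om L) (space (Om L)) = 0"
      by (simp add: eventually_False ae_filter_eq_bot_iff del: space_Om)
    then show False using L by (simp add: emeasure_restrict_space)
  qed
  define c where "c = (LINT x|Om L. q x * \<psi>0 x) / (LINT x|Om L. \<psi>0 x)"
  have "AE x in Om L. q x - c = 0"
  proof (rule fundamental_lemma)
    show "(\<lambda>x. q x - c) \<in> L2 L" using q by simp
    fix \<psi> assume \<psi>: "\<psi> \<in> test_functions L"
    define m where "m = (LINT x|Om L. \<psi> x) / (LINT x|Om L. \<psi>0 x)"
    note int = L2_integrable[OF test_function_L2[OF \<psi>]] L2_integrable[OF test_function_L2[OF \<psi>0(1)]]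
      L2_integrable_mult[OF q test_function_L2[OF \<psi>]] L2_integrable_mult[OF q test_function_L2[OF \<psi>0(1)]]
    have "(\<lambda>x. \<psi> x + (-m) * \<psi>0 x) \<in> test_functions L" by (rule test_function_lincomb[OF \<psi> \<psi>0(1)])
    moreover have "(LINT x|Om L. \<psi> x + (-m) * \<psi>0 x) = 0"
      using \<psi>0(2) int by (simp add: m_def)
    ultimately obtain \<phi> where \<phi>: "\<phi> \<in> test_functions L" "deriv \<phi> = (\<lambda>x. \<psi> x + (-m) * \<psi>0 x)"
      using test_function_antiderivative[OF _ L] by blast
    have "(LINT x|Om L. q x * (\<psi> x + (-m) * \<psi>0 x)) = 0"
      using zero \<phi> unfolding has_distr_deriv_def by fastforce
    also have "(LINT x|Om L. q x * (\<psi> x + (-m) * \<psi>0 x)) = (LINT x|Om L. q x * \<psi> x - m * (q x * \<psi>0 x))"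
      by (rule Bochner_Integration.integral_cong) (auto simp: algebra_simps)
    also have "\<dots> = (LINT x|Om L. q x * \<psi> x) - m * (LINT x|Om L. q x * \<psi>0 x)"
      using int by simp
    also have "m * (LINT x|Om L. q x * \<psi>0 x) = c * (LINT x|Om L. \<psi> x)" by (simp add: m_def c_def)
    finally show "(LINT x|Om L. (q x - c) * \<psi> x) = 0" using int by (simp add: left_diff_distrib)
  qed
  then have "AE x in Om L. q x = c" by simp
  then show ?thesis by (rule that)
qed

definition primitive :: "real \<Rightarrow> (real \<Rightarrow> real) \<Rightarrow> real \<Rightarrow> real" where
  "primitive L v x = (LINT y|Om L. (if y < x then v y else 0))"

lemma id_measurable_Om: "(\<lambda>x. x) \<in> borel_measurable (Om L)"
  by (intro continuous_imp_measurable_on_sets_lebesgue) auto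

lemma indicator_below_L2: "(\<lambda>y. if y < x then 1 else 0 :: real) \<in> L2 L"
proof (rule L2_bounded[of _ _ 1])
  show "(\<lambda>y. if y < x then 1 else 0 :: real) \<in> borel_measurable (Om L)"
    using id_measurable_Om[of L] by measurable
qed auto

lemma primitive_eq_inner: "primitive L v x = L2_inner L v (\<lambda>y. if y < x then 1 else 0)"
  unfolding primitive_def L2_inner_def by (rule Bochner_Integration.integral_cong) auto

lemma primitive_abs_le:
  assumes v: "v \<in> L2 L"
  shows "\<bar>primitive L v x\<bar> \<le> sqrt (L2_sq L v) * sqrt (L2_sq L (\<lambda>_. 1))"
proof -
  let ?i = "\<lambda>y. if y < x then 1 else 0 :: real"
  have "\<bar>primitive L v x\<bar> \<le> sqrt (L2_sq L v) * sqrt (L2_sq L ?i)"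
    unfolding primitive_eq_inner by (rule L2.Cauchy_Schwarz_abs[OF v indicator_below_L2])
  also have "L2_sq L ?i \<le> L2_sq L (\<lambda>_. 1)"
    unfolding L2_inner_def
    by (intro integral_mono L2_integrable_mult indicator_below_L2 L2_const) auto
  finally show ?thesis by (simp add: mult_left_mono L2_inner_self_nonneg)
qed

lemma primitive_measurable:
  assumes v: "v \<in> L2 L"
  shows "primitive L v \<in> borel_measurable (Om L)"
proof -
  interpret finite_measure "Om L" by (rule finite_measure_Om)
  note [measurable] = L2_measurable[OF v] id_measurable_Om[of L]
  show ?thesis unfolding primitive_def by measurable
qed

lemma primitive_L2:
  assumes "v \<in> L2 L"
  shows "primitive L v \<in> L2 L"
  by (rule L2_bounded[OF primitive_measurable AE_I2]) (use assms primitive_abs_le in auto)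

text \<open>
  Integration by parts for a primitive is Fubini's theorem: the inner integral becomes that of
  \<open>deriv \<phi>\<close> over \<open>(y, L)\<close>, which is \<open>- \<phi> y\<close>.
\<close>

lemma primitive_has_distr_deriv:
  assumes v: "v \<in> L2 L"
  shows "has_distr_deriv L (primitive L v) v"
  unfolding has_distr_deriv_def
proof
  fix \<phi> assume \<phi>: "\<phi> \<in> test_functions L"
  have d: "deriv \<phi> \<in> L2 L" by (rule test_function_L2[OF test_function_deriv[OF \<phi>]])
  interpret F: finite_measure "Om L" by (rule finite_measure_Om)
  interpret pair_sigma_finite "Om L" "Om L" ..
  note [measurable] = L2_measurable[OF v] L2_measurable[OF d] id_measurable_Om[of L]
  define h where "h x y = (if y < x then v y else 0) * deriv \<phi> x" for x y :: real
  have hm [measurable]: "(\<lambda>(x, y). h x y) \<in> borel_measurable (Om L \<Otimes>\<^sub>M Om L)"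
    unfolding h_def by measurable
  have "integrable (Om L \<Otimes>\<^sub>M Om L) (\<lambda>(x, y). v y * deriv \<phi> x)"
  proof (rule Fubini_integrable)
    show "(\<lambda>(x, y). v y * deriv \<phi> x) \<in> borel_measurable (Om L \<Otimes>\<^sub>M Om L)" by measurable
    show "integrable (Om L) (\<lambda>x. LINT y|Om L. norm (case (x, y) of (x, y) \<Rightarrow> v y * deriv \<phi> x))"
      using L2_integrable[OF d] by (simp add: abs_mult)
    show "AE x in Om L. integrable (Om L) (\<lambda>y. case (x, y) of (x, y) \<Rightarrow> v y * deriv \<phi> x)"
      using L2_integrable[OF v] by simp
  qed
  then have hi: "integrable (Om L \<Otimes>\<^sub>M Om L) (\<lambda>(x, y). h x y)"
    by (rule Bochner_Integration.integrable_bound[OF _ hm]) (auto simp: h_def intro!: AE_I2)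
  have "(LINT x|Om L. primitive L v x * deriv \<phi> x) = (LINT x|Om L. LINT y|Om L. h x y)"
    by (simp add: primitive_def h_def)
  also have "\<dots> = (LINT y|Om L. LINT x|Om L. h x y)"
    by (rule Fubini_integral[OF hi, symmetric])
  also have "\<dots> = (LINT y|Om L. - (v y * \<phi> y))"
  proof (rule Bochner_Integration.integral_cong[OF refl])
    fix y assume "y \<in> space (Om L)"
    then have y: "-L < y" "y < L" by auto
    have "(LINT x|Om L. h x y) = (LINT x|Om L. v y * (indicator {y<..<L} x * deriv \<phi> x))"
      by (rule Bochner_Integration.integral_cong) (auto simp: h_def)
    also have "\<dots> = v y * - \<phi> y"
      using test_function_integral_deriv[OF \<phi>, of y] y by simp
    finally show "(LINT x|Om L. h x y) = - (v y * \<phi> y)" by simp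
  qed
  finally show "(LINT x|Om L. primitive L v x * deriv \<phi> x) = - (LINT x|Om L. v x * \<phi> x)" by simp
qed

lemma const_plus_primitive_H1:
  assumes v: "v \<in> L2 L" and L: "0 < L"
  shows "(\<lambda>x. c + primitive L v x) \<in> H1 L" and "AE x in Om L. ddx L (\<lambda>x. c + primitive L v x) x = v x"
proof -
  have "has_distr_deriv L (\<lambda>x. c + primitive L v x) v"
    unfolding has_distr_deriv_def
  proof
    fix \<phi> assume \<phi>: "\<phi> \<in> test_functions L"
    have d: "deriv \<phi> \<in> L2 L" by (rule test_function_L2[OF test_function_deriv[OF \<phi>]])
    have "(LINT x|Om L. (c + primitive L v x) * deriv \<phi> x)
        = c * (LINT x|Om L. deriv \<phi> x) + (LINT x|Om L. primitive L v x * deriv \<phi> x)"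
      using L2_integrable[OF d] L2_integrable_mult[OF primitive_L2[OF v] d] by (simp add: distrib_right)
    then show "(LINT x|Om L. (c + primitive L v x) * deriv \<phi> x) = - (LINT x|Om L. v x * \<phi> x)"
      using test_function_integral_deriv_zero[OF \<phi> L] primitive_has_distr_deriv[OF v] \<phi>
      by (simp add: has_distr_deriv_def)
  qed
  from ddx_eq[OF _ v this] show "(\<lambda>x. c + primitive L v x) \<in> H1 L"
    and "AE x in Om L. ddx L (\<lambda>x. c + primitive L v x) x = v x"
    using primitive_L2[OF v] by auto
qed

text \<open>
  A function and the primitive of its weak derivative have the same weak derivative, so they differ
  by a constant.
\<close>

lemma H1_representation:
  assumes z: "z \<in> H1 L" and L: "0 < L"
  obtains c where "AE x in Om L. z x = c + primitive L (ddx L z) x"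
proof -
  let ?v = "ddx L z"
  note zL = H1_L2[OF z] and v = ddx_spec[OF z]
  have "has_distr_deriv L (\<lambda>x. z x - primitive L ?v x) (\<lambda>_. 0)"
    unfolding has_distr_deriv_def
  proof
    fix \<phi> assume \<phi>: "\<phi> \<in> test_functions L"
    have d: "deriv \<phi> \<in> L2 L" by (rule test_function_L2[OF test_function_deriv[OF \<phi>]])
    have "(LINT x|Om L. (z x - primitive L ?v x) * deriv \<phi> x)
        = (LINT x|Om L. z x * deriv \<phi> x) - (LINT x|Om L. primitive L ?v x * deriv \<phi> x)"
      using L2_integrable_mult[OF zL d] L2_integrable_mult[OF primitive_L2[OF v(1)] d]
      by (simp add: left_diff_distrib)
    then show "(LINT x|Om L. (z x - primitive L ?v x) * deriv \<phi> x) = - (LINT x|Om L. 0 * \<phi> x)"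
      using v(2) primitive_has_distr_deriv[OF v(1)] \<phi> by (simp add: has_distr_deriv_def)
  qed
  then obtain c where "AE x in Om L. z x - primitive L ?v x = c"
    using distr_deriv_zero_imp_const[OF L2_diff[OF zL primitive_L2[OF v(1)]] L] by blast
  then have "AE x in Om L. z x = c + primitive L ?v x" by eventually_elim simp
  then show ?thesis by (rule that)
qed

lemma H1_bounded:
  assumes z: "z \<in> H1 L" and L: "0 < L"
  obtains C where "AE x in Om L. \<bar>z x\<bar> \<le> C"
proof -
  obtain c where c: "AE x in Om L. z x = c + primitive L (ddx L z) x"
    using H1_representation[OF z L] .
  let ?M = "sqrt (L2_sq L (ddx L z)) * sqrt (L2_sq L (\<lambda>_. 1))"
  have "AE x in Om L. \<bar>z x\<bar> \<le> \<bar>c\<bar> + ?M"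
    using c
  proof eventually_elim
    case (elim x)
    then show ?case using primitive_abs_le[OF ddx_spec(1)[OF z], of x] by linarith
  qed
  then show ?thesis by (rule that)
qed

definition L2_weak_lim :: "real \<Rightarrow> (nat \<Rightarrow> real \<Rightarrow> real) \<Rightarrow> (real \<Rightarrow> real) \<Rightarrow> bool" where
  "L2_weak_lim L X x \<longleftrightarrow> (\<forall>y\<in>L2 L. (\<lambda>k. L2_inner L (X k) y) \<longlonglongrightarrow> L2_inner L x y)"

lemma L2_weakly_iff: "semi_hilbert.weakly (L2 L) (L2_inner L) = L2_weak_lim L"
  by (intro ext) (simp add: L2.weakly_def L2_weak_lim_def)

lemma L2_weak_lim_subseq: "L2_weak_lim L X x \<Longrightarrow> strict_mono r \<Longrightarrow> L2_weak_lim L (\<lambda>k. X (r k)) x"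
  using L2.weakly_subseq[of L X x r] by (simp add: L2_weakly_iff)

text \<open>
  The compact embedding of \<open>H\<^sup>1\<close>: weak convergence of the derivatives is pointwise convergence of
  the primitives, because the value of a primitive is an inner product with an indicator.
\<close>

lemma H1_compact:
  assumes z: "\<And>k::nat. z k \<in> H1 L" and L: "0 < L"
    and B: "\<And>k. L2_sq L (z k) \<le> B" "\<And>k. L2_sq L (ddx L (z k)) \<le> B"
  obtains r y C where "strict_mono r" "y \<in> H1 L" "AE x in Om L. (\<lambda>k. z (r k) x) \<longlonglongrightarrow> y x"
    "\<And>k. AE x in Om L. \<bar>z (r k) x\<bar> \<le> C"
    "L2_weak_lim L (\<lambda>k. ddx L (z (r k))) (ddx L y)"
proof -
  define v where "v k = ddx L (z k)" for k
  have v: "v k \<in> L2 L" for k using ddx_spec(1)[OF z] by (simp add: v_def)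
  define \<mu> where "\<mu> = L2_sq L (\<lambda>_. 1)"
  have \<mu>: "\<mu> > 0"
    using L by (simp add: \<mu>_def L2_inner_def measure_restrict_space)
  define M where "M = sqrt B * sqrt \<mu>"
  have "\<forall>k. \<exists>c. AE x in Om L. z k x = c + primitive L (v k) x"
    unfolding v_def using H1_representation[OF z L] by metis
  then obtain c where c: "\<And>k. AE x in Om L. z k x = c k + primitive L (v k) x" by metis
  have prim: "\<bar>primitive L (v k) x\<bar> \<le> M" for k x
  proof -
    have "\<bar>primitive L (v k) x\<bar> \<le> sqrt (L2_sq L (v k)) * sqrt \<mu>"
      unfolding \<mu>_def by (rule primitive_abs_le[OF v])
    also have "\<dots> \<le> M" unfolding M_def using B(2)[of k] \<mu> by (intro mult_right_mono) (auto simp: v_def)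
    finally show ?thesis .
  qed
  have cbound: "\<bar>c k\<bar> \<le> (sqrt B + M * sqrt \<mu>) / sqrt \<mu>" for k
  proof -
    let ?p = "primitive L (v k)"
    have zL: "z k \<in> L2 L" using H1_L2[OF z] .
    have "(c k)\<^sup>2 * \<mu> = L2_sq L (\<lambda>_. c k)"
      by (simp add: \<mu>_def L2_inner_def power2_eq_square)
    also have "\<dots> = L2_sq L (\<lambda>x. z k x - ?p x)"
      using c[of k] zL primitive_L2[OF v[of k]] by (intro L2_inner_cong_AE) (auto elim: eventually_mono)
    finally have "\<bar>c k\<bar> * sqrt \<mu> = sqrt (L2_sq L (\<lambda>x. z k x - ?p x))"
      by (metis real_sqrt_abs real_sqrt_mult)
    also have "\<dots> \<le> sqrt (L2_sq L (z k)) + sqrt (L2_sq L (\<lambda>x. - ?p x))"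
      using L2.sqrt_ip_triangle[of "z k" L "\<lambda>x. - ?p x"] zL primitive_L2[OF v[of k]] by (simp add: plus_fun_def)
    also have "L2_sq L (\<lambda>x. - ?p x) \<le> L2_sq L (\<lambda>_. M)"
      unfolding L2_inner_def
    proof (intro integral_mono L2_integrable_mult L2_const L2_uminus primitive_L2 v)
      show "- ?p x * - ?p x \<le> M * M" for x
        using prim[of k x] abs_le_square_iff[of "?p x" M] by (simp add: power2_eq_square)
    qed
    also have "L2_sq L (\<lambda>_. M) = (M * sqrt \<mu>)\<^sup>2"
      using \<mu> by (simp add: \<mu>_def L2_inner_def power_mult_distrib power2_eq_square)
    finally have "\<bar>c k\<bar> * sqrt \<mu> \<le> sqrt (L2_sq L (z k)) + sqrt ((M * sqrt \<mu>)\<^sup>2)" by simp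
    also have "sqrt ((M * sqrt \<mu>)\<^sup>2) = M * sqrt \<mu>"
      using prim[of k 0] \<mu> by (simp add: abs_of_nonneg order_trans[OF abs_ge_zero])
    also have "sqrt (L2_sq L (z k)) \<le> sqrt B" using B(1) by simp
    finally show ?thesis using \<mu> by (simp add: field_simps)
  qed
  define D where "D = (sqrt B + M * sqrt \<mu>) / sqrt \<mu>"
  obtain r1 w where r1: "strict_mono r1" and w: "w \<in> L2 L" and weak: "L2_weak_lim L (\<lambda>k. v (r1 k)) w"
    using L2.weak_sequential_compactness[of v L B] v B(2) by (auto simp: L2_weakly_iff v_def)
  have "bounded (range (\<lambda>k. c (r1 k)))"
    using cbound by (auto simp: bounded_iff D_def intro!: exI[of _ D])
  then obtain d r2 where r2: "strict_mono r2" and d: "(\<lambda>k. c (r1 (r2 k))) \<longlonglongrightarrow> d"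
    using bounded_imp_convergent_subsequence[of "\<lambda>k. c (r1 k)"] by (auto simp: o_def)
  define r where "r k = r1 (r2 k)" for k
  have r: "strict_mono r" using r1 r2 by (auto simp: r_def strict_mono_def)
  define y where "y x = d + primitive L w x" for x
  have y: "y \<in> H1 L" and dy: "AE x in Om L. ddx L y x = w x"
    using const_plus_primitive_H1[OF w L, of d] by (auto simp: y_def[abs_def])
  have weak: "L2_weak_lim L (\<lambda>k. v (r k)) w"
    using L2_weak_lim_subseq[OF weak r2] by (simp add: r_def)
  have plim: "(\<lambda>k. primitive L (v (r k)) x) \<longlonglongrightarrow> primitive L w x" for x
    unfolding primitive_eq_inner using weak indicator_below_L2 by (simp add: L2_weak_lim_def)
  have all: "AE x in Om L. \<forall>k. z k x = c k + primitive L (v k) x" using c by (simp add: AE_all_countable)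
  show ?thesis
  proof (rule that[OF r y])
    show "AE x in Om L. (\<lambda>k. z (r k) x) \<longlonglongrightarrow> y x"
      using all
    proof eventually_elim
      case (elim x)
      have "(\<lambda>k. c (r k) + primitive L (v (r k)) x) \<longlonglongrightarrow> y x"
        unfolding y_def by (intro tendsto_intros plim d[folded r_def])
      then show ?case using elim by simp
    qed
    show "AE x in Om L. \<bar>z (r k) x\<bar> \<le> D + M" for k
      using all
    proof eventually_elim
      case (elim x)
      then have "z (r k) x = c (r k) + primitive L (v (r k)) x" by blast
      then show ?case using cbound[of "r k"] prim[of "r k" x] unfolding D_def by linarith
    qed
    have "L2_inner L (ddx L y) u = L2_inner L w u" if "u \<in> L2 L" for u
      using dy w that ddx_spec(1)[OF y] by (intro L2_inner_cong_AE) auto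
    then show "L2_weak_lim L (\<lambda>k. ddx L (z (r k))) (ddx L y)"
      using weak by (simp add: L2_weak_lim_def v_def)
  qed
qed

section \<open>Sobolev and product spaces as Hilbert spaces\<close>

lemma H1_lincomb:
  assumes y: "y \<in> H1 L" and z: "z \<in> H1 L"
  shows "(\<lambda>x. a * y x + b * z x) \<in> H1 L"
    and "AE x in Om L. ddx L (\<lambda>x. a * y x + b * z x) x = a * ddx L y x + b * ddx L z x"
proof -
  note yL = H1_L2[OF y] and zL = H1_L2[OF z] and dy = ddx_spec[OF y] and dz = ddx_spec[OF z]
  have "has_distr_deriv L (\<lambda>x. a * y x + b * z x) (\<lambda>x. a * ddx L y x + b * ddx L z x)"
    unfolding has_distr_deriv_def
  proof
    fix \<phi> assume \<phi>: "\<phi> \<in> test_functions L"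
    have p: "\<phi> \<in> L2 L" "deriv \<phi> \<in> L2 L"
      using \<phi> by (auto intro: test_function_L2 test_function_deriv)
    have 1: "(LINT x|Om L. (a * f x + b * g x) * h x) = a * (LINT x|Om L. f x * h x) + b * (LINT x|Om L. g x * h x)"
      if "f \<in> L2 L" "g \<in> L2 L" "h \<in> L2 L" for f g h
      using L2_inner_simps(1,5)[of _ L] that by (simp add: L2_inner_def)
    show "(LINT x|Om L. (a * y x + b * z x) * deriv \<phi> x) = - (LINT x|Om L. (a * ddx L y x + b * ddx L z x) * \<phi> x)"
      unfolding 1[OF yL zL p(2)] 1[OF dy(1) dz(1) p(1)]
      using dy(2) dz(2) \<phi> by (simp add: has_distr_deriv_def)
  qed
  from ddx_eq[OF _ _ this] show "(\<lambda>x. a * y x + b * z x) \<in> H1 L"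
    and "AE x in Om L. ddx L (\<lambda>x. a * y x + b * z x) x = a * ddx L y x + b * ddx L z x"
    using yL zL dy dz by auto
qed

lemma H1_zero: "(\<lambda>x. 0) \<in> H1 L" and ddx_zero: "AE x in Om L. ddx L (\<lambda>x. 0) x = 0"
  using ddx_eq[of "\<lambda>x. 0" L "\<lambda>x. 0"] by (auto simp: has_distr_deriv_def)

lemma H1_subspace: "subspace (H1 L)"
  using H1_lincomb[of _ L _ 1 1] H1_lincomb[of _ L _ _ 0] H1_zero
  by (auto simp: subspace_def plus_fun_def zero_fun_def scaleR_fun_def)

lemma ddx_add:
  assumes "y \<in> H1 L" "z \<in> H1 L"
  shows "AE x in Om L. ddx L (\<lambda>x. y x + z x) x = ddx L y x + ddx L z x"
  using H1_lincomb(2)[OF assms, of 1 1] by simp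

lemma ddx_diff:
  assumes "y \<in> H1 L" "z \<in> H1 L"
  shows "AE x in Om L. ddx L (\<lambda>x. y x - z x) x = ddx L y x - ddx L z x"
  using H1_lincomb(2)[OF assms, of 1 "-1"] by simp

lemma ddx_scale:
  assumes "y \<in> H1 L"
  shows "AE x in Om L. ddx L (\<lambda>x. c * y x) x = c * ddx L y x"
  using H1_lincomb(2)[OF assms assms, of c 0] by simp

lemma H1_closed:
  assumes "y \<in> H1 L" "z \<in> H1 L"
  shows "(\<lambda>x. y x + z x) \<in> H1 L" "(\<lambda>x. y x - z x) \<in> H1 L" "(\<lambda>x. c * y x) \<in> H1 L"
  using H1_lincomb(1)[OF assms, of 1 1] H1_lincomb(1)[OF assms, of 1 "-1"] H1_lincomb(1)[OF assms, of c 0]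
  by simp_all

lemma H1_complete:
  assumes X: "\<And>k::nat. X k \<in> H1 L"
    and cauchy: "\<And>e. e > 0 \<Longrightarrow>
      \<exists>N. \<forall>i\<ge>N. \<forall>j\<ge>N. H1_inner L (\<lambda>x. X i x - X j x) (\<lambda>x. X i x - X j x) < e"
  shows "\<exists>z\<in>H1 L. (\<lambda>k. H1_inner L (\<lambda>x. X k x - z x) (\<lambda>x. X k x - z x)) \<longlonglongrightarrow> 0"
proof -
  note XL = H1_L2[OF X] and dX = ddx_spec[OF X]
  have sq: "H1_inner L (\<lambda>x. y x - z x) (\<lambda>x. y x - z x) =
      L2_sq L (\<lambda>x. y x - z x) + L2_sq L (\<lambda>x. ddx L y x - ddx L z x)"
    if "y \<in> H1 L" "z \<in> H1 L" for y z
    unfolding H1_inner_def using ddx_diff[OF that] ddx_spec(1)[OF H1_closed(2)[OF that]] ddx_spec(1)[OF that(1)] ddx_spec(1)[OF that(2)]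
    by (intro arg_cong2[of _ _ _ _ "(+)"] refl L2_inner_cong_AE) auto
  have "\<exists>z\<in>L2 L. (\<lambda>k. L2_sq L (\<lambda>x. X k x - z x)) \<longlonglongrightarrow> 0"
  proof (rule L2_complete[OF XL])
    fix e :: real assume "e > 0"
    then obtain N where N: "\<forall>i\<ge>N. \<forall>j\<ge>N. H1_inner L (\<lambda>x. X i x - X j x) (\<lambda>x. X i x - X j x) < e" using cauchy by blast
    have "L2_sq L (\<lambda>x. X i x - X j x) < e" if "i \<ge> N" "j \<ge> N" for i j
    proof -
      have "L2_sq L (\<lambda>x. X i x - X j x) \<le> H1_inner L (\<lambda>x. X i x - X j x) (\<lambda>x. X i x - X j x)"
        by (simp add: sq[OF X X] L2_inner_self_nonneg)
      then show ?thesis using N that by fastforce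
    qed
    then show "\<exists>N. \<forall>i\<ge>N. \<forall>j\<ge>N. L2_sq L (\<lambda>x. X i x - X j x) < e" by blast
  qed
  then obtain z where z: "z \<in> L2 L" and zlim: "(\<lambda>k. L2_sq L (\<lambda>x. X k x - z x)) \<longlonglongrightarrow> 0" by blast
  have "\<exists>v\<in>L2 L. (\<lambda>k. L2_sq L (\<lambda>x. ddx L (X k) x - v x)) \<longlonglongrightarrow> 0"
  proof (rule L2_complete[OF dX(1)])
    fix e :: real assume "e > 0"
    then obtain N where N: "\<forall>i\<ge>N. \<forall>j\<ge>N. H1_inner L (\<lambda>x. X i x - X j x) (\<lambda>x. X i x - X j x) < e" using cauchy by blast
    have "L2_sq L (\<lambda>x. ddx L (X i) x - ddx L (X j) x) < e" if "i \<ge> N" "j \<ge> N" for i j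
    proof -
      have "L2_sq L (\<lambda>x. ddx L (X i) x - ddx L (X j) x) \<le> H1_inner L (\<lambda>x. X i x - X j x) (\<lambda>x. X i x - X j x)"
        by (simp add: sq[OF X X] L2_inner_self_nonneg)
      then show ?thesis using N that by fastforce
    qed
    then show "\<exists>N. \<forall>i\<ge>N. \<forall>j\<ge>N. L2_sq L (\<lambda>x. ddx L (X i) x - ddx L (X j) x) < e" by blast
  qed
  then obtain v where v: "v \<in> L2 L" and vlim: "(\<lambda>k. L2_sq L (\<lambda>x. ddx L (X k) x - v x)) \<longlonglongrightarrow> 0" by blast
  have "has_distr_deriv L z v"
    unfolding has_distr_deriv_def
  proof
    fix \<phi> assume \<phi>: "\<phi> \<in> test_functions L"
    then have p: "\<phi> \<in> L2 L" "deriv \<phi> \<in> L2 L" by (auto intro: test_function_L2 test_function_deriv)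
    have l1: "(\<lambda>k. L2_inner L (X k) (deriv \<phi>)) \<longlonglongrightarrow> L2_inner L z (deriv \<phi>)"
      using L2.tendsto_ip_left[OF XL z p(2)] zlim by (simp add: fun_diff_def)
    have l2: "(\<lambda>k. L2_inner L (ddx L (X k)) \<phi>) \<longlonglongrightarrow> L2_inner L v \<phi>"
      using L2.tendsto_ip_left[OF dX(1) v p(1)] vlim by (simp add: fun_diff_def)
    have "L2_inner L (X k) (deriv \<phi>) = - L2_inner L (ddx L (X k)) \<phi>" for k
      using dX(2) \<phi> by (simp add: has_distr_deriv_def L2_inner_def)
    then have "(\<lambda>k. L2_inner L (X k) (deriv \<phi>)) \<longlonglongrightarrow> - L2_inner L v \<phi>"
      using tendsto_minus[OF l2] by simp
    then have "L2_inner L z (deriv \<phi>) = - L2_inner L v \<phi>" by (rule LIMSEQ_unique[OF l1])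
    then show "(LINT x|Om L. z x * deriv \<phi> x) = - (LINT x|Om L. v x * \<phi> x)" by (simp add: L2_inner_def)
  qed
  from ddx_eq[OF z v this] have zH: "z \<in> H1 L" and dz: "AE x in Om L. ddx L z x = v x" .
  have "L2_sq L (\<lambda>x. ddx L (X k) x - ddx L z x)
      = L2_sq L (\<lambda>x. ddx L (X k) x - v x)" for k
  proof -
    have "AE x in Om L. ddx L (X k) x - ddx L z x = ddx L (X k) x - v x" using dz by eventually_elim simp
    then show ?thesis using dX(1)[of k] v ddx_spec(1)[OF zH] by (intro L2_inner_cong_AE L2_diff)
  qed
  then have "(\<lambda>k. H1_inner L (\<lambda>x. X k x - z x) (\<lambda>x. X k x - z x)) \<longlonglongrightarrow> 0 + 0"
    using tendsto_add[OF zlim vlim] by (simp add: sq[OF X zH])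
  with zH show ?thesis by auto
qed

interpretation H1: semi_hilbert "H1 L" "H1_inner L" for L
proof
  show "subspace (H1 L)" by (rule H1_subspace)
  show "H1_inner L x y = H1_inner L y x" for x y by (simp add: H1_inner_def L2_inner_sym)
  show "0 \<le> H1_inner L x x" for x by (simp add: H1_inner_def L2_inner_self_nonneg)
next
  fix x y z assume H: "x \<in> H1 L" "y \<in> H1 L" "z \<in> H1 L"
  have "L2_inner L (ddx L (\<lambda>t. x t + y t)) (ddx L z) = L2_inner L (\<lambda>t. ddx L x t + ddx L y t) (ddx L z)"
    using ddx_add[OF H(1,2)] ddx_spec(1)[OF H(1)] ddx_spec(1)[OF H(2)] ddx_spec(1)[OF H(3)] ddx_spec(1)[OF H1_closed(1)[OF H(1,2)]]
    by (intro L2_inner_cong_AE) auto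
  then show "H1_inner L (x + y) z = H1_inner L x z + H1_inner L y z"
    using H[THEN H1_L2] ddx_spec(1)[OF H(1)] ddx_spec(1)[OF H(2)] ddx_spec(1)[OF H(3)]
    by (simp add: H1_inner_def plus_fun_def L2_inner_simps)
next
  fix x y r assume H: "x \<in> H1 L" "y \<in> H1 L"
  have "L2_inner L (ddx L (\<lambda>t. r * x t)) (ddx L y) = L2_inner L (\<lambda>t. r * ddx L x t) (ddx L y)"
    using ddx_scale[OF H(1)] ddx_spec(1)[OF H(1)] ddx_spec(1)[OF H(2)] ddx_spec(1)[OF H1_closed(3)[OF H(1,1)]]
    by (intro L2_inner_cong_AE) auto
  then show "H1_inner L (r *\<^sub>R x) y = r * H1_inner L x y"
    using H[THEN H1_L2] ddx_spec(1)[OF H(1)] ddx_spec(1)[OF H(2)]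
    by (simp add: H1_inner_def scaleR_fun_def L2_inner_simps algebra_simps)
next
  fix X :: "nat \<Rightarrow> real \<Rightarrow> real" and L assume "\<And>k. X k \<in> H1 L"
    and "\<And>e. e > 0 \<Longrightarrow> \<exists>N. \<forall>i\<ge>N. \<forall>j\<ge>N. H1_inner L (X i - X j) (X i - X j) < e"
  then show "\<exists>x\<in>H1 L. (\<lambda>k. H1_inner L (X k - x) (X k - x)) \<longlonglongrightarrow> 0"
    unfolding fun_diff_def by (rule H1_complete)
qed

text \<open>
  Convergent sequences of numbers are bounded, so uniform boundedness applies to the functionals
  that the sequence represents.
\<close>

lemma H1_weak_lim_bounded:
  assumes X: "\<And>k. X k \<in> H1 L" and lim: "H1_weak_lim L X x"
  obtains B where "\<And>k. L2_sq L (X k) \<le> B"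
proof -
  have "\<exists>B. \<forall>k. H1_inner L (X k) (X k) \<le> B"
  proof (rule H1.uniform_boundedness[OF X])
    fix y assume "y \<in> H1 L"
    then have "convergent (\<lambda>k. H1_inner L (X k) y)" using lim by (auto simp: H1_weak_lim_def convergent_def)
    then have "Bseq (\<lambda>k. H1_inner L (X k) y)" by (rule convergent_imp_Bseq)
    then show "\<exists>C. \<forall>k. \<bar>H1_inner L (X k) y\<bar> \<le> C" by (auto simp: Bseq_def)
  qed
  then obtain B where B: "\<And>k. H1_inner L (X k) (X k) \<le> B" by blast
  have "L2_sq L (X k) \<le> B" for k
    using B[of k] L2_inner_self_nonneg[of L "ddx L (X k)"] unfolding H1_inner_def by linarith
  then show ?thesis by (rule that)
qed

text \<open>An \<open>L\<^sup>2\<close> functional restricted to \<open>H\<^sup>1\<close> is an \<open>H\<^sup>1\<close> inner product, by Riesz representation.\<close>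

lemma H1_weak_lim_imp_L2_weak_lim:
  assumes X: "\<And>k. X k \<in> H1 L" and x: "x \<in> H1 L" and lim: "H1_weak_lim L X x"
  shows "L2_weak_lim L X x"
  unfolding L2_weak_lim_def
proof
  fix h assume h: "h \<in> L2 L"
  obtain u where u: "u \<in> H1 L" "\<And>y. y \<in> H1 L \<Longrightarrow> H1_inner L u y = L2_inner L h y"
  proof (rule H1.Riesz_on_subspace[OF H1_subspace[of L] subset_refl, of "L2_inner L h" "sqrt (L2_sq L h)"])
    fix y assume y: "y \<in> H1 L"
    have "\<bar>L2_inner L h y\<bar> \<le> sqrt (L2_sq L h) * sqrt (L2_sq L y)"
      by (rule L2.Cauchy_Schwarz_abs[OF h H1_L2[OF y]])
    also have "\<dots> \<le> sqrt (L2_sq L h) * sqrt (H1_inner L y y)"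
      by (intro mult_left_mono) (auto simp: H1_inner_def L2_inner_self_nonneg)
    finally show "\<bar>L2_inner L h y\<bar> \<le> sqrt (L2_sq L h) * sqrt (H1_inner L y y)" .
  qed (use h in \<open>auto simp: L2.ip_simps H1_L2\<close>)
  have eq: "H1_inner L y u = L2_inner L y h" if "y \<in> H1 L" for y
    using u(2)[OF that] by (simp add: L2_inner_sym H1_inner_def)
  have "(\<lambda>k. H1_inner L (X k) u) \<longlonglongrightarrow> H1_inner L x u" using lim u(1) by (simp add: H1_weak_lim_def)
  then show "(\<lambda>k. L2_inner L (X k) h) \<longlonglongrightarrow> L2_inner L x h" by (simp add: eq X x)
qed

interpretation XX: semi_hilbert "XX L n" "XX_inner L n" for L n
proof
  show "subspace (XX L n)"
    by (auto simp: subspace_def XX_def plus_fun_def zero_fun_def scaleR_fun_def)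
  show "XX_inner L n x y = XX_inner L n y x" for x y by (simp add: XX_inner_def L2_inner_sym)
  show "0 \<le> XX_inner L n x x" for x by (simp add: XX_inner_def L2_inner_self_nonneg sum_nonneg)
next
  fix x y z :: "nat \<Rightarrow> real \<Rightarrow> real" assume "x \<in> XX L n" "y \<in> XX L n" "z \<in> XX L n"
  then show "XX_inner L n (x + y) z = XX_inner L n x z + XX_inner L n y z"
    unfolding XX_inner_def sum.distrib[symmetric]
    by (intro sum.cong) (auto simp: XX_def L2.ip_add_left)
next
  fix x y :: "nat \<Rightarrow> real \<Rightarrow> real" and r assume "x \<in> XX L n" "y \<in> XX L n"
  then show "XX_inner L n (r *\<^sub>R x) y = r * XX_inner L n x y"
    unfolding XX_inner_def sum_distrib_left
    by (intro sum.cong) (auto simp: XX_def L2.ip_scale_left)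
next
  fix X :: "nat \<Rightarrow> nat \<Rightarrow> real \<Rightarrow> real" and L n assume X: "\<And>k. X k \<in> XX L n"
    and cauchy: "\<And>e. e > 0 \<Longrightarrow> \<exists>N. \<forall>i\<ge>N. \<forall>j\<ge>N. XX_inner L n (X i - X j) (X i - X j) < e"
  have "\<forall>c\<in>{1..n}. \<exists>x. x \<in> L2 L \<and> (\<lambda>k. L2_sq L (X k c - x)) \<longlonglongrightarrow> 0"
  proof
    fix c assume c: "c \<in> {1..n}"
    have "\<exists>x\<in>L2 L. (\<lambda>k. L2_sq L (X k c - x)) \<longlonglongrightarrow> 0"
    proof (rule L2.complete)
      show "X k c \<in> L2 L" for k using X c by (auto simp: XX_def)
      fix e :: real assume "e > 0"
      then obtain N where N: "\<forall>i\<ge>N. \<forall>j\<ge>N. XX_inner L n (X i - X j) (X i - X j) < e" using cauchy by blast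
      have "L2_sq L (X i c - X j c) < e" if "i \<ge> N" "j \<ge> N" for i j
      proof -
        have "L2_sq L ((X i - X j) c) \<le> XX_inner L n (X i - X j) (X i - X j)"
          unfolding XX_inner_def using c by (intro member_le_sum) (auto simp: L2_inner_self_nonneg)
        then show ?thesis using N that by fastforce
      qed
      then show "\<exists>N. \<forall>i\<ge>N. \<forall>j\<ge>N. L2_sq L (X i c - X j c) < e" by blast
    qed
    then show "\<exists>x. x \<in> L2 L \<and> (\<lambda>k. L2_sq L (X k c - x)) \<longlonglongrightarrow> 0" by blast
  qed
  from bchoice[OF this] obtain x where
    x: "\<And>c. c \<in> {1..n} \<Longrightarrow> x c \<in> L2 L" "\<And>c. c \<in> {1..n} \<Longrightarrow> (\<lambda>k. L2_sq L (X k c - x c)) \<longlonglongrightarrow> 0"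
    by blast
  have "(\<lambda>k. XX_inner L n (X k - x) (X k - x)) \<longlonglongrightarrow> (\<Sum>c=1..n. 0)"
    unfolding XX_inner_def using x(2) by (intro tendsto_sum) simp
  then show "\<exists>x\<in>XX L n. (\<lambda>k. XX_inner L n (X k - x) (X k - x)) \<longlonglongrightarrow> 0"
    using x(1) by (intro bexI[of _ x]) (auto simp: XX_def)
qed

lemma XX_weakly_iff: "semi_hilbert.weakly (XX L n) (XX_inner L n) = XX_weak_lim L n"
  by (intro ext) (simp add: XX.weakly_def XX_weak_lim_def)

lemma XX_weak_lim_component:
  assumes "XX_weak_lim L n u u0" and i: "i \<in> {1..n}"
  shows "L2_weak_lim L (\<lambda>k. u k i) (u0 i)"
  unfolding L2_weak_lim_def
proof
  fix h assume h: "h \<in> L2 L"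
  define v where "v = (\<lambda>j. if j = i then h else (\<lambda>_. 0))"
  have "v \<in> XX L n" using h by (auto simp: XX_def v_def)
  moreover have "XX_inner L n w v = L2_inner L (w i) h" for w
  proof -
    have "XX_inner L n w v = (\<Sum>j=1..n. if j = i then L2_inner L (w i) h else 0)"
      unfolding XX_inner_def v_def by (intro sum.cong) (auto simp: L2_inner_def)
    then show ?thesis using i by simp
  qed
  ultimately show "(\<lambda>k. L2_inner L (u k i) h) \<longlonglongrightarrow> L2_inner L (u0 i) h"
    using assms(1) by (auto simp: XX_weak_lim_def)
qed

lemma XX_inner_component_le: "i \<in> {1..n} \<Longrightarrow> L2_sq L (u i) \<le> XX_inner L n u u"
  unfolding XX_inner_def by (intro member_le_sum) (auto simp: L2_inner_self_nonneg)

section \<open>The convex potentials and their parameter limits\<close>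

lemma sequentially_within:
  fixes F :: "real \<Rightarrow> 'a::topological_space"
  assumes "(F \<longlongrightarrow> F a) (at a within S)" and "\<And>k. s k \<in> S" and "s \<longlonglongrightarrow> a"
  shows "(\<lambda>k::nat. F (s k)) \<longlonglongrightarrow> F a"
  using assms continuous_within_tendsto_compose'[of a S F s sequentially] by (simp add: continuous_within)

text \<open>
  Difference quotients to the right and to the left enclose a subgradient. They converge to those
  of the limit function, which are close to its derivative for a small increment.
\<close>

lemma subgradients_converge:
  fixes \<phi> :: "real \<Rightarrow> real" and p :: "nat \<Rightarrow> real"
  assumes conv: "\<And>s. (\<lambda>k. \<phi>k k s) \<longlonglongrightarrow> \<phi> s" and subgrad: "\<And>k s. \<phi>k k s \<ge> \<phi>k k r + p k * (s - r)"
    and deriv: "(\<phi> has_real_derivative q) (at r)"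
  shows "p \<longlonglongrightarrow> q"
proof (rule LIMSEQ_I)
  fix e :: real assume e: "e > 0"
  have "((\<lambda>h. (\<phi> (r + h) - \<phi> r) / h) \<longlongrightarrow> q) (at 0)" using deriv by (simp add: DERIV_def)
  from LIM_D[OF this e] obtain d where d: "d > 0"
    "\<And>h. h \<noteq> 0 \<Longrightarrow> \<bar>h\<bar> < d \<Longrightarrow> \<bar>(\<phi> (r + h) - \<phi> r) / h - q\<bar> < e" by auto
  define t where "t = d / 2"
  have t: "t > 0" "\<bar>t\<bar> < d" "\<bar>-t\<bar> < d" using d by (auto simp: t_def)
  have up: "(\<phi> (r + t) - \<phi> r) / t < q + e" and lo: "(\<phi> (r - t) - \<phi> r) / (- t) > q - e"
    using d(2)[of t] d(2)[of "-t"] t by auto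
  have "(\<lambda>k. (\<phi>k k (r + t) - \<phi>k k r) / t) \<longlonglongrightarrow> (\<phi> (r + t) - \<phi> r) / t"
    using t by (intro tendsto_intros conv) auto
  then have 1: "\<forall>\<^sub>F k in sequentially. (\<phi>k k (r + t) - \<phi>k k r) / t < q + e" using up by (rule order_tendstoD)
  have "(\<lambda>k. (\<phi>k k (r - t) - \<phi>k k r) / (- t)) \<longlonglongrightarrow> (\<phi> (r - t) - \<phi> r) / (- t)"
    using t by (intro tendsto_intros conv) auto
  then have 2: "\<forall>\<^sub>F k in sequentially. q - e < (\<phi>k k (r - t) - \<phi>k k r) / (- t)" using lo by (rule order_tendstoD)
  have "\<forall>\<^sub>F k in sequentially. norm (p k - q) < e"
    using 1 2
  proof eventually_elim
    case (elim k)
    have "p k \<le> (\<phi>k k (r + t) - \<phi>k k r) / t" using subgrad[of k "r + t"] t by (simp add: field_simps)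
    moreover have "(\<phi>k k (r - t) - \<phi>k k r) / (- t) \<le> p k" using subgrad[of k "r - t"] t by (simp add: field_simps)
    ultimately show ?case using elim by (simp add: abs_less_iff)
  qed
  then show "\<exists>no. \<forall>k\<ge>no. norm (p k - q) < e" by (simp add: eventually_sequentially)
qed

text \<open>
  A selection of the subdifferential of \<open>f \<epsilon>\<close>. At the kink of \<open>f 0\<close> the value \<open>sgn 0 = 0\<close> is the
  one that makes the selection continuous in \<open>\<epsilon>\<close>, since \<open>0\<close> minimizes every \<open>f \<epsilon>\<close>.
\<close>

definition fsub :: "(real \<Rightarrow> real \<Rightarrow> real) \<Rightarrow> real \<Rightarrow> real \<Rightarrow> real" where
  "fsub f \<epsilon> r = (if \<epsilon> = 0 then sgn r else deriv (f \<epsilon>) r)"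

context
  fixes f :: "real \<Rightarrow> real \<Rightarrow> real"
  assumes f: "f_family f"
begin

lemma f_at_0: "f 0 r = \<bar>r\<bar>"
  using f by (simp add: f_family_def)

lemma f_nonneg: "\<epsilon> \<in> {0..1} \<Longrightarrow> 0 \<le> f \<epsilon> r"
  using f by (cases "\<epsilon> = 0") (auto simp: f_family_def)

lemma f_zero: "\<epsilon> \<in> {0..1} \<Longrightarrow> f \<epsilon> 0 = 0"
  using f by (cases "\<epsilon> = 0") (auto simp: f_family_def)

lemma f_convex:
  assumes "\<epsilon> \<in> {0..1}"
  shows "convex_on UNIV (f \<epsilon>)"
proof (cases "\<epsilon> = 0")
  case True
  then have "f \<epsilon> = dist 0" by (simp add: fun_eq_iff f_at_0 dist_real_def)
  then show ?thesis using convex_on_dist[OF convex_UNIV, of "0::real"] by (simp only:)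
next
  case False
  then show ?thesis using f assms by (auto simp: f_family_def)
qed

lemma f_convex_ineq:
  assumes "\<epsilon> \<in> {0..1}" and "0 \<le> t" "t \<le> 1"
  shows "f \<epsilon> ((1 - t) * a + t * b) \<le> (1 - t) * f \<epsilon> a + t * f \<epsilon> b"
  using convex_onD[OF f_convex[OF assms(1)] assms(2,3), of a b] by simp

lemma f_DERIV: "\<epsilon> \<in> {0<..1} \<Longrightarrow> (f \<epsilon> has_real_derivative deriv (f \<epsilon>) r) (at r)"
  using f by (intro real_differentiable_DERIV) (auto simp: f_family_def C2_def)

lemma f_tendsto: "(\<And>k. E k \<in> {0..1}) \<Longrightarrow> E \<longlonglongrightarrow> \<epsilon> \<Longrightarrow> \<epsilon> \<in> {0..1} \<Longrightarrow> (\<lambda>k::nat. f (E k) r) \<longlonglongrightarrow> f \<epsilon> r"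
  using f by (intro sequentially_within[where F="\<lambda>\<epsilon>. f \<epsilon> r"]) (auto simp: f_family_def)

lemma f_subgradient:
  assumes "\<epsilon> \<in> {0..1}"
  shows "f \<epsilon> s \<ge> f \<epsilon> r + fsub f \<epsilon> r * (s - r)"
proof (cases "\<epsilon> = 0")
  case True
  then show ?thesis by (auto simp: f_at_0 fsub_def sgn_if)
next
  case False
  then have "f \<epsilon> s - f \<epsilon> r \<ge> deriv (f \<epsilon>) r * (s - r)"
    using assms f_DERIV[of \<epsilon> r] by (intro convex_on_imp_above_tangent[OF f_convex[OF assms]]) auto
  then show ?thesis using False by (simp add: fsub_def)
qed

lemma fsub_bound:
  obtains C where "C > 0" "\<And>\<epsilon> r. \<epsilon> \<in> {0..1} \<Longrightarrow> \<bar>fsub f \<epsilon> r\<bar> \<le> C * (1 + \<bar>r\<bar>)"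
proof -
  obtain C0 where C0: "C0 > 0" "\<And>\<epsilon> r. \<epsilon> \<in> {0<..1} \<Longrightarrow> \<bar>deriv (f \<epsilon>) r\<bar> \<le> C0 * (1 + \<bar>r\<bar>)"
    using f by (auto simp: f_family_def)
  have "\<bar>fsub f \<epsilon> r\<bar> \<le> (C0 + 1) * (1 + \<bar>r\<bar>)" if e: "\<epsilon> \<in> {0..1}" for \<epsilon> r
  proof (cases "\<epsilon> = 0")
    case True
    have "\<bar>sgn r\<bar> \<le> 1 * (1 + \<bar>r\<bar>)" by (auto simp: sgn_if)
    also have "\<dots> \<le> (C0 + 1) * (1 + \<bar>r\<bar>)" using C0 by (intro mult_right_mono) auto
    finally show ?thesis using True by (simp add: fsub_def)
  next
    case False
    then have "\<bar>fsub f \<epsilon> r\<bar> \<le> C0 * (1 + \<bar>r\<bar>)" using C0(2) e by (auto simp: fsub_def)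
    also have "\<dots> \<le> (C0 + 1) * (1 + \<bar>r\<bar>)" by (intro mult_right_mono) auto
    finally show ?thesis .
  qed
  then show ?thesis using that[of "C0 + 1"] C0(1) by auto
qed

text \<open>
  The subgradient inequality between \<open>r\<close> and \<open>0\<close> bounds \<open>f \<epsilon> r\<close> by \<open>fsub f \<epsilon> r * r\<close>.
\<close>

lemma f_growth:
  obtains C where "C > 0" "\<And>\<epsilon> r. \<epsilon> \<in> {0..1} \<Longrightarrow> f \<epsilon> r \<le> C * (1 + r\<^sup>2)"
proof -
  obtain C where C: "C > 0" "\<And>\<epsilon> r. \<epsilon> \<in> {0..1} \<Longrightarrow> \<bar>fsub f \<epsilon> r\<bar> \<le> C * (1 + \<bar>r\<bar>)" using fsub_bound by blast
  have "f \<epsilon> r \<le> (2 * C) * (1 + r\<^sup>2)" if e: "\<epsilon> \<in> {0..1}" for \<epsilon> r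
  proof -
    have "f \<epsilon> r \<le> fsub f \<epsilon> r * r" using f_subgradient[OF e, of r 0] f_zero[OF e] by simp
    also have "\<dots> \<le> \<bar>fsub f \<epsilon> r\<bar> * \<bar>r\<bar>" by (simp add: abs_mult[symmetric])
    also have "\<dots> \<le> C * (1 + \<bar>r\<bar>) * \<bar>r\<bar>" using C(2)[OF e] by (intro mult_right_mono) auto
    also have "\<dots> = C * (\<bar>r\<bar> + r\<^sup>2)" by (simp add: algebra_simps power2_eq_square)
    also have "\<dots> \<le> C * (2 * (1 + r\<^sup>2))"
    proof (intro mult_left_mono)
      show "\<bar>r\<bar> + r\<^sup>2 \<le> 2 * (1 + r\<^sup>2)"
        using sum_squares_bound[of 1 "\<bar>r\<bar>"] zero_le_power2[of r] unfolding power2_abs by simp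
    qed (use C in auto)
    finally show ?thesis by (simp add: algebra_simps)
  qed
  then show ?thesis using that[of "2 * C"] C(1) by auto
qed

text \<open>
  At the kink of the limit all selected subgradients vanish; elsewhere the limit function is
  differentiable.
\<close>

lemma fsub_tendsto:
  assumes E: "\<And>k. E k \<in> {0..1}" "E \<longlonglongrightarrow> \<epsilon>" "\<epsilon> \<in> {0..1}"
  shows "(\<lambda>k::nat. fsub f (E k) r) \<longlonglongrightarrow> fsub f \<epsilon> r"
proof (cases "\<epsilon> = 0 \<and> r = 0")
  case True
  have "fsub f \<epsilon> 0 = 0" if "\<epsilon> \<in> {0..1}" for \<epsilon>
  proof (cases "\<epsilon> = 0")
    case False
    then have "(f \<epsilon> has_real_derivative deriv (f \<epsilon>) 0) (at 0)" using that f_DERIV[of \<epsilon> 0] by auto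
    then have "deriv (f \<epsilon>) 0 = 0"
      by (rule DERIV_local_min[of _ _ _ 1]) (use that f_nonneg f_zero in auto)
    then show ?thesis using False by (simp add: fsub_def)
  qed (simp add: fsub_def)
  then show ?thesis using True E by simp
next
  case False
  have "(f \<epsilon> has_real_derivative fsub f \<epsilon> r) (at r)"
  proof (cases "\<epsilon> = 0")
    case True
    then have r: "r \<noteq> 0" using False by simp
    have "((\<lambda>r. \<bar>r\<bar>) has_real_derivative sgn r) (at r)"
    proof (cases "r > 0")
      case True
      have "((\<lambda>r. r) has_real_derivative 1) (at r)" by simp
      then have "((\<lambda>r. \<bar>r\<bar>) has_real_derivative 1) (at r)"
        by (rule has_field_derivative_transform_within_open[of _ _ _ "{0<..}"]) (use True in auto)
      then show ?thesis using True by simp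
    next
      case False
      have "((\<lambda>r. - r) has_real_derivative - 1) (at r)" by (auto intro!: derivative_eq_intros)
      then have "((\<lambda>r. \<bar>r\<bar>) has_real_derivative - 1) (at r)"
        by (rule has_field_derivative_transform_within_open[of _ _ _ "{..<0}"]) (use False r in auto)
      then show ?thesis using False r by simp
    qed
    moreover have "f \<epsilon> = (\<lambda>r. \<bar>r\<bar>)" using True by (simp add: fun_eq_iff f_at_0)
    ultimately show ?thesis using True by (simp add: fsub_def)
  next
    case False
    then show ?thesis using f_DERIV[of \<epsilon> r] E(3) by (simp add: fsub_def)
  qed
  with f_tendsto[OF E] f_subgradient[OF E(1)] show ?thesis
    by (rule subgradients_converge[of "\<lambda>k. f (E k)" "f \<epsilon>" r])
qed

lemma f_measurable: "\<epsilon> \<in> {0..1} \<Longrightarrow> f \<epsilon> \<in> borel_measurable borel"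
proof -
  assume e: "\<epsilon> \<in> {0..1}"
  have "continuous_on UNIV (f \<epsilon>)" using f_convex[OF e] by (intro convex_on_continuous) auto
  then show ?thesis by (rule borel_measurable_continuous_onI)
qed

lemma fsub_measurable: "\<epsilon> \<in> {0..1} \<Longrightarrow> fsub f \<epsilon> \<in> borel_measurable borel"
proof -
  assume e: "\<epsilon> \<in> {0..1}"
  show ?thesis
  proof (cases "\<epsilon> = 0")
    case True
    have "fsub f \<epsilon> = (\<lambda>r. if r > 0 then 1 else if r < 0 then -1 else 0)" using True by (auto simp: fsub_def sgn_if)
    then show ?thesis by simp
  next
    case False
    then have "C2 (f \<epsilon>)" using f e by (auto simp: f_family_def)
    then have "continuous_on UNIV (deriv (f \<epsilon>))" by (auto simp: C2_def intro: C1_differentiable_imp_continuous_on)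
    moreover have "fsub f \<epsilon> = deriv (f \<epsilon>)" using False by (auto simp: fsub_def)
    ultimately show ?thesis by (simp add: borel_measurable_continuous_onI)
  qed
qed

end

context
  fixes Kh K :: "real \<Rightarrow> real \<Rightarrow> real"
  assumes K: "K_family Kh K"
begin

lemma Kh_DERIV: "\<delta> \<in> {0<..1} \<Longrightarrow> (Kh \<delta> has_real_derivative K \<delta> r) (at r)"
  using K by (auto simp: K_family_def)

lemma Kh_convex:
  assumes d: "\<delta> \<in> {0<..1}"
  shows "convex_on UNIV (Kh \<delta>)"
proof (rule convex_on_realI)
  show "K \<delta> x \<le> K \<delta> y" if "x \<le> y" for x y
  proof (rule DERIV_nonneg_imp_nondecreasing[OF that])
    fix r
    have "K \<delta> C1_differentiable_on UNIV" using K d by (auto simp: K_family_def)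
    then have "(K \<delta> has_real_derivative deriv (K \<delta>) r) (at r)"
      by (intro real_differentiable_DERIV) (auto simp: C1_differentiable_on_eq)
    moreover have "\<exists>C>0. \<forall>r. 0 \<le> deriv (K \<delta>) r \<and> deriv (K \<delta>) r \<le> C"
      using K[unfolded K_family_def] d by blast
    ultimately show "\<exists>y. (K \<delta> has_real_derivative y) (at r) \<and> 0 \<le> y" by blast
  qed
qed (use Kh_DERIV[OF d] in auto)

lemma Kh_zero: "\<delta> \<in> {0<..1} \<Longrightarrow> r \<in> {-1..1} \<Longrightarrow> Kh \<delta> r = 0"
  using K by (auto simp: K_family_def)

text \<open>
  The potential is convex and lies above its tangent at \<open>0\<close>, which is horizontal because the
  potential vanishes on \<open>[-1,1]\<close>.
\<close>

lemma Kh_nonneg: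
  assumes d: "\<delta> \<in> {0<..1}"
  shows "0 \<le> Kh \<delta> r"
proof -
  have "((\<lambda>_. 0) has_real_derivative 0) (at (0::real))" by simp
  then have "(Kh \<delta> has_real_derivative 0) (at 0)"
    by (rule has_field_derivative_transform_within_open[of _ _ _ "{-1<..<1}"]) (use Kh_zero[OF d] in auto)
  then have "Kh \<delta> r - Kh \<delta> 0 \<ge> 0 * (r - 0)"
    by (intro convex_on_imp_above_tangent[OF Kh_convex[OF d]]) auto
  then show ?thesis using Kh_zero[OF d, of 0] by simp
qed

abbreviation \<kappa> :: "real \<Rightarrow> real \<Rightarrow> ennreal" where
  "\<kappa> \<delta> r \<equiv> e2ennreal (Khat Kh \<delta> r)"

lemma \<kappa>_pos: "\<delta> \<noteq> 0 \<Longrightarrow> \<kappa> \<delta> r = ennreal (Kh \<delta> r)"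
  by (simp add: Khat_def)

lemma \<kappa>_0: "\<kappa> 0 r = (if r \<in> {-1..1} then 0 else \<infinity>)"
  by (simp add: Khat_def e2ennreal_neg)

lemma \<kappa>_zero: "\<delta> \<in> {0..1} \<Longrightarrow> r \<in> {-1..1} \<Longrightarrow> \<kappa> \<delta> r = 0"
  using Kh_zero[of \<delta> r] by (cases "\<delta> = 0") (auto simp: Khat_def e2ennreal_neg)

lemma \<kappa>_convex:
  assumes d: "\<delta> \<in> {0..1}" and t: "0 \<le> t" "t \<le> 1"
  shows "\<kappa> \<delta> ((1 - t) * a + t * b) \<le> ennreal (1 - t) * \<kappa> \<delta> a + ennreal t * \<kappa> \<delta> b"
proof (cases "\<delta> = 0")
  case False
  then have d: "\<delta> \<in> {0<..1}" using d by auto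
  have "Kh \<delta> ((1 - t) * a + t * b) \<le> (1 - t) * Kh \<delta> a + t * Kh \<delta> b"
    using convex_onD[OF Kh_convex[OF d] t, of a b] by simp
  then have "ennreal (Kh \<delta> ((1 - t) * a + t * b)) \<le> ennreal ((1 - t) * Kh \<delta> a + t * Kh \<delta> b)"
    by (rule ennreal_leI)
  also have "\<dots> = ennreal (1 - t) * \<kappa> \<delta> a + ennreal t * \<kappa> \<delta> b"
    using t Kh_nonneg[OF d] False by (simp add: \<kappa>_pos ennreal_plus ennreal_mult del: ennreal_minus)
  finally show ?thesis using False by (simp add: \<kappa>_pos)
next
  case True
  consider "t = 0" | "t = 1" | "0 < t" "t < 1" using t by linarith
  then show ?thesis
  proof cases
    case 3
    show ?thesis
    proof (cases "a \<in> {-1..1} \<and> b \<in> {-1..1}")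
      case True
      have "(1 - t) *\<^sub>R a + t *\<^sub>R b \<in> {-1..1}"
        using True t by (intro convexD_alt) auto
      then show ?thesis using \<kappa>_zero[OF d] by simp
    next
      case False
      then show ?thesis using 3 \<open>\<delta> = 0\<close> by (auto simp: \<kappa>_0 ennreal_mult_top)
    qed
  qed auto
qed

lemma \<kappa>_measurable:
  assumes d: "\<delta> \<in> {0..1}"
  shows "\<kappa> \<delta> \<in> borel_measurable borel"
proof (cases "\<delta> = 0")
  case False
  then have "continuous_on UNIV (Kh \<delta>)"
    using Kh_DERIV[of \<delta>] d by (intro DERIV_continuous_on) auto
  then have "Kh \<delta> \<in> borel_measurable borel" by (rule borel_measurable_continuous_onI)
  then show ?thesis using False by (simp add: \<kappa>_pos)
qed (simp add: \<kappa>_0 del: atLeastAtMost_iff)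

lemma \<kappa>_liminf:
  assumes D: "\<And>k. D k \<in> {0..1}" "D \<longlonglongrightarrow> \<delta>" "\<delta> \<in> {0..1}" and r: "r \<longlonglongrightarrow> r0"
  shows "\<kappa> \<delta> r0 \<le> liminf (\<lambda>k::nat. \<kappa> (D k) (r k))"
proof -
  have "weak_lim r r0" using r by (auto simp: weak_lim_def intro!: tendsto_intros)
  moreover have "mosco_lim (\<lambda>k. Khat Kh (D k)) (Khat Kh \<delta>)"
    using K D by (auto simp: K_family_def mosco_within_def)
  ultimately have "Khat Kh \<delta> r0 \<le> liminf (\<lambda>k. Khat Kh (D k) (r k))" by (auto simp: mosco_lim_def)
  then have "\<kappa> \<delta> r0 \<le> e2ennreal (liminf (\<lambda>k. Khat Kh (D k) (r k)))" by (rule e2ennreal_mono)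
  also have "\<dots> = liminf (\<lambda>k. \<kappa> (D k) (r k))"
    by (rule Liminf_compose_continuous_mono[symmetric])
      (auto simp: continuous_on_e2ennreal mono_def e2ennreal_mono)
  finally show ?thesis .
qed

text \<open>
  For \<open>\<delta> > 0\<close> this is locally uniform convergence. For \<open>\<delta> = 0\<close> the bound is infinite off \<open>[-1,1]\<close>,
  and on \<open>[-1,1]\<close> all potentials vanish.
\<close>

lemma \<kappa>_upper:
  assumes D: "\<And>k. D k \<in> {0..1}" "D \<longlonglongrightarrow> \<delta>" "\<delta> \<in> {0..1}" and e: "e > 0"
  shows "\<forall>\<^sub>F k::nat in sequentially. \<forall>r\<in>{-B..B}. \<kappa> (D k) r \<le> \<kappa> \<delta> r + ennreal e"
proof (cases "\<delta> = 0")
  case True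
  have "\<kappa> (D k) r \<le> \<kappa> \<delta> r + ennreal e" for k r
    using \<kappa>_zero[OF D(1)] True by (auto simp: \<kappa>_0)
  then show ?thesis by simp
next
  case False
  then have d: "\<delta> \<in> {0<..1}" using D(3) by auto
  then have "uniform_limit {-B..B} Kh (Kh \<delta>) (at \<delta> within {0<..1})"
    using K by (auto simp: K_family_def)
  from uniform_limitD[OF this e]
  have "\<forall>\<^sub>F x in at \<delta> within {0<..1}. \<forall>r\<in>{-B..B}. dist (Kh x r) (Kh \<delta> r) < e" .
  then obtain S where S: "open S" "\<delta> \<in> S"
    "\<And>x. x \<in> S \<Longrightarrow> x \<noteq> \<delta> \<Longrightarrow> x \<in> {0<..1} \<Longrightarrow> \<forall>r\<in>{-B..B}. dist (Kh x r) (Kh \<delta> r) < e"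
    unfolding eventually_at_topological by blast
  have "\<forall>\<^sub>F k in sequentially. D k \<in> S \<inter> {0<..}"
    using D(2) by (rule topological_tendstoD) (use S d in auto)
  then show ?thesis
  proof eventually_elim
    case (elim k)
    show ?case
    proof
      fix r assume r: "r \<in> {-B..B}"
      have "Kh (D k) r \<le> Kh \<delta> r + e"
      proof (cases "D k = \<delta>")
        case True
        then show ?thesis using e by simp
      next
        case False
        then have "dist (Kh (D k) r) (Kh \<delta> r) < e" using S(3)[of "D k"] elim D(1)[of k] r by auto
        then show ?thesis by (simp add: dist_real_def abs_less_iff)
      qed
      then have "ennreal (Kh (D k) r) \<le> ennreal (Kh \<delta> r + e)" by (rule ennreal_leI)
      then show "\<kappa> (D k) r \<le> \<kappa> \<delta> r + ennreal e"
        using elim False Kh_nonneg[OF d] e by (auto simp: \<kappa>_pos)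
    qed
  qed
qed

end

section \<open>The energy functional\<close>

text \<open>
  The bound on \<open>Cg\<close> is what remains of the smallness of the time step \<open>\<tau>\<close>: it makes \<open>r / \<tau> + g r\<close>
  strongly monotone.
\<close>

locale phase_field =
  fixes L \<nu> \<tau> Cg :: real and f Kh K :: "real \<Rightarrow> real \<Rightarrow> real" and g :: "real \<Rightarrow> real"
  assumes L_pos: "0 < L" and nu_pos: "0 < \<nu>" and tau_pos: "0 < \<tau>" and tau_Cg: "Cg < 1 / \<tau>"
    and f_fam: "f_family f" and K_fam: "K_family Kh K" and g_ass: "g_assms g Cg"
begin

definition admissible :: "real \<Rightarrow> (real \<Rightarrow> real) set" where
  "admissible \<delta> = {z \<in> H1 L. Khat_integral L Kh \<delta> z < \<infinity>}"

definition gradient_energy :: "real \<Rightarrow> (real \<Rightarrow> real) \<Rightarrow> real" where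
  "gradient_energy \<epsilon> z = (LINT x|Om L. f \<epsilon> (ddx L z x))"

definition energy :: "real \<Rightarrow> real \<Rightarrow> (real \<Rightarrow> real) \<Rightarrow> real" where
  "energy \<epsilon> \<delta> z = gradient_energy \<epsilon> z + \<nu>\<^sup>2 / 2 * L2_sq L (ddx L z)
     + enn2real (Khat_integral L Kh \<delta> z)"

lemma admissible_H1: "z \<in> admissible \<delta> \<Longrightarrow> z \<in> H1 L"
  by (simp add: admissible_def)

lemma admissible_L2: "z \<in> admissible \<delta> \<Longrightarrow> z \<in> L2 L"
  by (simp add: admissible_def H1_L2)

lemma L2_integrable_quadratic:
  assumes "v \<in> L2 L"
  shows "integrable (Om L) (\<lambda>x. C * (1 + (v x)\<^sup>2))"
  by (intro integrable_mult_right Bochner_Integration.integrable_add L2_square_integrable assms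
      finite_measure.integrable_const finite_measure_Om)

lemma f_comp_integrable:
  assumes e: "\<epsilon> \<in> {0..1}" and v: "v \<in> L2 L"
  shows "integrable (Om L) (\<lambda>x. f \<epsilon> (v x))"
proof -
  obtain C where C: "C > 0" "\<And>\<epsilon> r. \<epsilon> \<in> {0..1} \<Longrightarrow> f \<epsilon> r \<le> C * (1 + r\<^sup>2)" using f_growth[OF f_fam] by blast
  show ?thesis
  proof (rule Bochner_Integration.integrable_bound)
    show "integrable (Om L) (\<lambda>x. C * (1 + (v x)\<^sup>2))"
      by (rule L2_integrable_quadratic[OF v])
    show "(\<lambda>x. f \<epsilon> (v x)) \<in> borel_measurable (Om L)"
      using measurable_compose[OF L2_measurable[OF v] f_measurable[OF f_fam e]] .
    show "AE x in Om L. norm (f \<epsilon> (v x)) \<le> norm (C * (1 + (v x)\<^sup>2))"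
      using C e f_nonneg[OF f_fam e] by (auto intro!: AE_I2 order_trans[OF _ abs_ge_self])
  qed
qed

lemma Khat_comp_measurable:
  assumes d: "\<delta> \<in> {0..1}" and z: "z \<in> L2 L"
  shows "(\<lambda>x. e2ennreal (Khat Kh \<delta> (z x))) \<in> borel_measurable (Om L)"
  using measurable_compose[OF L2_measurable[OF z] \<kappa>_measurable[OF K_fam d]] .

lemma Psi_eq_energy:
  assumes e: "\<epsilon> \<in> {0..1}" and z: "z \<in> admissible \<delta>"
  shows "Psi L \<nu> f Kh \<epsilon> \<delta> z = ereal (energy \<epsilon> \<delta> z)"
proof -
  have zH: "z \<in> H1 L" and fin: "Khat_integral L Kh \<delta> z < \<infinity>" using z by (auto simp: admissible_def)
  note v = ddx_spec(1)[OF zH]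
  have 1: "(\<integral>\<^sup>+x. ennreal (f \<epsilon> (ddx L z x)) \<partial>Om L) = ennreal (gradient_energy \<epsilon> z)"
    unfolding gradient_energy_def
    by (intro nn_integral_eq_integral f_comp_integrable e v AE_I2 f_nonneg[OF f_fam e])
  have 2: "(\<integral>\<^sup>+x. ennreal (\<bar>ddx L z x\<bar>\<^sup>2) \<partial>Om L) = ennreal (L2_sq L (ddx L z))"
    unfolding L2_inner_def
    by (subst nn_integral_eq_integral[symmetric]) (auto intro: L2_integrable_mult v simp: power2_eq_square)
  have 3: "Khat_integral L Kh \<delta> z = ennreal (enn2real (Khat_integral L Kh \<delta> z))" using fin by simp
  have nn: "0 \<le> gradient_energy \<epsilon> z"
    unfolding gradient_energy_def by (intro Bochner_Integration.integral_nonneg f_nonneg[OF f_fam e])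
  have "Psi L \<nu> f Kh \<epsilon> \<delta> z = enn2ereal (ennreal (gradient_energy \<epsilon> z) +
      ennreal (\<nu>\<^sup>2 / 2) * ennreal (L2_sq L (ddx L z)) + ennreal (enn2real (Khat_integral L Kh \<delta> z)))"
    unfolding Psi_def 1 2 3[symmetric] using zH by simp
  also have "\<dots> = enn2ereal (ennreal (energy \<epsilon> \<delta> z))"
  proof -
    have "ennreal (\<nu>\<^sup>2 / 2) * ennreal (L2_sq L (ddx L z)) = ennreal (\<nu>\<^sup>2 / 2 * L2_sq L (ddx L z))"
      by (rule ennreal_mult[symmetric]) (auto simp: L2_inner_self_nonneg)
    then show ?thesis unfolding energy_def using nn by (simp add: L2_inner_self_nonneg)
  qed
  also have "\<dots> = ereal (energy \<epsilon> \<delta> z)"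
    by (rule enn2ereal_ennreal) (use nn in \<open>simp add: energy_def L2_inner_self_nonneg\<close>)
  finally show ?thesis .
qed

lemma D_Psi_eq_admissible:
  assumes e: "\<epsilon> \<in> {0..1}"
  shows "D_Psi L \<nu> f Kh \<epsilon> \<delta> = admissible \<delta>"
proof (intro equalityI subsetI)
  fix z assume z: "z \<in> D_Psi L \<nu> f Kh \<epsilon> \<delta>"
  then have H: "z \<in> H1 L" and lt: "Psi L \<nu> f Kh \<epsilon> \<delta> z < \<infinity>" by (auto simp: D_Psi_def Psi_def split: if_splits)
  let ?a = "(\<integral>\<^sup>+x. ennreal (f \<epsilon> (ddx L z x)) \<partial>Om L) + ennreal (\<nu>\<^sup>2 / 2) * (\<integral>\<^sup>+x. ennreal (\<bar>ddx L z x\<bar>\<^sup>2) \<partial>Om L)"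
  have "enn2ereal (?a + Khat_integral L Kh \<delta> z) < enn2ereal \<infinity>" using lt H by (simp add: Psi_def)
  then have "?a + Khat_integral L Kh \<delta> z < \<infinity>" by (simp add: less_ennreal.rep_eq)
  then have "Khat_integral L Kh \<delta> z < \<infinity>" by (simp add: ennreal_add_eq_top less_top)
  then show "z \<in> admissible \<delta>" using H by (simp add: admissible_def)
next
  fix z assume z: "z \<in> admissible \<delta>"
  then show "z \<in> D_Psi L \<nu> f Kh \<epsilon> \<delta>" by (simp add: D_Psi_def admissible_L2 Psi_eq_energy[OF e z])
qed

lemma gradient_energy_nonneg: "\<epsilon> \<in> {0..1} \<Longrightarrow> 0 \<le> gradient_energy \<epsilon> z"
  unfolding gradient_energy_def by (intro Bochner_Integration.integral_nonneg f_nonneg[OF f_fam])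

lemma energy_ge:
  assumes "\<epsilon> \<in> {0..1}"
  shows "\<nu>\<^sup>2 / 2 * L2_sq L (ddx L z) \<le> energy \<epsilon> \<delta> z"
    and "enn2real (Khat_integral L Kh \<delta> z) \<le> energy \<epsilon> \<delta> z"
  unfolding energy_def using gradient_energy_nonneg[OF assms, of z] by (simp_all add: L2_inner_self_nonneg)

lemma zero_admissible:
  assumes e: "\<epsilon> \<in> {0..1}" and d: "\<delta> \<in> {0..1}"
  shows "(\<lambda>x. 0) \<in> admissible \<delta>" and "energy \<epsilon> \<delta> (\<lambda>x. 0) = 0"
proof -
  have K0: "Khat_integral L Kh \<delta> (\<lambda>x. 0) = 0" using \<kappa>_zero[OF K_fam d, of 0] by (simp add: Khat_integral_def)
  then show "(\<lambda>x. 0) \<in> admissible \<delta>" by (simp add: admissible_def H1_zero)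
  have "gradient_energy \<epsilon> (\<lambda>x. 0) = (LINT x|Om L. 0)"
    unfolding gradient_energy_def
  proof (rule integral_cong_AE)
    show "AE x in Om L. f \<epsilon> (ddx L (\<lambda>x. 0) x) = 0"
      using ddx_zero by eventually_elim (simp add: f_zero[OF f_fam e])
  qed (use borel_measurable_integrable[OF f_comp_integrable[OF e ddx_spec(1)[OF H1_zero]]] in auto)
  moreover have "L2_sq L (ddx L (\<lambda>x. 0)) = L2_sq L (\<lambda>x. 0)"
    using ddx_zero ddx_spec(1)[OF H1_zero] by (intro L2_inner_cong_AE) auto
  ultimately show "energy \<epsilon> \<delta> (\<lambda>x. 0) = 0" using K0 by (simp add: energy_def L2_inner_def)
qed

lemma energy_convex:
  assumes e: "\<epsilon> \<in> {0..1}" and d: "\<delta> \<in> {0..1}" and y: "y \<in> admissible \<delta>" and z: "z \<in> admissible \<delta>"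
    and t: "0 \<le> t" "t \<le> 1"
  shows "(\<lambda>x. (1 - t) * y x + t * z x) \<in> admissible \<delta>"
    and "energy \<epsilon> \<delta> (\<lambda>x. (1 - t) * y x + t * z x) \<le> (1 - t) * energy \<epsilon> \<delta> y + t * energy \<epsilon> \<delta> z"
proof -
  let ?w = "\<lambda>x. (1 - t) * y x + t * z x"
  note yH = admissible_H1[OF y] and zH = admissible_H1[OF z]
  note dy = ddx_spec(1)[OF yH] and dz = ddx_spec(1)[OF zH]
  have wH: "?w \<in> H1 L" and dw: "AE x in Om L. ddx L ?w x = (1 - t) * ddx L y x + t * ddx L z x"
    using H1_lincomb[OF yH zH] by auto
  have KI: "Khat_integral L Kh \<delta> ?w \<le> ennreal (1 - t) * Khat_integral L Kh \<delta> y + ennreal t * Khat_integral L Kh \<delta> z"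
  proof -
    have "Khat_integral L Kh \<delta> ?w \<le> (\<integral>\<^sup>+x. ennreal (1 - t) * e2ennreal (Khat Kh \<delta> (y x)) + ennreal t * e2ennreal (Khat Kh \<delta> (z x)) \<partial>Om L)"
      unfolding Khat_integral_def by (intro nn_integral_mono \<kappa>_convex[OF K_fam d t])
    also have "\<dots> = ennreal (1 - t) * Khat_integral L Kh \<delta> y + ennreal t * Khat_integral L Kh \<delta> z"
      unfolding Khat_integral_def using Khat_comp_measurable[OF d admissible_L2[OF y]] Khat_comp_measurable[OF d admissible_L2[OF z]]
      by (subst nn_integral_add) (auto simp: nn_integral_cmult)
    finally show ?thesis .
  qed
  have fin: "ennreal (1 - t) * Khat_integral L Kh \<delta> y < \<infinity>" "ennreal t * Khat_integral L Kh \<delta> z < \<infinity>"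
    using y z by (auto simp: admissible_def ennreal_mult_less_top)
  then show adm: "?w \<in> admissible \<delta>"
    using wH le_less_trans[OF KI] by (simp add: admissible_def)
  have K: "enn2real (Khat_integral L Kh \<delta> ?w) \<le> (1 - t) * enn2real (Khat_integral L Kh \<delta> y) + t * enn2real (Khat_integral L Kh \<delta> z)"
  proof -
    have "enn2real (Khat_integral L Kh \<delta> ?w) \<le> enn2real (ennreal (1 - t) * Khat_integral L Kh \<delta> y + ennreal t * Khat_integral L Kh \<delta> z)"
      using KI fin by (intro enn2real_mono) auto
    also have "\<dots> = (1 - t) * enn2real (Khat_integral L Kh \<delta> y) + t * enn2real (Khat_integral L Kh \<delta> z)"
      using fin t by (simp add: enn2real_plus enn2real_mult)
    finally show ?thesis .
  qed
  have F: "gradient_energy \<epsilon> ?w \<le> (1 - t) * gradient_energy \<epsilon> y + t * gradient_energy \<epsilon> z"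
  proof -
    have "gradient_energy \<epsilon> ?w \<le> (LINT x|Om L. (1 - t) * f \<epsilon> (ddx L y x) + t * f \<epsilon> (ddx L z x))"
      unfolding gradient_energy_def
    proof (rule integral_mono_AE)
      show "AE x in Om L. f \<epsilon> (ddx L ?w x) \<le> (1 - t) * f \<epsilon> (ddx L y x) + t * f \<epsilon> (ddx L z x)"
        using dw by eventually_elim (simp add: f_convex_ineq[OF f_fam e t])
    qed (intro Bochner_Integration.integrable_add integrable_mult_right f_comp_integrable e dy dz ddx_spec(1)[OF wH])+
    also have "\<dots> = (1 - t) * gradient_energy \<epsilon> y + t * gradient_energy \<epsilon> z"
      unfolding gradient_energy_def using f_comp_integrable[OF e dy] f_comp_integrable[OF e dz] by simp
    finally show ?thesis .
  qed
  have Q: "L2_sq L (ddx L ?w) \<le> (1 - t) * L2_sq L (ddx L y) + t * L2_sq L (ddx L z)"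
  proof -
    have "L2_sq L (ddx L ?w) \<le> (LINT x|Om L. (1 - t) * (ddx L y x * ddx L y x) + t * (ddx L z x * ddx L z x))"
      unfolding L2_inner_def
    proof (rule integral_mono_AE)
      have "((1 - t) * a + t * b) * ((1 - t) * a + t * b) \<le> (1 - t) * (a * a) + t * (b * b)" for a b
      proof -
        have "(1 - t) * (a * a) + t * (b * b) - ((1 - t) * a + t * b) * ((1 - t) * a + t * b) = t * (1 - t) * (a - b)\<^sup>2"
          by (simp add: power2_eq_square algebra_simps)
        moreover have "0 \<le> t * (1 - t) * (a - b)\<^sup>2" using t by simp
        ultimately show ?thesis by linarith
      qed
      then show "AE x in Om L. ddx L ?w x * ddx L ?w x \<le> (1 - t) * (ddx L y x * ddx L y x) + t * (ddx L z x * ddx L z x)"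
        using dw by (auto elim!: eventually_mono)
    qed (intro Bochner_Integration.integrable_add integrable_mult_right L2_integrable_mult dy dz ddx_spec(1)[OF wH])+
    also have "\<dots> = (1 - t) * L2_sq L (ddx L y) + t * L2_sq L (ddx L z)"
      unfolding L2_inner_def using L2_integrable_mult[OF dy dy] L2_integrable_mult[OF dz dz] by simp
    finally show ?thesis .
  qed
  define c where "c = \<nu>\<^sup>2 / 2"
  have "c * L2_sq L (ddx L ?w) \<le> c * ((1 - t) * L2_sq L (ddx L y) + t * L2_sq L (ddx L z))"
    using Q by (intro mult_left_mono) (auto simp: c_def)
  also have "\<dots> = (1 - t) * (c * L2_sq L (ddx L y)) + t * (c * L2_sq L (ddx L z))"
    by (simp only: distrib_left mult.left_commute)
  finally show "energy \<epsilon> \<delta> ?w \<le> (1 - t) * energy \<epsilon> \<delta> y + t * energy \<epsilon> \<delta> z"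
    using F K unfolding energy_def c_def[symmetric] distrib_left by linarith
qed

text \<open>
  The gradient term is minorized by its linearization at the limit \<open>ddx L y\<close>. The subgradients
  there converge pointwise and have linear growth, hence converge strongly, so they can be paired
  with the weakly convergent derivatives.
\<close>

lemma gradient_energy_liminf:
  assumes E: "\<And>k. E k \<in> {0..1}" "E \<longlonglongrightarrow> \<epsilon>" "\<epsilon> \<in> {0..1}"
    and Y: "\<And>k. Y k \<in> H1 L" and y: "y \<in> H1 L" and weak: "L2_weak_lim L (\<lambda>k. ddx L (Y k)) (ddx L y)"
    and B: "\<And>k. L2_sq L (ddx L (Y k)) \<le> B" and e: "e > 0"
  shows "\<forall>\<^sub>F k in sequentially. gradient_energy \<epsilon> y - e < gradient_energy (E k) (Y k)"
proof -
  define v where "v = ddx L y"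
  define V where "V k = ddx L (Y k)" for k :: nat
  have v: "v \<in> L2 L" and V: "\<And>k. V k \<in> L2 L" using ddx_spec(1)[OF y] ddx_spec(1)[OF Y] by (auto simp: v_def V_def)
  obtain C where C: "C > 0" "\<And>\<epsilon> r. \<epsilon> \<in> {0..1} \<Longrightarrow> \<bar>fsub f \<epsilon> r\<bar> \<le> C * (1 + \<bar>r\<bar>)" using fsub_bound[OF f_fam] by blast
  obtain C' where C': "C' > 0" "\<And>\<epsilon> r. \<epsilon> \<in> {0..1} \<Longrightarrow> f \<epsilon> r \<le> C' * (1 + r\<^sup>2)" using f_growth[OF f_fam] by blast
  define p where "p \<epsilon> x = fsub f \<epsilon> (v x)" for \<epsilon> x
  have mp: "p \<epsilon> \<in> borel_measurable (Om L)" if "\<epsilon> \<in> {0..1}" for \<epsilon>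
    unfolding p_def[abs_def] using measurable_compose[OF L2_measurable[OF v] fsub_measurable[OF f_fam that]] .
  have dom: "integrable (Om L) (\<lambda>x. (2 * C * (1 + \<bar>v x\<bar>))\<^sup>2)"
  proof -
    have "(\<lambda>x. 2 * C * (1 + \<bar>v x\<bar>)) \<in> L2 L"
    proof (intro L2_scale L2_add L2_const)
      show "(\<lambda>x. \<bar>v x\<bar>) \<in> L2 L" using v by (auto simp: L2_def)
    qed
    then show ?thesis by (rule L2_square_integrable)
  qed
  have pb: "\<bar>p \<epsilon> x\<bar> \<le> C * (1 + \<bar>v x\<bar>)" if "\<epsilon> \<in> {0..1}" for \<epsilon> x using C(2)[OF that] by (simp add: p_def)
  have p: "p \<epsilon> \<in> L2 L" if e: "\<epsilon> \<in> {0..1}" for \<epsilon>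
  proof -
    have "integrable (Om L) (\<lambda>x. (p \<epsilon> x)\<^sup>2)"
    proof (rule Bochner_Integration.integrable_bound[OF dom])
      have "(p \<epsilon> x)\<^sup>2 \<le> (2 * C * (1 + \<bar>v x\<bar>))\<^sup>2" for x
        using pb[OF e, of x] C(1) by (intro power2_le_iff_abs_le[THEN iffD2]) (auto simp: algebra_simps intro: order_trans)
      then show "AE x in Om L. norm ((p \<epsilon> x)\<^sup>2) \<le> norm ((2 * C * (1 + \<bar>v x\<bar>))\<^sup>2)" by simp
    qed (use mp[OF e] in measurable)
    then show ?thesis using mp[OF e] by (simp add: L2_def)
  qed
  have plim: "(\<lambda>k. L2_sq L (\<lambda>x. p (E k) x - p \<epsilon> x)) \<longlonglongrightarrow> 0"
  proof -
    have "(\<lambda>k. LINT x|Om L. (p (E k) x - p \<epsilon> x)\<^sup>2) \<longlonglongrightarrow> (LINT x|Om L. 0)"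
    proof (rule integral_dominated_convergence[OF _ _ dom])
      show "AE x in Om L. (\<lambda>k. (p (E k) x - p \<epsilon> x)\<^sup>2) \<longlonglongrightarrow> 0"
      proof (rule AE_I2)
        fix x
        have "(\<lambda>k. (p (E k) x - p \<epsilon> x)\<^sup>2) \<longlonglongrightarrow> (p \<epsilon> x - p \<epsilon> x)\<^sup>2"
          unfolding p_def by (intro tendsto_intros fsub_tendsto[OF f_fam E])
        then show "(\<lambda>k. (p (E k) x - p \<epsilon> x)\<^sup>2) \<longlonglongrightarrow> 0" by simp
      qed
      have "\<bar>p (E k) x - p \<epsilon> x\<bar> \<le> \<bar>2 * C * (1 + \<bar>v x\<bar>)\<bar>" for k x
        using pb[OF E(1), of k x] pb[OF E(3), of x] by linarith
      then show "AE x in Om L. norm ((p (E k) x - p \<epsilon> x)\<^sup>2) \<le> (2 * C * (1 + \<bar>v x\<bar>))\<^sup>2" for k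
        by (simp add: abs_le_square_iff)
    qed (use mp[OF E(1)] mp[OF E(3)] in measurable)
    then show ?thesis by (simp add: L2_inner_def power2_eq_square)
  qed
  have lim1: "(\<lambda>k. LINT x|Om L. f (E k) (v x)) \<longlonglongrightarrow> (LINT x|Om L. f \<epsilon> (v x))"
  proof (rule integral_dominated_convergence)
    show "integrable (Om L) (\<lambda>x. C' * (1 + (v x)\<^sup>2))"
      by (rule L2_integrable_quadratic[OF v])
    show "AE x in Om L. (\<lambda>k. f (E k) (v x)) \<longlonglongrightarrow> f \<epsilon> (v x)" using f_tendsto[OF f_fam E] by auto
    show "AE x in Om L. norm (f (E k) (v x)) \<le> C' * (1 + (v x)\<^sup>2)" for k
      using C'(2)[OF E(1)] f_nonneg[OF f_fam E(1)] by auto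
  qed (use f_comp_integrable[OF E(1) v] f_comp_integrable[OF E(3) v] in auto)
  have lim2: "(\<lambda>k. L2_inner L (V k) (p (E k))) \<longlonglongrightarrow> L2_inner L v (p \<epsilon>)"
    using L2.weakly_strongly[of V L v B "\<lambda>k. p (E k)" "p \<epsilon>"] V v weak B p[OF E(1)] p[OF E(3)] plim
    by (simp add: L2_weakly_iff V_def[abs_def] v_def fun_diff_def)
  have lim3: "(\<lambda>k. L2_inner L v (p (E k))) \<longlonglongrightarrow> L2_inner L v (p \<epsilon>)"
    using L2.tendsto_ip_left[of "\<lambda>k. p (E k)" L "p \<epsilon>" v] v p[OF E(1)] p[OF E(3)] plim
    by (simp add: fun_diff_def L2_inner_sym)
  have "(\<lambda>k. (LINT x|Om L. f (E k) (v x)) + (L2_inner L (V k) (p (E k)) - L2_inner L v (p (E k))))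
      \<longlonglongrightarrow> (LINT x|Om L. f \<epsilon> (v x)) + (L2_inner L v (p \<epsilon>) - L2_inner L v (p \<epsilon>))"
    by (intro tendsto_intros lim1 lim2 lim3)
  then have "\<forall>\<^sub>F k in sequentially. gradient_energy \<epsilon> y - e <
      (LINT x|Om L. f (E k) (v x)) + (L2_inner L (V k) (p (E k)) - L2_inner L v (p (E k)))"
    by (rule order_tendstoD) (use e in \<open>simp add: gradient_energy_def v_def\<close>)
  then show ?thesis
  proof eventually_elim
    case (elim k)
    have "(LINT x|Om L. f (E k) (v x)) + (L2_inner L (V k) (p (E k)) - L2_inner L v (p (E k)))
        = (LINT x|Om L. f (E k) (v x) + (V k x * p (E k) x - v x * p (E k) x))"
      using f_comp_integrable[OF E(1) v] L2_integrable_mult[OF V p[OF E(1)]] L2_integrable_mult[OF v p[OF E(1)]]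
      by (simp add: L2_inner_def)
    also have "\<dots> \<le> gradient_energy (E k) (Y k)"
      unfolding gradient_energy_def V_def[symmetric]
    proof (rule integral_mono)
      show "f (E k) (v x) + (V k x * p (E k) x - v x * p (E k) x) \<le> f (E k) (V k x)" for x
        using f_subgradient[OF f_fam E(1), where s="V k x" and r="v x"] by (simp add: p_def algebra_simps)
    qed (intro Bochner_Integration.integrable_add Bochner_Integration.integrable_diff f_comp_integrable
        L2_integrable_mult E(1) v V p)+
    finally show ?case using elim by linarith
  qed
qed

lemma Khat_integral_liminf:
  assumes D: "\<And>k. D k \<in> {0..1}" "D \<longlonglongrightarrow> \<delta>" "\<delta> \<in> {0..1}"
    and Y: "\<And>k. Y k \<in> L2 L" and lim: "AE x in Om L. (\<lambda>k. Y k x) \<longlonglongrightarrow> y x"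
  shows "Khat_integral L Kh \<delta> y \<le> liminf (\<lambda>k. Khat_integral L Kh (D k) (Y k))"
  unfolding Khat_integral_def
proof (rule nn_integral_Fatou_AE)
  show "AE x in Om L. e2ennreal (Khat Kh \<delta> (y x)) \<le> liminf (\<lambda>k. e2ennreal (Khat Kh (D k) (Y k x)))"
    using lim by eventually_elim (rule \<kappa>_liminf[OF K_fam D])
qed (rule Khat_comp_measurable[OF D(1) Y])

text \<open>
  The liminf half of Mosco convergence, term by term: linearization for \<open>f\<close>, weak lower
  semicontinuity of the norm for the quadratic part, and Fatou's lemma for \<open>Khat\<close>.
\<close>

lemma energy_liminf:
  assumes E: "\<And>k. E k \<in> {0..1}" "E \<longlonglongrightarrow> \<epsilon>" "\<epsilon> \<in> {0..1}"
    and D: "\<And>k. D k \<in> {0..1}" "D \<longlonglongrightarrow> \<delta>" "\<delta> \<in> {0..1}"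
    and Y: "\<And>k. Y k \<in> admissible (D k)" and y: "y \<in> H1 L"
    and lim: "AE x in Om L. (\<lambda>k. Y k x) \<longlonglongrightarrow> y x"
    and weak: "L2_weak_lim L (\<lambda>k. ddx L (Y k)) (ddx L y)"
    and B: "\<And>k. energy (E k) (D k) (Y k) \<le> B"
  shows "y \<in> admissible \<delta>" and "e > 0 \<Longrightarrow> \<forall>\<^sub>F k in sequentially. energy \<epsilon> \<delta> y - e < energy (E k) (D k) (Y k)"
proof -
  note YH = admissible_H1[OF Y] and YL = admissible_L2[OF Y]
  let ?KI = "\<lambda>k. Khat_integral L Kh (D k) (Y k)"
  have fin: "?KI k < \<infinity>" for k using Y[of k] by (simp add: admissible_def)
  have KIB: "?KI k \<le> ennreal B" for k
    using energy_ge(2)[OF E(1), of "D k" "Y k" k] B[of k] fin[of k]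
    by (metis ennreal_enn2real ennreal_leI infinity_ennreal_def order_trans)
  have K: "Khat_integral L Kh \<delta> y \<le> liminf ?KI" by (rule Khat_integral_liminf[OF D YL lim])
  have "liminf ?KI \<le> ennreal B"
    using KIB Liminf_le[of sequentially ?KI "ennreal B"] by auto
  then have Kfin: "Khat_integral L Kh \<delta> y < \<infinity>"
    using K by (metis ennreal_less_top infinity_ennreal_def le_less_trans)
  then show "y \<in> admissible \<delta>" using y by (simp add: admissible_def)
  have dB: "L2_sq L (ddx L (Y k)) \<le> B / (\<nu>\<^sup>2 / 2)" for k
    using order_trans[OF energy_ge(1)[OF E(1)] B[of k]] nu_pos
    by (subst pos_le_divide_eq) (auto simp: mult.commute)
  assume e: "e > 0"
  have 1: "\<forall>\<^sub>F k in sequentially. gradient_energy \<epsilon> y - e / 3 < gradient_energy (E k) (Y k)"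
    by (rule gradient_energy_liminf[OF E YH y weak dB]) (use e in simp)
  define e2 where "e2 = (e / 3) / (\<nu>\<^sup>2 / 2)"
  have e2: "e2 > 0" "\<nu>\<^sup>2 / 2 * e2 = e / 3" using e nu_pos by (auto simp: e2_def)
  have 2: "\<forall>\<^sub>F k in sequentially. L2_sq L (ddx L y) - e2 < L2_sq L (ddx L (Y k))"
    using L2.weakly_lower_semicontinuous[of "\<lambda>k. ddx L (Y k)" L "ddx L y" e2] ddx_spec(1)[OF YH] ddx_spec(1)[OF y] weak e2(1)
    by (simp add: L2_weakly_iff)
  have 3: "\<forall>\<^sub>F k in sequentially. enn2real (Khat_integral L Kh \<delta> y) - e / 3 < enn2real (?KI k)"
  proof (cases "enn2real (Khat_integral L Kh \<delta> y) - e / 3 < 0")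
    case True
    then show ?thesis by (auto intro!: always_eventually intro: less_le_trans[OF _ enn2real_nonneg])
  next
    case False
    define c where "c = enn2real (Khat_integral L Kh \<delta> y) - e / 3"
    have "ennreal c < ennreal (enn2real (Khat_integral L Kh \<delta> y))"
      using False e by (intro ennreal_lessI) (auto simp: c_def)
    also have "\<dots> = Khat_integral L Kh \<delta> y" using Kfin by simp
    also note K
    finally have "\<forall>\<^sub>F k in sequentially. ennreal c < ?KI k" by (rule less_LiminfD)
    then show ?thesis
    proof eventually_elim
      case (elim k)
      then have "ennreal c < ennreal (enn2real (?KI k))" using fin[of k] by simp
      then show ?case using False by (simp add: ennreal_less_iff c_def)
    qed
  qed
  show "\<forall>\<^sub>F k in sequentially. energy \<epsilon> \<delta> y - e < energy (E k) (D k) (Y k)"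
    using 1 2 3
  proof eventually_elim
    case (elim k)
    have "\<nu>\<^sup>2 / 2 * (L2_sq L (ddx L y) - e2) < \<nu>\<^sup>2 / 2 * L2_sq L (ddx L (Y k))"
      using elim(2) nu_pos by (intro mult_strict_left_mono) auto
    then have "\<nu>\<^sup>2 / 2 * L2_sq L (ddx L y) - e / 3 < \<nu>\<^sup>2 / 2 * L2_sq L (ddx L (Y k))"
      using e2(2) by (simp add: right_diff_distrib)
    then show ?case using elim(1,3) unfolding energy_def by linarith
  qed
qed

text \<open>
  The recovery half of Mosco convergence, with a constant sequence. For \<open>\<delta> = 0\<close> functions of finite
  energy take their values in \<open>[-1,1]\<close>, where all potentials vanish; for \<open>\<delta> > 0\<close> the potentials
  converge uniformly on the bounded range of an \<open>H\<^sup>1\<close> function.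
\<close>

lemma energy_recovery:
  assumes E: "\<And>k. E k \<in> {0..1}" "E \<longlonglongrightarrow> \<epsilon>" "\<epsilon> \<in> {0..1}"
    and D: "\<And>k. D k \<in> {0..1}" "D \<longlonglongrightarrow> \<delta>" "\<delta> \<in> {0..1}"
    and z: "z \<in> admissible \<delta>" and e: "e > 0"
  shows "\<forall>\<^sub>F k in sequentially. z \<in> admissible (D k) \<and> energy (E k) (D k) z \<le> energy \<epsilon> \<delta> z + e"
proof -
  note zH = admissible_H1[OF z]
  note v = ddx_spec(1)[OF zH]
  obtain C where C: "C > 0" "\<And>\<epsilon> r. \<epsilon> \<in> {0..1} \<Longrightarrow> f \<epsilon> r \<le> C * (1 + r\<^sup>2)" using f_growth[OF f_fam] by blast
  have "(\<lambda>k. gradient_energy (E k) z) \<longlonglongrightarrow> gradient_energy \<epsilon> z"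
    unfolding gradient_energy_def
  proof (rule integral_dominated_convergence)
    show "integrable (Om L) (\<lambda>x. C * (1 + (ddx L z x)\<^sup>2))"
      by (rule L2_integrable_quadratic[OF v])
    show "AE x in Om L. (\<lambda>k. f (E k) (ddx L z x)) \<longlonglongrightarrow> f \<epsilon> (ddx L z x)" using f_tendsto[OF f_fam E] by auto
    show "AE x in Om L. norm (f (E k) (ddx L z x)) \<le> C * (1 + (ddx L z x)\<^sup>2)" for k
      using C(2)[OF E(1)] f_nonneg[OF f_fam E(1)] by auto
  qed (use f_comp_integrable[OF E(1) v] f_comp_integrable[OF E(3) v] in auto)
  then have 1: "\<forall>\<^sub>F k in sequentially. gradient_energy (E k) z < gradient_energy \<epsilon> z + e / 2"
    by (rule order_tendstoD) (use e in simp)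
  obtain B where B: "AE x in Om L. \<bar>z x\<bar> \<le> B" using H1_bounded[OF zH L_pos] by blast
  define m where "m = measure (Om L) (space (Om L)) + 1"
  have m: "m > 0" "measure (Om L) (space (Om L)) \<le> m" by (auto simp: m_def add_nonneg_pos)
  define e' where "e' = e / (2 * m)"
  have e': "e' > 0" using e m by (simp add: e'_def)
  have 2: "\<forall>\<^sub>F k in sequentially. \<forall>r\<in>{-B..B}. e2ennreal (Khat Kh (D k) r) \<le> e2ennreal (Khat Kh \<delta> r) + ennreal e'"
    by (rule \<kappa>_upper[OF K_fam D e'])
  show ?thesis
    using 1 2
  proof eventually_elim
    case (elim k)
    have KI: "Khat_integral L Kh (D k) z \<le> Khat_integral L Kh \<delta> z + ennreal (e / 2)"
    proof -
      have "Khat_integral L Kh (D k) z \<le> (\<integral>\<^sup>+x. e2ennreal (Khat Kh \<delta> (z x)) + ennreal e' \<partial>Om L)"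
        unfolding Khat_integral_def
      proof (rule nn_integral_mono_AE)
        show "AE x in Om L. e2ennreal (Khat Kh (D k) (z x)) \<le> e2ennreal (Khat Kh \<delta> (z x)) + ennreal e'"
          using B by eventually_elim (use elim(2) in \<open>auto simp: abs_le_iff\<close>)
      qed
      also have "\<dots> = Khat_integral L Kh \<delta> z + ennreal e' * emeasure (Om L) (space (Om L))"
        unfolding Khat_integral_def using Khat_comp_measurable[OF D(3) admissible_L2[OF z]]
        by (subst nn_integral_add) auto
      also have "ennreal e' * emeasure (Om L) (space (Om L)) = ennreal (e' * measure (Om L) (space (Om L)))"
        using e' by (simp add: finite_measure.emeasure_eq_measure[OF finite_measure_Om] ennreal_mult del: space_Om)
      also have "\<dots> \<le> ennreal (e / 2)"
        using e e' m by (intro ennreal_leI order_trans[OF mult_left_mono[OF m(2)]]) (auto simp: e'_def)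
      finally show ?thesis by (simp add: add_left_mono)
    qed
    have fin: "Khat_integral L Kh \<delta> z < \<infinity>" using z by (simp add: admissible_def)
    then have fin': "Khat_integral L Kh \<delta> z + ennreal (e / 2) < \<infinity>" by simp
    have "enn2real (Khat_integral L Kh (D k) z) \<le> enn2real (Khat_integral L Kh \<delta> z + ennreal (e / 2))"
      using KI fin' by (intro enn2real_mono) auto
    also have "\<dots> = enn2real (Khat_integral L Kh \<delta> z) + e / 2"
      using fin e by (simp add: enn2real_plus)
    finally have "energy (E k) (D k) z \<le> energy \<epsilon> \<delta> z + e" using elim(1) unfolding energy_def by linarith
    moreover have "z \<in> admissible (D k)" using zH le_less_trans[OF KI fin'] by (simp add: admissible_def)
    ultimately show ?case by blast
  qed
qed

end

section \<open>Strong convergence of square integrable functions\<close>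

definition L2_lim :: "real \<Rightarrow> (nat \<Rightarrow> real \<Rightarrow> real) \<Rightarrow> (real \<Rightarrow> real) \<Rightarrow> bool" where
  "L2_lim L X x \<longleftrightarrow> (\<lambda>k. L2_sq L (\<lambda>t. X k t - x t)) \<longlonglongrightarrow> 0"

lemma L2_lim_inner:
  assumes "\<And>k. X k \<in> L2 L" "x \<in> L2 L" "L2_lim L X x" "\<And>k. Y k \<in> L2 L" "y \<in> L2 L" "L2_lim L Y y"
  shows "(\<lambda>k. L2_inner L (X k) (Y k)) \<longlonglongrightarrow> L2_inner L x y"
  using assms unfolding L2_lim_def by (intro L2.tendsto_ip) (simp_all add: fun_diff_def)

lemma L2_lim_const: "L2_lim L (\<lambda>_. x) x"
  by (simp add: L2_lim_def L2_inner_def)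

lemma L2_lim_weak:
  assumes "\<And>k. X k \<in> L2 L" "x \<in> L2 L" "L2_lim L X x"
  shows "L2_weak_lim L X x"
  unfolding L2_weak_lim_def using L2_lim_inner[OF assms _ _ L2_lim_const] by blast

lemma L2_lim_bounded:
  assumes "\<And>k. X k \<in> L2 L" "x \<in> L2 L" "L2_lim L X x"
  obtains B where "\<And>k. L2_sq L (X k) \<le> B"
  using L2.strongly_imp_bounded[of X L x] assms unfolding L2_lim_def by (auto simp: fun_diff_def)

lemma L2_weak_strong_inner:
  assumes "\<And>k. X k \<in> L2 L" "x \<in> L2 L" "L2_weak_lim L X x" "\<And>k. L2_sq L (X k) \<le> B"
    and "\<And>k. Y k \<in> L2 L" "y \<in> L2 L" "L2_lim L Y y"
  shows "(\<lambda>k. L2_inner L (X k) (Y k)) \<longlonglongrightarrow> L2_inner L x y"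
  using L2.weakly_strongly[of X L x B Y y] assms by (simp add: L2_weakly_iff L2_lim_def fun_diff_def)

lemma L2_lim_lincomb:
  assumes X: "\<And>k. X k \<in> L2 L" "x \<in> L2 L" "L2_lim L X x" and Y: "\<And>k. Y k \<in> L2 L" "y \<in> L2 L" "L2_lim L Y y"
  shows "L2_lim L (\<lambda>k t. a * X k t + b * Y k t) (\<lambda>t. a * x t + b * y t)"
  unfolding L2_lim_def
proof (rule tendsto_sandwich[OF always_eventually always_eventually])
  define D where "D u v = L2_sq L (\<lambda>t. u t - v t)" for u v :: "real \<Rightarrow> real"
  show "\<forall>k. 0 \<le> L2_sq L (\<lambda>t. a * X k t + b * Y k t - (a * x t + b * y t))"
    by (simp add: L2_inner_self_nonneg)
  show "(\<lambda>k. 2 * a\<^sup>2 * D (X k) x + 2 * b\<^sup>2 * D (Y k) y) \<longlonglongrightarrow> 0"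
  proof -
    have "(\<lambda>k. 2 * a\<^sup>2 * D (X k) x + 2 * b\<^sup>2 * D (Y k) y) \<longlonglongrightarrow> 2 * a\<^sup>2 * 0 + 2 * b\<^sup>2 * 0"
      using X(3) Y(3) unfolding L2_lim_def D_def by (intro tendsto_intros)
    then show ?thesis by simp
  qed
  show "\<forall>k. L2_sq L (\<lambda>t. a * X k t + b * Y k t - (a * x t + b * y t))
      \<le> 2 * a\<^sup>2 * D (X k) x + 2 * b\<^sup>2 * D (Y k) y"
  proof
    fix k
    let ?p = "\<lambda>t. X k t - x t" and ?q = "\<lambda>t. Y k t - y t"
    have pq: "?p \<in> L2 L" "?q \<in> L2 L" using X Y by auto
    have pt: "(a * u + b * v) * (a * u + b * v) \<le> 2 * a\<^sup>2 * (u * u) + 2 * b\<^sup>2 * (v * v)" for u v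
      using zero_le_power2[of "a * u - b * v"] by (simp add: power2_eq_square algebra_simps)
    have "L2_sq L (\<lambda>t. a * ?p t + b * ?q t)
        \<le> (LINT t|Om L. 2 * a\<^sup>2 * (?p t * ?p t) + 2 * b\<^sup>2 * (?q t * ?q t))"
      unfolding L2_inner_def
      by (intro integral_mono Bochner_Integration.integrable_add integrable_mult_right L2_integrable_mult
          L2_add L2_scale pq pt)
    also have "\<dots> = 2 * a\<^sup>2 * D (X k) x + 2 * b\<^sup>2 * D (Y k) y"
      unfolding D_def L2_inner_def using L2_integrable_mult[OF pq(1,1)] L2_integrable_mult[OF pq(2,2)] by simp
    finally show "L2_sq L (\<lambda>t. a * X k t + b * Y k t - (a * x t + b * y t))
      \<le> 2 * a\<^sup>2 * D (X k) x + 2 * b\<^sup>2 * D (Y k) y"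
      by (simp add: algebra_simps)
  qed
qed simp

lemma L2_young:
  assumes "y \<in> L2 L" "z \<in> L2 L" "a > 0"
  shows "L2_inner L y z \<le> a / 2 * L2_sq L z + 1 / (2 * a) * L2_sq L y"
proof -
  have "0 \<le> L2_sq L (\<lambda>t. a * z t - y t)" by (rule L2_inner_self_nonneg)
  also have "\<dots> = a\<^sup>2 * L2_sq L z - 2 * a * L2_inner L y z + L2_sq L y"
    using assms by (simp add: L2_inner_simps L2_inner_sym[of L z y] power2_eq_square algebra_simps)
  finally show ?thesis using assms(3) by (simp add: field_simps power2_eq_square)
qed

lemma L2_norm_zero_AE:
  assumes "z \<in> L2 L" "L2_sq L z \<le> 0"
  shows "AE x in Om L. z x = 0"
proof -
  have "(LINT x|Om L. z x * z x) = 0" using antisym[OF assms(2) L2_inner_self_nonneg] by (simp add: L2_inner_def)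
  then have "AE x in Om L. z x * z x = 0"
    using L2_integrable_mult[OF assms(1,1)] by (subst integral_nonneg_eq_0_iff_AE[symmetric]) auto
  then show ?thesis by simp
qed

lemma bounded_comp:
  assumes \<phi>: "continuous_on UNIV (\<phi> :: real \<Rightarrow> real)"
  obtains B where "\<And>r. \<bar>r\<bar> \<le> C \<Longrightarrow> \<bar>\<phi> r\<bar> \<le> B"
proof -
  have "compact (\<phi> ` {-C..C})" using \<phi> by (intro compact_continuous_image) (auto intro: continuous_on_subset)
  then obtain B where "\<And>y. y \<in> \<phi> ` {-C..C} \<Longrightarrow> \<bar>y\<bar> \<le> B"
    using compact_imp_bounded[of "\<phi> ` {-C..C}"] by (auto simp: bounded_iff)
  then have "\<bar>\<phi> r\<bar> \<le> B" if "\<bar>r\<bar> \<le> C" for r using that by (auto simp: abs_le_iff)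
  then show ?thesis by (rule that)
qed

lemma L2_comp:
  assumes \<phi>: "continuous_on UNIV (\<phi> :: real \<Rightarrow> real)" and z: "z \<in> borel_measurable (Om L)"
    and C: "AE x in Om L. \<bar>z x\<bar> \<le> C"
  shows "(\<lambda>x. \<phi> (z x)) \<in> L2 L"
proof -
  obtain B where B: "\<And>r. \<bar>r\<bar> \<le> C \<Longrightarrow> \<bar>\<phi> r\<bar> \<le> B" using bounded_comp[OF \<phi>] by blast
  show ?thesis
  proof (rule L2_bounded)
    show "(\<lambda>x. \<phi> (z x)) \<in> borel_measurable (Om L)"
      by (rule measurable_compose[OF z borel_measurable_continuous_onI[OF \<phi>]])
    show "AE x in Om L. \<bar>\<phi> (z x)\<bar> \<le> B" using C by eventually_elim (rule B)
  qed
qed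

lemma L2_lim_comp:
  assumes \<phi>: "continuous_on UNIV (\<phi> :: real \<Rightarrow> real)"
    and Y: "\<And>k. Y k \<in> borel_measurable (Om L)" and y: "y \<in> borel_measurable (Om L)"
    and C: "\<And>k. AE x in Om L. \<bar>Y k x\<bar> \<le> C" and lim: "AE x in Om L. (\<lambda>k. Y k x) \<longlonglongrightarrow> y x"
  shows "L2_lim L (\<lambda>k x. \<phi> (Y k x)) (\<lambda>x. \<phi> (y x))"
proof -
  obtain B where B: "\<And>r. \<bar>r\<bar> \<le> C \<Longrightarrow> \<bar>\<phi> r\<bar> \<le> B" using bounded_comp[OF \<phi>] by blast
  note m = measurable_compose[OF _ borel_measurable_continuous_onI[OF \<phi>]]
  show ?thesis unfolding L2_lim_def
  proof (rule L2_bounded_convergence(2)[of _ _ _ B])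
    show "AE x in Om L. \<bar>\<phi> (Y k x)\<bar> \<le> B" for k using C[of k] by eventually_elim (rule B)
    show "AE x in Om L. (\<lambda>k. \<phi> (Y k x)) \<longlonglongrightarrow> \<phi> (y x)"
      using lim
    proof eventually_elim
      case (elim x)
      then show ?case using \<phi> by (intro continuous_on_tendsto_compose[OF \<phi>]) auto
    qed
  qed (use m Y y in auto)
qed

section \<open>One time step\<close>

context phase_field
begin

lemma g_continuous: "continuous_on UNIV g"
  using g_ass by (auto simp: g_assms_def intro: C1_differentiable_imp_continuous_on)

lemma g_semimonotone: "- Cg * (a - b)\<^sup>2 \<le> (g a - g b) * (a - b)"
proof -
  have m: "mono (\<lambda>r. g r + Cg * r)" using g_ass by (simp add: g_assms_def)
  have "0 \<le> ((g a + Cg * a) - (g b + Cg * b)) * (a - b)"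
    using monoD[OF m, of a b] monoD[OF m, of b a] by (cases "a \<le> b") (auto intro: mult_nonpos_nonpos)
  then show ?thesis by (simp add: algebra_simps power2_eq_square)
qed

definition coercivity :: real where "coercivity = 1 / \<tau> - Cg"

lemma coercivity_pos: "coercivity > 0"
  using tau_Cg by (simp add: coercivity_def)

definition reaction :: "real \<Rightarrow> real" where "reaction r = r / \<tau> + g r"

lemma reaction_continuous: "continuous_on UNIV reaction"
  unfolding reaction_def using g_continuous tau_pos by (intro continuous_intros) auto

lemma reaction_monotone: "coercivity * (a - b)\<^sup>2 \<le> (reaction a - reaction b) * (a - b)"
  using g_semimonotone[of a b] tau_pos
  by (simp add: reaction_def coercivity_def power2_eq_square algebra_simps diff_divide_distrib add_divide_distrib)

lemma reaction_L2: "z \<in> H1 L \<Longrightarrow> (\<lambda>x. reaction (z x)) \<in> L2 L"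
  using H1_bounded[OF _ L_pos] L2_comp[OF reaction_continuous L2_measurable[OF H1_L2]] by metis

text \<open>
  In this form of the variational inequality \<open>reaction\<close> collects the zero-order terms in the unknown,
  and \<open>h\<close> the control together with the contribution of the preceding step.
\<close>

definition step_solution :: "real \<Rightarrow> real \<Rightarrow> (real \<Rightarrow> real) \<Rightarrow> (real \<Rightarrow> real) \<Rightarrow> bool" where
  "step_solution \<epsilon> \<delta> h w \<longleftrightarrow> w \<in> admissible \<delta> \<and> (\<forall>z\<in>admissible \<delta>.
     L2_inner L (\<lambda>x. reaction (w x) - h x) (\<lambda>x. w x - z x) + energy \<epsilon> \<delta> w \<le> energy \<epsilon> \<delta> z)"

lemma step_monotone:
  assumes w: "step_solution \<epsilon> \<delta> h w" and w': "step_solution \<epsilon> \<delta> h' w'" and h: "h \<in> L2 L" "h' \<in> L2 L"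
  shows "coercivity * L2_sq L (\<lambda>x. w x - w' x) \<le> L2_inner L (\<lambda>x. h x - h' x) (\<lambda>x. w x - w' x)"
proof -
  have a: "w \<in> admissible \<delta>" "w' \<in> admissible \<delta>" using w w' by (auto simp: step_solution_def)
  note L2s = admissible_L2[OF a(1)] admissible_L2[OF a(2)] reaction_L2[OF admissible_H1[OF a(1)]] reaction_L2[OF admissible_H1[OF a(2)]]
  let ?d = "\<lambda>x. w x - w' x"
  have "coercivity * L2_sq L ?d \<le> L2_inner L (\<lambda>x. reaction (w x) - reaction (w' x)) ?d"
    unfolding L2_inner_def integral_mult_right_zero[symmetric] power2_eq_square[symmetric]
    by (intro integral_mono integrable_mult_right L2_square_integrable L2_integrable_mult L2_diff L2s reaction_monotone)
  moreover have "L2_inner L (\<lambda>x. reaction (w x) - h x) (\<lambda>x. w x - w' x) + energy \<epsilon> \<delta> w \<le> energy \<epsilon> \<delta> w'"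
    "L2_inner L (\<lambda>x. reaction (w' x) - h' x) (\<lambda>x. w' x - w x) + energy \<epsilon> \<delta> w' \<le> energy \<epsilon> \<delta> w"
    using w w' a by (auto simp: step_solution_def)
  ultimately show ?thesis using L2s h by (simp add: L2_inner_simps)
qed

lemma step_unique:
  assumes "step_solution \<epsilon> \<delta> h w" "step_solution \<epsilon> \<delta> h' w'" "h \<in> L2 L" "h' \<in> L2 L"
    and "AE x in Om L. h x = h' x"
  shows "AE x in Om L. w x = w' x"
proof -
  let ?d = "\<lambda>x. w x - w' x"
  have d: "?d \<in> L2 L" using assms by (auto simp: step_solution_def admissible_L2)
  have "L2_inner L (\<lambda>x. h x - h' x) ?d = L2_inner L (\<lambda>x. 0) ?d"
    using assms d by (intro L2_inner_cong_AE) auto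
  then have "coercivity * L2_sq L ?d \<le> 0" using step_monotone[OF assms(1-4)] by (simp add: L2_inner_def)
  then have "L2_sq L ?d \<le> 0" using coercivity_pos by (simp add: mult_le_0_iff)
  from L2_norm_zero_AE[OF d this] show ?thesis by simp
qed

text \<open>
  Testing with \<open>z = 0\<close>, where the energy vanishes, leaves the strongly monotone reaction and the
  energy on the left; Young's inequality absorbs the forcing.
\<close>

lemma step_bound:
  obtains B' where "\<And>\<epsilon> \<delta> h w. \<epsilon> \<in> {0..1} \<Longrightarrow> \<delta> \<in> {0..1} \<Longrightarrow> h \<in> L2 L \<Longrightarrow> L2_sq L h \<le> B \<Longrightarrow>
      step_solution \<epsilon> \<delta> h w \<Longrightarrow>
      L2_sq L w \<le> B' \<and> L2_sq L (ddx L w) \<le> B' \<and> energy \<epsilon> \<delta> w \<le> B'"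
proof -
  define c where "c = coercivity"
  have c: "c > 0" using coercivity_pos by (simp add: c_def)
  define Q where "Q = 2 * B + 2 * (reaction 0)\<^sup>2 * L2_sq L (\<lambda>_. 1)"
  define B1 where "B1 = Q / (2 * c)"
  define B' where "B' = B1 + B1 / (c / 2) + B1 / (\<nu>\<^sup>2 / 2)"
  have "L2_sq L w \<le> B' \<and> L2_sq L (ddx L w) \<le> B' \<and> energy \<epsilon> \<delta> w \<le> B'"
    if e: "\<epsilon> \<in> {0..1}" and d: "\<delta> \<in> {0..1}" and h: "h \<in> L2 L" "L2_sq L h \<le> B" and w: "step_solution \<epsilon> \<delta> h w"
    for \<epsilon> \<delta> h w
  proof -
    have a: "w \<in> admissible \<delta>" using w by (auto simp: step_solution_def)
    note L2s = admissible_L2[OF a] reaction_L2[OF admissible_H1[OF a]]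
    let ?r0 = "\<lambda>_::real. reaction 0" and ?k = "\<lambda>x. h x - reaction 0"
    have k: "?k \<in> L2 L" using h by simp
    have "c * L2_sq L w \<le> L2_inner L (\<lambda>x. reaction (w x) - ?r0 x) w"
      unfolding L2_inner_def integral_mult_right_zero[symmetric] power2_eq_square[symmetric] c_def
      using reaction_monotone[of _ 0]
      by (intro integral_mono integrable_mult_right L2_square_integrable L2_integrable_mult L2_diff L2s L2_const) simp
    moreover have "L2_inner L (\<lambda>x. reaction (w x) - h x) (\<lambda>x. w x - 0) + energy \<epsilon> \<delta> w \<le> 0"
      using w zero_admissible[OF e d] unfolding step_solution_def by fastforce
    ultimately have "c * L2_sq L w + energy \<epsilon> \<delta> w \<le> L2_inner L ?k w"
      using L2s h by (simp add: L2_inner_simps)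
    also have "\<dots> \<le> c / 2 * L2_sq L w + 1 / (2 * c) * L2_sq L ?k"
      by (rule L2_young[OF k L2s(1) c])
    also have "L2_sq L ?k \<le> Q"
    proof -
      have "0 \<le> L2_sq L (\<lambda>x. h x + reaction 0)" by (rule L2_inner_self_nonneg)
      then have "L2_sq L ?k \<le> 2 * L2_sq L h + 2 * L2_sq L ?r0"
        using h by (simp add: L2_inner_simps L2_inner_sym[of L ?r0 h])
      also have "L2_sq L ?r0 = (reaction 0)\<^sup>2 * L2_sq L (\<lambda>_. 1)"
        by (simp add: L2_inner_def power2_eq_square)
      finally show ?thesis using h(2) by (simp add: Q_def)
    qed
    finally have main: "c / 2 * L2_sq L w + energy \<epsilon> \<delta> w \<le> B1"
      using c by (simp add: B1_def divide_right_mono field_simps)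
    have E0: "0 \<le> \<nu>\<^sup>2 / 2 * L2_sq L (ddx L w)" by (simp add: L2_inner_self_nonneg)
    note E1 = energy_ge(1)[OF e, of w \<delta>]
    have W0: "0 \<le> c / 2 * L2_sq L w" using c by (simp add: L2_inner_self_nonneg)
    have "c / 2 * L2_sq L w \<le> B1" "\<nu>\<^sup>2 / 2 * L2_sq L (ddx L w) \<le> B1" "energy \<epsilon> \<delta> w \<le> B1" "0 \<le> B1"
      using main E0 E1 W0 by linarith+
    then have "L2_sq L w \<le> B1 / (c / 2)" "L2_sq L (ddx L w) \<le> B1 / (\<nu>\<^sup>2 / 2)" "energy \<epsilon> \<delta> w \<le> B1" "0 \<le> B1"
      "0 \<le> B1 / (c / 2)" "0 \<le> B1 / (\<nu>\<^sup>2 / 2)"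
      using c nu_pos by (auto simp: pos_le_divide_eq mult.commute)
    then show ?thesis unfolding B'_def by linarith
  qed
  then show ?thesis by (rule that)
qed

text \<open>
  The potential \<open>r\<^sup>2 / (2 * \<tau>) + G r\<close> is convex since its derivative is monotone, and it grows
  quadratically since \<open>G\<close> is nonnegative.
\<close>

lemma reaction_potential:
  obtains P where "\<And>r. (P has_real_derivative reaction r) (at r)" "\<And>r. r\<^sup>2 / (2 * \<tau>) \<le> P r"
    "\<And>a b. P b + reaction b * (a - b) \<le> P a"
proof -
  obtain G where G: "\<And>r. 0 \<le> G r" "\<And>r. (G has_real_derivative g r) (at r)"
    using g_ass by (auto simp: g_assms_def)
  define P where "P r = r\<^sup>2 / (2 * \<tau>) + G r" for r
  have D: "(P has_real_derivative reaction r) (at r)" for r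
    unfolding P_def reaction_def using tau_pos G(2) by (auto intro!: derivative_eq_intros)
  have "convex_on UNIV P"
  proof (rule convex_on_realI)
    show "reaction x \<le> reaction y" if "x \<le> y" for x y
    proof (rule ccontr)
      assume n: "\<not> reaction x \<le> reaction y"
      then have "x < y" using that by (cases "x = y") auto
      then have "(reaction y - reaction x) * (y - x) < 0" using n by (intro mult_neg_pos) auto
      moreover have "0 \<le> coercivity * (y - x)\<^sup>2" using coercivity_pos by simp
      ultimately show False using reaction_monotone[of y x] by linarith
    qed
  qed (use D in auto)
  then have "reaction b * (a - b) \<le> P a - P b" for a b
    by (rule convex_on_imp_above_tangent) (use D in auto)
  then have "P b + reaction b * (a - b) \<le> P a" for a b by (simp add: algebra_simps)
  with D show ?thesis using that[of P] G(1) by (simp add: P_def)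
qed

text \<open>
  The direct method. A minimizing sequence is bounded in \<open>H\<^sup>1\<close>, and compactness with the liminf
  inequality yields a minimizer \<open>w\<close>. It is compared with the points \<open>W k\<close> on the segment towards
  \<open>z\<close>: the increment of the potential is bounded by its slope at \<open>W k\<close>, the increment of the energy
  by convexity, and division by the step length \<open>q k\<close> gives the variational inequality in the limit.
\<close>

lemma step_exists:
  assumes e: "\<epsilon> \<in> {0..1}" and d: "\<delta> \<in> {0..1}" and h: "h \<in> L2 L"
  obtains w where "step_solution \<epsilon> \<delta> h w"
proof -
  obtain P where P: "\<And>r. (P has_real_derivative reaction r) (at r)" "\<And>r. r\<^sup>2 / (2 * \<tau>) \<le> P r"
    "\<And>a b. P b + reaction b * (a - b) \<le> P a" using reaction_potential by blast
  have Pcont: "continuous_on UNIV P" using P(1) by (auto intro: DERIV_continuous_on has_field_derivative_at_within)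
  have PL2: "(\<lambda>x. P (z x)) \<in> L2 L" if "z \<in> H1 L" for z
    using H1_bounded[OF that L_pos] L2_comp[OF Pcont L2_measurable[OF H1_L2[OF that]]] by metis
  define J where "J z = L2_inner L (\<lambda>x. P (z x)) (\<lambda>_. 1) - L2_inner L h z + energy \<epsilon> \<delta> z" for z
  define m where "m = \<tau> * L2_sq L h"
  have lower: "L2_sq L z / (4 * \<tau>) + energy \<epsilon> \<delta> z \<le> J z + m" if z: "z \<in> admissible \<delta>" for z
  proof -
    note zL = admissible_L2[OF z]
    have "L2_sq L z / (2 * \<tau>) \<le> L2_inner L (\<lambda>x. P (z x)) (\<lambda>_. 1)"
      unfolding L2_inner_def integral_divide_zero[symmetric]
      using P(2) L2_integrable[OF PL2[OF admissible_H1[OF z]]] L2_integrable_mult[OF zL zL]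
      by (intro integral_mono) (auto simp: power2_eq_square)
    moreover have "L2_inner L h z \<le> (1 / (2 * \<tau>)) / 2 * L2_sq L z + 1 / (2 * (1 / (2 * \<tau>))) * L2_sq L h"
      using tau_pos by (intro L2_young h zL) auto
    then have "L2_inner L h z \<le> L2_sq L z / (4 * \<tau>) + m" by (simp add: m_def)
    moreover have "L2_sq L z / (2 * \<tau>) = L2_sq L z / (4 * \<tau>) + L2_sq L z / (4 * \<tau>)"
      using tau_pos by (simp add: field_simps)
    ultimately show ?thesis unfolding J_def by linarith
  qed
  have nn: "0 \<le> energy \<epsilon> \<delta> z" "0 \<le> L2_sq L z / (4 * \<tau>)" for z
    using energy_ge(2)[OF e, of \<delta> z] order_trans[OF enn2real_nonneg] tau_pos by (auto simp: L2_inner_self_nonneg)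
  define j where "j = Inf (J ` admissible \<delta>)"
  have "- m \<le> J z" if "z \<in> admissible \<delta>" for z
    using lower[OF that] nn[of z] by linarith
  then have "bdd_below (J ` admissible \<delta>)" by (auto intro!: bdd_belowI2)
  then have j: "j \<le> J z" if "z \<in> admissible \<delta>" for z using that by (auto simp: j_def intro: cINF_lower)
  have "\<exists>z\<in>admissible \<delta>. J z < j + 1 / real (Suc k)" for k
  proof -
    have "J ` admissible \<delta> \<noteq> {}" using zero_admissible[OF e d] by blast
    from cInf_lessD[OF this, of "j + 1 / real (Suc k)"] show ?thesis by (auto simp: j_def)
  qed
  then obtain Z where Z: "\<And>k. Z k \<in> admissible \<delta>" and JZ: "\<And>k. J (Z k) < j + 1 / real (Suc k)" by metis
  define q where "q k = 1 / real (Suc k)" for k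
  have JZ: "J (Z k) < j + q k" and q1: "q k \<le> 1" "0 < q k" for k using JZ by (auto simp: q_def)
  have q0: "q \<longlonglongrightarrow> 0" unfolding q_def[abs_def] using LIMSEQ_Suc[OF lim_1_over_n] by simp
  define B where "B = (j + 1 + m) * (4 * \<tau>) + (j + 1 + m) / (\<nu>\<^sup>2 / 2)"
  have tot: "L2_sq L (Z k) / (4 * \<tau>) \<le> j + 1 + m" "energy \<epsilon> \<delta> (Z k) \<le> j + 1 + m" for k
    using lower[OF Z[of k]] nn[of "Z k"] JZ[of k] q1(1)[of k] by linarith+
  have B: "L2_sq L (Z k) \<le> B" "L2_sq L (ddx L (Z k)) \<le> B" for k
  proof -
    have "\<nu>\<^sup>2 / 2 * L2_sq L (ddx L (Z k)) \<le> j + 1 + m"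
      using energy_ge(1)[OF e, of "Z k" \<delta>] tot(2)[of k] by linarith
    then have "L2_sq L (Z k) \<le> (j + 1 + m) * (4 * \<tau>)"
      "L2_sq L (ddx L (Z k)) \<le> (j + 1 + m) / (\<nu>\<^sup>2 / 2)"
      using tot(1)[of k] tau_pos nu_pos by (auto simp: pos_divide_le_eq pos_le_divide_eq mult.commute)
    moreover have "0 \<le> (j + 1 + m) * (4 * \<tau>)" "0 \<le> (j + 1 + m) / (\<nu>\<^sup>2 / 2)"
      using order_trans[OF nn(1) tot(2)] tau_pos by auto
    ultimately show "L2_sq L (Z k) \<le> B" "L2_sq L (ddx L (Z k)) \<le> B"
      unfolding B_def by linarith+
  qed
  obtain r w C where r: "strict_mono r" and w: "w \<in> H1 L" and lim: "AE x in Om L. (\<lambda>k. Z (r k) x) \<longlonglongrightarrow> w x"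
    and C: "\<And>k. AE x in Om L. \<bar>Z (r k) x\<bar> \<le> C" and weak: "L2_weak_lim L (\<lambda>k. ddx L (Z (r k))) (ddx L w)"
    using H1_compact[of Z L B] admissible_H1[OF Z] L_pos B by blast
  note ZL = admissible_L2[OF Z] and wL = H1_L2[OF w]
  note en = energy_liminf[of "\<lambda>_. \<epsilon>" \<epsilon> "\<lambda>_. \<delta>" \<delta> "\<lambda>k. Z (r k)" w "j + 1 + m"]
  have wa: "w \<in> admissible \<delta>"
    by (rule en(1)) (use e d Z w lim weak tot in auto)
  have en: "\<forall>\<^sub>F k in sequentially. energy \<epsilon> \<delta> w - a < energy \<epsilon> \<delta> (Z (r k))" if "a > 0" for a
    by (rule en(2)) (use e d Z w lim weak tot that in auto)
  have lims: "L2_lim L (\<lambda>k. Z (r k)) w" "L2_lim L (\<lambda>k x. P (Z (r k) x)) (\<lambda>x. P (w x))"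
    using L2_lim_comp[OF _ L2_measurable[OF ZL] L2_measurable[OF wL] C lim, of "\<lambda>r. r"]
      L2_lim_comp[OF Pcont L2_measurable[OF ZL] L2_measurable[OF wL] C lim] by auto
  have potential_lim: "(\<lambda>k. L2_inner L (\<lambda>x. P (Z (r k) x)) (\<lambda>_. 1) - L2_inner L h (Z (r k)))
      \<longlonglongrightarrow> L2_inner L (\<lambda>x. P (w x)) (\<lambda>_. 1) - L2_inner L h w"
    by (intro tendsto_diff L2_lim_inner lims L2_lim_const PL2 admissible_H1[OF Z] w ZL wL h L2_const)
  have J_le: "J w \<le> j + a" if a: "a > 0" for a
  proof -
    let ?s = "L2_inner L (\<lambda>x. P (w x)) (\<lambda>_. 1) - L2_inner L h w"
    have "\<forall>\<^sub>F k in sequentially. ?s - a / 3 < L2_inner L (\<lambda>x. P (Z (r k) x)) (\<lambda>_. 1) - L2_inner L h (Z (r k))"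
      using potential_lim by (rule order_tendstoD) (use a in simp)
    moreover have "\<forall>\<^sub>F k in sequentially. energy \<epsilon> \<delta> w - a / 3 < energy \<epsilon> \<delta> (Z (r k))" using a by (intro en) simp
    moreover have "\<forall>\<^sub>F k in sequentially. q (r k) < a / 3"
      using LIMSEQ_subseq_LIMSEQ[OF q0 r] by (intro order_tendstoD(2)[of _ 0]) (use a in \<open>auto simp: o_def\<close>)
    ultimately have "\<forall>\<^sub>F k in sequentially. J w \<le> j + a"
    proof eventually_elim
      case (elim k)
      then show ?case using JZ[of "r k"] unfolding J_def by linarith
    qed
    then show ?thesis by simp
  qed
  have Jw: "J w \<le> j" by (rule field_le_epsilon[OF J_le])
  have "L2_inner L (\<lambda>x. reaction (w x) - h x) (\<lambda>x. w x - z x) + energy \<epsilon> \<delta> w \<le> energy \<epsilon> \<delta> z"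
    if z: "z \<in> admissible \<delta>" for z
  proof -
    note zL = admissible_L2[OF z] and zH = admissible_H1[OF z]
    let ?d = "\<lambda>x. z x - w x"
    have dL: "?d \<in> L2 L" using zL wL by simp
    define W where "W k x = (1 - q k) * w x + q k * z x" for k x
    have Wa: "W k \<in> admissible \<delta>" and WE: "energy \<epsilon> \<delta> (W k) \<le> (1 - q k) * energy \<epsilon> \<delta> w + q k * energy \<epsilon> \<delta> z" for k
      using energy_convex[OF e d wa z, of "q k"] q1[of k] by (auto simp: W_def[abs_def] less_imp_le)
    note WL = admissible_L2[OF Wa] and WH = admissible_H1[OF Wa]
    note RW = reaction_L2[OF WH]
    have ineq: "0 \<le> L2_inner L (\<lambda>x. reaction (W k x)) ?d - L2_inner L h ?d + (energy \<epsilon> \<delta> z - energy \<epsilon> \<delta> w)" for k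
    proof -
      have "L2_inner L (\<lambda>x. P (W k x)) (\<lambda>_. 1) - L2_inner L (\<lambda>x. P (w x)) (\<lambda>_. 1)
          = (LINT x|Om L. P (W k x) - P (w x))"
        using L2_integrable[OF PL2[OF WH]] L2_integrable[OF PL2[OF w]] by (simp add: L2_inner_def)
      also have "\<dots> \<le> (LINT x|Om L. q k * (reaction (W k x) * (z x - w x)))"
      proof (rule integral_mono)
        show "P (W k x) - P (w x) \<le> q k * (reaction (W k x) * (z x - w x))" for x
        proof -
          have "w x - W k x = - q k * (z x - w x)" by (simp add: W_def algebra_simps)
          then show ?thesis using P(3)[of "W k x" "w x"] by (simp add: mult.left_commute)
        qed
      qed (intro Bochner_Integration.integrable_diff integrable_mult_right L2_integrable_mult L2_integrable PL2 WH w RW dL)+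
      also have "\<dots> = q k * L2_inner L (\<lambda>x. reaction (W k x)) ?d" by (simp add: L2_inner_def)
      finally have 1: "L2_inner L (\<lambda>x. P (W k x)) (\<lambda>_. 1) - L2_inner L (\<lambda>x. P (w x)) (\<lambda>_. 1) \<le> q k * L2_inner L (\<lambda>x. reaction (W k x)) ?d" .
      have 2: "L2_inner L h (W k) = L2_inner L h w + q k * L2_inner L h ?d"
        using h wL zL by (simp add: W_def[abs_def] L2_inner_simps algebra_simps)
      have 3: "energy \<epsilon> \<delta> (W k) - energy \<epsilon> \<delta> w \<le> q k * (energy \<epsilon> \<delta> z - energy \<epsilon> \<delta> w)"
        using WE[of k] by (simp add: algebra_simps)
      have "J w \<le> J (W k)" using Jw j[OF Wa] by (rule order_trans)
      then have "0 \<le> q k * L2_inner L (\<lambda>x. reaction (W k x)) ?d - q k * L2_inner L h ?d + q k * (energy \<epsilon> \<delta> z - energy \<epsilon> \<delta> w)"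
        using 1 2 3 unfolding J_def by linarith
      also have "\<dots> = q k * (L2_inner L (\<lambda>x. reaction (W k x)) ?d - L2_inner L h ?d + (energy \<epsilon> \<delta> z - energy \<epsilon> \<delta> w))"
        by (simp add: algebra_simps)
      finally show ?thesis using q1(2)[of k] by (simp add: zero_le_mult_iff)
    qed
    obtain Cw where Cw: "AE x in Om L. \<bar>w x\<bar> \<le> Cw" using H1_bounded[OF w L_pos] by blast
    obtain Cz where Cz: "AE x in Om L. \<bar>z x\<bar> \<le> Cz" using H1_bounded[OF zH L_pos] by blast
    have Rlim: "L2_lim L (\<lambda>k x. reaction (W k x)) (\<lambda>x. reaction (w x))"
    proof (rule L2_lim_comp[OF reaction_continuous L2_measurable[OF WL] L2_measurable[OF wL]])
      show "AE x in Om L. \<bar>W k x\<bar> \<le> Cw + Cz" for k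
        using Cw Cz
      proof eventually_elim
        case (elim x)
        have "\<bar>W k x\<bar> \<le> \<bar>(1 - q k) * w x\<bar> + \<bar>q k * z x\<bar>" unfolding W_def by (rule abs_triangle_ineq)
        also have "\<dots> = (1 - q k) * \<bar>w x\<bar> + q k * \<bar>z x\<bar>" using q1[of k] by (simp add: abs_mult)
        also have "\<dots> \<le> 1 * \<bar>w x\<bar> + 1 * \<bar>z x\<bar>" using q1[of k] by (intro add_mono mult_right_mono) auto
        finally show ?case using elim by linarith
      qed
      show "AE x in Om L. (\<lambda>k. W k x) \<longlonglongrightarrow> w x"
      proof (rule AE_I2)
        fix x
        have "(\<lambda>k. W k x) \<longlonglongrightarrow> (1 - 0) * w x + 0 * z x" unfolding W_def by (intro tendsto_intros q0)
        then show "(\<lambda>k. W k x) \<longlonglongrightarrow> w x" by simp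
      qed
    qed
    have "(\<lambda>k. L2_inner L (\<lambda>x. reaction (W k x)) ?d - L2_inner L h ?d + (energy \<epsilon> \<delta> z - energy \<epsilon> \<delta> w))
        \<longlonglongrightarrow> L2_inner L (\<lambda>x. reaction (w x)) ?d - L2_inner L h ?d + (energy \<epsilon> \<delta> z - energy \<epsilon> \<delta> w)"
      by (intro tendsto_intros L2_lim_inner L2_lim_const Rlim RW reaction_L2 w dL)
    then have "0 \<le> L2_inner L (\<lambda>x. reaction (w x)) ?d - L2_inner L h ?d + (energy \<epsilon> \<delta> z - energy \<epsilon> \<delta> w)"
      by (rule LIMSEQ_le_const) (use ineq in blast)
    then show ?thesis using h wL zL reaction_L2[OF w] by (simp add: L2_inner_simps)
  qed
  then have "step_solution \<epsilon> \<delta> h w" using wa by (simp add: step_solution_def)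
  then show ?thesis by (rule that)
qed

text \<open>
  The forcing converges only weakly, but it is paired with \<open>W k - z\<close>, which converges strongly by
  compactness along a subsequence. The energies pass to the limit by the two halves of Mosco convergence.
\<close>

lemma step_limit:
  assumes E: "\<And>k. E k \<in> {0..1}" "E \<longlonglongrightarrow> \<epsilon>" "\<epsilon> \<in> {0..1}"
    and D: "\<And>k. D k \<in> {0..1}" "D \<longlonglongrightarrow> \<delta>" "\<delta> \<in> {0..1}"
    and h: "\<And>k. h k \<in> L2 L" "h0 \<in> L2 L" "\<And>k. L2_sq L (h k) \<le> B" "L2_weak_lim L h h0"
    and W: "\<And>k. step_solution (E k) (D k) (h k) (W k)"
  obtains r w where "strict_mono r" "step_solution \<epsilon> \<delta> h0 w" "L2_lim L (\<lambda>k. W (r k)) w"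
proof -
  obtain B' where B': "\<And>k. L2_sq L (W k) \<le> B'" "\<And>k. L2_sq L (ddx L (W k)) \<le> B'"
    "\<And>k. energy (E k) (D k) (W k) \<le> B'"
    using step_bound[of B] E(1) D(1) h(1,3) W by metis
  have Wa: "W k \<in> admissible (D k)" for k using W by (simp add: step_solution_def)
  obtain r w C where r: "strict_mono r" and w: "w \<in> H1 L" and lim: "AE x in Om L. (\<lambda>k. W (r k) x) \<longlonglongrightarrow> w x"
    and C: "\<And>k. AE x in Om L. \<bar>W (r k) x\<bar> \<le> C" and weak: "L2_weak_lim L (\<lambda>k. ddx L (W (r k))) (ddx L w)"
    using H1_compact[of W L B'] admissible_H1[OF Wa] L_pos B' by blast
  note WL = admissible_L2[OF Wa] and wL = H1_L2[OF w] and WH = admissible_H1[OF Wa]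
  have Er: "(\<lambda>k. E (r k)) \<longlonglongrightarrow> \<epsilon>" and Dr: "(\<lambda>k. D (r k)) \<longlonglongrightarrow> \<delta>"
    using LIMSEQ_subseq_LIMSEQ[OF E(2) r] LIMSEQ_subseq_LIMSEQ[OF D(2) r] by (auto simp: o_def)
  note en = energy_liminf[OF E(1) Er E(3) D(1) Dr D(3) Wa w lim weak B'(3)]
  have lims: "L2_lim L (\<lambda>k. W (r k)) w" "L2_lim L (\<lambda>k x. reaction (W (r k) x)) (\<lambda>x. reaction (w x))"
    using L2_lim_comp[OF _ L2_measurable[OF WL] L2_measurable[OF wL] C lim, of "\<lambda>r. r"]
      L2_lim_comp[OF reaction_continuous L2_measurable[OF WL] L2_measurable[OF wL] C lim] by auto
  have "L2_inner L (\<lambda>x. reaction (w x) - h0 x) (\<lambda>x. w x - z x) + energy \<epsilon> \<delta> w \<le> energy \<epsilon> \<delta> z"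
    if z: "z \<in> admissible \<delta>" for z
  proof (rule field_le_epsilon)
    fix a :: real assume a: "a > 0"
    note zL = admissible_L2[OF z]
    define p where "p k = L2_inner L (\<lambda>x. reaction (W (r k) x) - h (r k) x) (\<lambda>x. W (r k) x - z x)" for k
    define p0 where "p0 = L2_inner L (\<lambda>x. reaction (w x) - h0 x) (\<lambda>x. w x - z x)"
    have dlim: "L2_lim L (\<lambda>k x. W (r k) x - z x) (\<lambda>x. w x - z x)"
      using L2_lim_lincomb[OF WL wL lims(1) zL zL L2_lim_const, of 1 "-1"] by simp
    have "(\<lambda>k. L2_inner L (\<lambda>x. reaction (W (r k) x)) (\<lambda>x. W (r k) x - z x) - L2_inner L (h (r k)) (\<lambda>x. W (r k) x - z x))
        \<longlonglongrightarrow> L2_inner L (\<lambda>x. reaction (w x)) (\<lambda>x. w x - z x) - L2_inner L h0 (\<lambda>x. w x - z x)"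
      by (intro tendsto_diff L2_lim_inner L2_weak_strong_inner[where B=B] lims dlim reaction_L2 WH w L2_diff WL wL zL h
          L2_weak_lim_subseq[OF h(4) r])
    then have "p \<longlonglongrightarrow> p0"
      using h reaction_L2[OF WH] reaction_L2[OF w] WL wL zL by (simp add: p_def[abs_def] p0_def L2_inner_simps)
    then have "\<forall>\<^sub>F k in sequentially. p0 - a / 3 < p k" by (rule order_tendstoD) (use a in simp)
    moreover have "\<forall>\<^sub>F k in sequentially. energy \<epsilon> \<delta> w - a / 3 < energy (E (r k)) (D (r k)) (W (r k))"
      using a by (intro en(2)) simp
    moreover have "\<forall>\<^sub>F k in sequentially. z \<in> admissible (D (r k)) \<and> energy (E (r k)) (D (r k)) z \<le> energy \<epsilon> \<delta> z + a / 3"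
      using a by (intro energy_recovery[OF E(1) Er E(3) D(1) Dr D(3) z]) simp
    ultimately have "\<forall>\<^sub>F k in sequentially. p0 + energy \<epsilon> \<delta> w \<le> energy \<epsilon> \<delta> z + a"
    proof eventually_elim
      case (elim k)
      then have "p k + energy (E (r k)) (D (r k)) (W (r k)) \<le> energy (E (r k)) (D (r k)) z"
        using W[of "r k"] by (simp add: step_solution_def p_def)
      then show ?case using elim by linarith
    qed
    then show "L2_inner L (\<lambda>x. reaction (w x) - h0 x) (\<lambda>x. w x - z x) + energy \<epsilon> \<delta> w \<le> energy \<epsilon> \<delta> z + a"
      by (simp add: p0_def)
  qed
  then have "step_solution \<epsilon> \<delta> h0 w" using en(1) by (simp add: step_solution_def)
  with r show ?thesis using lims(1) by (rule that)
qed

text \<open>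
  Every subsequence has a further subsequence converging to a solution of the limit step, and there
  is only one such solution.
\<close>

lemma step_stable:
  assumes E: "\<And>k. E k \<in> {0..1}" "E \<longlonglongrightarrow> \<epsilon>" "\<epsilon> \<in> {0..1}"
    and D: "\<And>k. D k \<in> {0..1}" "D \<longlonglongrightarrow> \<delta>" "\<delta> \<in> {0..1}"
    and h: "\<And>k. h k \<in> L2 L" "h0 \<in> L2 L" "\<And>k. L2_sq L (h k) \<le> B" "L2_weak_lim L h h0"
    and W: "\<And>k. step_solution (E k) (D k) (h k) (W k)" and w: "step_solution \<epsilon> \<delta> h0 w"
  shows "L2_lim L W w"
  unfolding L2_lim_def
proof (rule tendsto_zero_by_subsequences)
  fix r :: "nat \<Rightarrow> nat" assume r: "strict_mono r"
  have Er: "(\<lambda>k. E (r k)) \<longlonglongrightarrow> \<epsilon>" and Dr: "(\<lambda>k. D (r k)) \<longlonglongrightarrow> \<delta>"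
    using LIMSEQ_subseq_LIMSEQ[OF E(2) r] LIMSEQ_subseq_LIMSEQ[OF D(2) r] by (auto simp: o_def)
  obtain s w' where s: "strict_mono s" and w': "step_solution \<epsilon> \<delta> h0 w'" and lim: "L2_lim L (\<lambda>k. W (r (s k))) w'"
    using step_limit[OF E(1) Er E(3) D(1) Dr D(3) h(1,2,3) L2_weak_lim_subseq[OF h(4) r] W] by blast
  have eq: "AE x in Om L. w x = w' x" using step_unique[OF w w' h(2) h(2)] by simp
  have WL: "W k \<in> L2 L" for k using W[of k] by (auto simp: step_solution_def intro: admissible_L2)
  have wL: "w \<in> L2 L" "w' \<in> L2 L" using w w' by (auto simp: step_solution_def intro: admissible_L2)
  have "L2_sq L (\<lambda>x. W k x - w x) = L2_sq L (\<lambda>x. W k x - w' x)" for k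
  proof -
    have "AE x in Om L. W k x - w x = W k x - w' x" using eq by eventually_elim simp
    then show ?thesis using WL[of k] wL by (intro L2_inner_cong_AE L2_diff)
  qed
  then show "\<exists>s. strict_mono s \<and> (\<lambda>k. L2_sq L (\<lambda>t. W (r (s k)) t - w t)) \<longlonglongrightarrow> 0"
    using s lim by (auto simp: L2_lim_def)
qed

end

section \<open>The state system and the control problem\<close>

locale control_problem = phase_field L \<nu> "T / real n" Cg f Kh K g
  for L \<nu> T :: real and n :: nat and Cg :: real and f Kh K :: "real \<Rightarrow> real \<Rightarrow> real" and g :: "real \<Rightarrow> real" +
  fixes Mu Mw :: real and wad :: "nat \<Rightarrow> real \<Rightarrow> real"
  assumes Mu_nonneg: "0 \<le> Mu" and Mw_nonneg: "0 \<le> Mw" and wad: "wad \<in> XX L n"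
begin

abbreviation "\<tau> \<equiv> T / real n"

definition forcing :: "(nat \<Rightarrow> real \<Rightarrow> real) \<Rightarrow> (nat \<Rightarrow> real \<Rightarrow> real) \<Rightarrow> nat \<Rightarrow> real \<Rightarrow> real" where
  "forcing v u i = (\<lambda>x. (1 / \<tau>) * v (i - 1) x + Mu * u i x)"

abbreviation solves where "solves \<equiv> AC_solution L T n \<nu> Mu f g Kh"

lemma forcing_L2: "v (i - 1) \<in> L2 L \<Longrightarrow> u i \<in> L2 L \<Longrightarrow> forcing v u i \<in> L2 L"
  unfolding forcing_def by (intro L2_add L2_scale)

text \<open>
  All energies of admissible functions are finite, so the extended real inequality of the state
  system is one between real numbers; the rest regroups the zero-order terms.
\<close>

lemma solves_iff_steps:
  assumes e: "\<epsilon> \<in> {0..1}" and w0: "w0 \<in> L2 L" and u: "u \<in> XX L n"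
  shows "solves \<epsilon> \<delta> w0 u w \<longleftrightarrow> (\<forall>i\<in>{1..n}. step_solution \<epsilon> \<delta> (forcing (w(0 := w0)) u i) (w i))"
proof (cases "\<forall>i\<in>{1..n}. w i \<in> admissible \<delta>")
  case False
  then show ?thesis
    unfolding AC_solution_def Let_def D_Psi_eq_admissible[OF e] step_solution_def by blast
next
  case True
  have prev: "(w(0 := w0)) (i - 1) \<in> L2 L" if "i \<in> {1..n}" for i
  proof (cases "i = 1")
    case False
    then have "i - 1 \<in> {1..n}" "i - 1 \<noteq> 0" using that by auto
    then show ?thesis using True by (auto intro!: admissible_L2)
  qed (use w0 in simp)
  have eq: "ereal (1 / \<tau> * L2_inner L (\<lambda>x. w i x - (w(0 := w0)) (i - 1) x) (\<lambda>x. w i x - z x) +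
        L2_inner L (\<lambda>x. g (w i x) - Mu * u i x) (\<lambda>x. w i x - z x)) +
        Psi L \<nu> f Kh \<epsilon> \<delta> (w i) - Psi L \<nu> f Kh \<epsilon> \<delta> z \<le> 0 \<longleftrightarrow>
      L2_inner L (\<lambda>x. reaction (w i x) - forcing (w(0 := w0)) u i x) (\<lambda>x. w i x - z x) + energy \<epsilon> \<delta> (w i) \<le> energy \<epsilon> \<delta> z"
    if i: "i \<in> {1..n}" and z: "z \<in> admissible \<delta>" for i z
  proof -
    let ?p = "(w(0 := w0)) (i - 1)" and ?d = "\<lambda>x. w i x - z x"
    have w: "w i \<in> admissible \<delta>" using True i by blast
    note wL = admissible_L2[OF w] and zL = admissible_L2[OF z]
    have uL: "u i \<in> L2 L" using u i by (simp add: XX_def)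
    have gL: "(\<lambda>x. g (w i x)) \<in> L2 L"
      using H1_bounded[OF admissible_H1[OF w] L_pos] L2_comp[OF g_continuous L2_measurable[OF wL]] by metis
    have "L2_inner L (\<lambda>x. reaction (w i x) - forcing (w(0 := w0)) u i x) ?d
        = L2_inner L (\<lambda>x. (1 / \<tau>) * (w i x - ?p x) + (g (w i x) - Mu * u i x)) ?d"
      by (rule arg_cong[of _ _ "\<lambda>a. L2_inner L a ?d"]) (auto simp: reaction_def forcing_def algebra_simps diff_divide_distrib)
    also have "\<dots> = 1 / \<tau> * L2_inner L (\<lambda>x. w i x - ?p x) ?d + L2_inner L (\<lambda>x. g (w i x) - Mu * u i x) ?d"
      using L2.ip_add_left[of "\<lambda>x. (1 / \<tau>) * (w i x - ?p x)" L "\<lambda>x. g (w i x) - Mu * u i x" ?d]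
        L2_inner_simps(5)[of "\<lambda>x. w i x - ?p x" L "\<lambda>_. 0" ?d "1 / \<tau>"] wL zL uL gL prev[OF i]
      by (simp add: plus_fun_def)
    finally show ?thesis
      unfolding Psi_eq_energy[OF e w] Psi_eq_energy[OF e z] by (simp add: algebra_simps)
  qed
  show ?thesis
    unfolding AC_solution_def Let_def D_Psi_eq_admissible[OF e] step_solution_def
    using True eq by blast
qed

lemma solves_L2:
  assumes "\<epsilon> \<in> {0..1}" "solves \<epsilon> \<delta> w0 u w" "i \<in> {1..n}"
  shows "w i \<in> L2 L"
  using assms by (auto simp: AC_solution_def Let_def D_Psi_eq_admissible intro: admissible_L2)

lemma solves_exists:
  assumes e: "\<epsilon> \<in> {0..1}" and d: "\<delta> \<in> {0..1}" and w0: "w0 \<in> L2 L" and u: "u \<in> XX L n"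
  shows "\<exists>w. solves \<epsilon> \<delta> w0 u w"
proof -
  define step where "step h = (SOME w. step_solution \<epsilon> \<delta> h w)" for h
  have step: "step_solution \<epsilon> \<delta> h (step h)" if "h \<in> L2 L" for h
    unfolding step_def using step_exists[OF e d that] by (metis someI_ex)
  define w where "w = rec_nat w0 (\<lambda>i v. step (\<lambda>x. (1 / \<tau>) * v x + Mu * u (Suc i) x))"
  have w0': "w 0 = w0" and wS: "w (Suc i) = step (forcing w u (Suc i))" for i
    by (simp_all add: w_def forcing_def)
  have wL: "w i \<in> L2 L" if "i \<le> n" for i
    using that
  proof (induction i)
    case 0
    then show ?case using w0 w0' by simp
  next
    case (Suc i)
    then have "forcing w u (Suc i) \<in> L2 L" using u by (intro forcing_L2) (auto simp: XX_def)
    from step[OF this] show ?case by (auto simp: wS step_solution_def intro: admissible_L2)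
  qed
  have "step_solution \<epsilon> \<delta> (forcing (w(0 := w0)) u i) (w i)" if i: "i \<in> {1..n}" for i
  proof -
    obtain k where k: "i = Suc k" using i by (cases i) auto
    have "w(0 := w0) = w" using w0' by auto
    moreover have "forcing w u i \<in> L2 L" using wL[of k] u i by (intro forcing_L2) (auto simp: XX_def k)
    ultimately show ?thesis using step by (simp add: k wS)
  qed
  then show ?thesis using solves_iff_steps[OF e w0 u] by blast
qed

abbreviation state where "state \<equiv> AC_state L T n \<nu> Mu f g Kh"

lemma state_solves:
  assumes "\<epsilon> \<in> {0..1}" "\<delta> \<in> {0..1}" "w0 \<in> L2 L" "u \<in> XX L n"
  shows "solves \<epsilon> \<delta> w0 u (state \<epsilon> \<delta> w0 u)"
  unfolding AC_state_def using solves_exists[OF assms] by (rule someI_ex)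

text \<open>
  Induction over the steps: a step turns weakly convergent and bounded data into a strongly
  convergent solution, which is a datum of the same kind for the next step.
\<close>

lemma state_stable:
  assumes E: "\<And>k. E k \<in> {0..1}" "E \<longlonglongrightarrow> \<epsilon>" "\<epsilon> \<in> {0..1}"
    and D: "\<And>k. D k \<in> {0..1}" "D \<longlonglongrightarrow> \<delta>" "\<delta> \<in> {0..1}"
    and W0: "\<And>k. W0 k \<in> L2 L" "w0 \<in> L2 L" "\<And>k. L2_sq L (W0 k) \<le> B0" "L2_weak_lim L W0 w0"
    and U: "\<And>k. U k \<in> XX L n" "u \<in> XX L n" "\<And>k. XX_inner L n (U k) (U k) \<le> B" "XX_weak_lim L n U u"
    and i: "i \<in> {1..n}"
  shows "L2_lim L (\<lambda>k. state (E k) (D k) (W0 k) (U k) i) (state \<epsilon> \<delta> w0 u i)"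
proof -
  define W where "W k = (state (E k) (D k) (W0 k) (U k))(0 := W0 k)" for k
  define w where "w = (state \<epsilon> \<delta> w0 u)(0 := w0)"
  have step: "step_solution (E k) (D k) (forcing (W k) (U k) i) (W k i)" if "i \<in> {1..n}" for k i
    using solves_iff_steps[OF E(1) W0(1) U(1)] state_solves[OF E(1) D(1) W0(1) U(1), of k k k k] that
    by (auto simp: W_def)
  have step0: "step_solution \<epsilon> \<delta> (forcing w u i) (w i)" if "i \<in> {1..n}" for i
    using solves_iff_steps[OF E(3) W0(2) U(2)] state_solves[OF E(3) D(3) W0(2) U(2)] that by (auto simp: w_def)
  have UL: "U k i \<in> L2 L" "u i \<in> L2 L" if "i \<in> {1..n}" for i k using U that by (auto simp: XX_def)
  define good where "good i \<longleftrightarrow> (\<forall>k. W k i \<in> L2 L) \<and> w i \<in> L2 L \<and> (\<exists>C. \<forall>k. L2_sq L (W k i) \<le> C) \<and>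
      L2_weak_lim L (\<lambda>k. W k i) (w i)" for i
  have next_step: "L2_lim L (\<lambda>k. W k (Suc i)) (w (Suc i))" if g: "good i" and i: "Suc i \<in> {1..n}" for i
  proof -
    define H where "H k = forcing (W k) (U k) (Suc i)" for k
    define h0 where "h0 = forcing w u (Suc i)"
    have WL: "W k i \<in> L2 L" and wL: "w i \<in> L2 L" and weak: "L2_weak_lim L (\<lambda>k. W k i) (w i)" for k
      using g by (auto simp: good_def)
    obtain C where C: "\<And>k. L2_sq L (W k i) \<le> C" using g by (auto simp: good_def)
    have hL: "H k \<in> L2 L" "h0 \<in> L2 L" for k using WL wL UL[OF i] by (auto simp: H_def h0_def intro: forcing_L2)
    have inner: "L2_inner L (\<lambda>x. a * p x + c * q x) y = a * L2_inner L p y + c * L2_inner L q y"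
      if "p \<in> L2 L" "q \<in> L2 L" "y \<in> L2 L" for a c p q y
      using that L2_inner_simps(1)[of "\<lambda>x. a * p x" L "\<lambda>x. c * q x" y] L2_inner_simps(5)[of p L p y a]
        L2_inner_simps(5)[of q L p y c] by simp
    have "L2_weak_lim L H h0"
      unfolding L2_weak_lim_def
    proof
      fix y assume y: "y \<in> L2 L"
      have "(\<lambda>k. (1 / \<tau>) * L2_inner L (W k i) y + Mu * L2_inner L (U k (Suc i)) y)
          \<longlonglongrightarrow> (1 / \<tau>) * L2_inner L (w i) y + Mu * L2_inner L (u (Suc i)) y"
        using weak XX_weak_lim_component[OF U(4) i] y unfolding L2_weak_lim_def
        by (intro tendsto_add tendsto_mult tendsto_const) auto
      then show "(\<lambda>k. L2_inner L (H k) y) \<longlonglongrightarrow> L2_inner L h0 y"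
        unfolding H_def h0_def forcing_def diff_Suc_1 inner[OF WL UL(1)[OF i] y] inner[OF wL UL(2)[OF i] y] .
    qed
    moreover have "L2_sq L (H k) \<le> 2 * (1 / \<tau>)\<^sup>2 * C + 2 * Mu\<^sup>2 * B" for k
    proof -
      let ?p = "W k i" and ?q = "U k (Suc i)"
      have "0 \<le> L2_sq L (\<lambda>x. (1 / \<tau>) * ?p x + (- Mu) * ?q x)"
        by (rule L2_inner_self_nonneg)
      moreover have sq: "L2_sq L (\<lambda>x. a * ?p x + c * ?q x)
          = a\<^sup>2 * L2_sq L ?p + 2 * (a * c) * L2_inner L ?p ?q + c\<^sup>2 * L2_sq L ?q" for a c
      proof -
        let ?F = "\<lambda>x. a * ?p x + c * ?q x"
        have pL: "?p \<in> L2 L" and qL: "?q \<in> L2 L" using WL UL[OF i] by auto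
        have FL: "?F \<in> L2 L" using pL qL by simp
        have "L2_sq L ?F = a * L2_inner L ?F ?p + c * L2_inner L ?F ?q"
          unfolding inner[OF pL qL FL] by (simp only: L2_inner_sym[of L ?F])
        then show ?thesis
          unfolding inner[OF pL qL pL] inner[OF pL qL qL] L2_inner_sym[of L ?q ?p]
          by (simp add: power2_eq_square algebra_simps)
      qed
      ultimately have "L2_sq L (H k) \<le> 2 * ((1 / \<tau>)\<^sup>2 * L2_sq L ?p) + 2 * (Mu\<^sup>2 * L2_sq L ?q)"
        unfolding H_def forcing_def by (simp only: sq diff_Suc_1) (simp add: algebra_simps)
      also have "\<dots> \<le> 2 * ((1 / \<tau>)\<^sup>2 * C) + 2 * (Mu\<^sup>2 * B)"
        using C[of k] order_trans[OF XX_inner_component_le[OF i] U(3)[of k]]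
        by (intro add_mono mult_left_mono) auto
      finally show ?thesis by simp
    qed
    ultimately show ?thesis
      using step[OF i] step0[OF i] hL by (intro step_stable[OF E D, of H h0]) (auto simp: H_def h0_def)
  qed
  have WLs: "W k i \<in> L2 L" "w i \<in> L2 L" if "i \<in> {1..n}" for i k
    using step[OF that, of k] step0[OF that] by (auto simp: step_solution_def intro: admissible_L2)
  have "good i" if "i \<le> n" for i
    using that
  proof (induction i)
    case 0
    then show ?case using W0 by (auto simp: good_def W_def w_def)
  next
    case (Suc i)
    then have i: "Suc i \<in> {1..n}" by auto
    have lim: "L2_lim L (\<lambda>k. W k (Suc i)) (w (Suc i))" using Suc i by (intro next_step) auto
    obtain C where "\<And>k. L2_sq L (W k (Suc i)) \<le> C"
      using L2_lim_bounded[OF WLs(1)[OF i] WLs(2)[OF i] lim] by blast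
    then show ?case
      using WLs[OF i] L2_lim_weak[OF WLs(1)[OF i] WLs(2)[OF i] lim] by (auto simp: good_def)
  qed
  moreover obtain k where "i = Suc k" using i by (cases i) auto
  ultimately have "L2_lim L (\<lambda>k. W k i) (w i)" using next_step[of k] i by simp
  then show ?thesis using i by (simp add: W_def w_def)
qed

abbreviation J where "J \<equiv> cost L T n \<nu> Mu Mw wad f g Kh"

definition tracking :: "real \<Rightarrow> real \<Rightarrow> (real \<Rightarrow> real) \<Rightarrow> (nat \<Rightarrow> real \<Rightarrow> real) \<Rightarrow> real" where
  "tracking \<epsilon> \<delta> w0 u = (\<Sum>i=1..n. L2_sq L (\<lambda>x. state \<epsilon> \<delta> w0 u i x - wad i x))"

lemma cost_eq: "J \<epsilon> \<delta> w0 u = Mw / 2 * tracking \<epsilon> \<delta> w0 u + Mu / 2 * XX_inner L n u u"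
  by (simp add: cost_def tracking_def XX_inner_def)

lemma tracking_nonneg: "0 \<le> tracking \<epsilon> \<delta> w0 u"
  by (simp add: tracking_def sum_nonneg L2_inner_self_nonneg)

lemma cost_ge: "Mu / 2 * XX_inner L n u u \<le> J \<epsilon> \<delta> w0 u"
  using tracking_nonneg Mw_nonneg by (simp add: cost_eq)

lemma cost_nonneg: "0 \<le> J \<epsilon> \<delta> w0 u"
  using cost_ge[of u] Mu_nonneg XX.ip_nonneg[of u L n]
  by (simp add: cost_eq tracking_nonneg Mw_nonneg XX_inner_def sum_nonneg L2_inner_self_nonneg)

lemma tracking_tendsto:
  assumes E: "\<And>k. E k \<in> {0..1}" "E \<longlonglongrightarrow> \<epsilon>" "\<epsilon> \<in> {0..1}"
    and D: "\<And>k. D k \<in> {0..1}" "D \<longlonglongrightarrow> \<delta>" "\<delta> \<in> {0..1}"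
    and W0: "\<And>k. W0 k \<in> L2 L" "w0 \<in> L2 L" "\<And>k. L2_sq L (W0 k) \<le> B0" "L2_weak_lim L W0 w0"
    and U: "\<And>k. U k \<in> XX L n" "u \<in> XX L n" "\<And>k. XX_inner L n (U k) (U k) \<le> B" "XX_weak_lim L n U u"
  shows "(\<lambda>k. tracking (E k) (D k) (W0 k) (U k)) \<longlonglongrightarrow> tracking \<epsilon> \<delta> w0 u"
  unfolding tracking_def
proof (rule tendsto_sum)
  fix i assume i: "i \<in> {1..n}"
  let ?W = "\<lambda>k. state (E k) (D k) (W0 k) (U k) i" and ?w = "state \<epsilon> \<delta> w0 u i"
  have a: "wad i \<in> L2 L" using wad i by (simp add: XX_def)
  have WL: "?W k \<in> L2 L" for k by (rule solves_L2[OF E(1) state_solves[OF E(1) D(1) W0(1) U(1)] i])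
  have wL: "?w \<in> L2 L" by (rule solves_L2[OF E(3) state_solves[OF E(3) D(3) W0(2) U(2)] i])
  have lim: "L2_lim L ?W ?w" by (rule state_stable[OF E D W0 U i])
  have "L2_lim L (\<lambda>k x. ?W k x - wad i x) (\<lambda>x. ?w x - wad i x)"
    using L2_lim_lincomb[OF WL wL lim a a L2_lim_const, of 1 "-1"] by simp
  then show "(\<lambda>k. L2_sq L (\<lambda>x. ?W k x - wad i x))
      \<longlonglongrightarrow> L2_sq L (\<lambda>x. ?w x - wad i x)"
    using WL wL a by (intro L2_lim_inner) auto
qed

lemma cost_tendsto:
  assumes E: "\<And>k. E k \<in> {0..1}" "E \<longlonglongrightarrow> \<epsilon>" "\<epsilon> \<in> {0..1}"
    and D: "\<And>k. D k \<in> {0..1}" "D \<longlonglongrightarrow> \<delta>" "\<delta> \<in> {0..1}"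
    and W0: "\<And>k. W0 k \<in> L2 L" "w0 \<in> L2 L" "\<And>k. L2_sq L (W0 k) \<le> B0" "L2_weak_lim L W0 w0"
    and u: "u \<in> XX L n"
  shows "(\<lambda>k. J (E k) (D k) (W0 k) u) \<longlonglongrightarrow> J \<epsilon> \<delta> w0 u"
  unfolding cost_eq
  by (intro tendsto_intros tracking_tendsto[OF E D W0, of "\<lambda>_. u" u "XX_inner L n u u"])
    (auto simp: u XX_weak_lim_def)

lemma cost_liminf:
  assumes E: "\<And>k. E k \<in> {0..1}" "E \<longlonglongrightarrow> \<epsilon>" "\<epsilon> \<in> {0..1}"
    and D: "\<And>k. D k \<in> {0..1}" "D \<longlonglongrightarrow> \<delta>" "\<delta> \<in> {0..1}"
    and W0: "\<And>k. W0 k \<in> L2 L" "w0 \<in> L2 L" "\<And>k. L2_sq L (W0 k) \<le> B0" "L2_weak_lim L W0 w0"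
    and U: "\<And>k. U k \<in> XX L n" "u \<in> XX L n" "\<And>k. XX_inner L n (U k) (U k) \<le> B" "XX_weak_lim L n U u"
    and e: "e > 0"
  shows "\<forall>\<^sub>F k in sequentially. J \<epsilon> \<delta> w0 u - e < J (E k) (D k) (W0 k) (U k)"
proof -
  have "(\<lambda>k. Mw / 2 * tracking (E k) (D k) (W0 k) (U k)) \<longlonglongrightarrow> Mw / 2 * tracking \<epsilon> \<delta> w0 u"
    by (intro tendsto_intros tracking_tendsto[OF E D W0 U])
  then have "\<forall>\<^sub>F k in sequentially. Mw / 2 * tracking \<epsilon> \<delta> w0 u - e / 2 < Mw / 2 * tracking (E k) (D k) (W0 k) (U k)"
    by (rule order_tendstoD) (use e in simp)
  (* Mu + 1 rather than Mu, which may vanish. *)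
  moreover have "\<forall>\<^sub>F k in sequentially. XX_inner L n u u - e / (Mu + 1) < XX_inner L n (U k) (U k)"
    by (rule XX.weakly_lower_semicontinuous[OF U(1,2)]) (use U(4) e Mu_nonneg in \<open>auto simp: XX_weakly_iff\<close>)
  ultimately show ?thesis
  proof eventually_elim
    case (elim k)
    have "Mu / 2 * (XX_inner L n u u - e / (Mu + 1)) \<le> Mu / 2 * XX_inner L n (U k) (U k)"
      using elim(2) Mu_nonneg by (intro mult_left_mono) auto
    moreover have "Mu / 2 * (e / (Mu + 1)) \<le> e / 2"
      using e Mu_nonneg by (simp add: field_simps)
    ultimately have "Mu / 2 * XX_inner L n u u - e / 2 \<le> Mu / 2 * XX_inner L n (U k) (U k)"
      by (simp add: right_diff_distrib)
    then show ?case using elim(1) unfolding cost_eq by linarith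
  qed
qed

abbreviation optimal where "optimal \<equiv> optimal_control L T n \<nu> Mu Mw wad f g Kh"

lemma optimalI:
  "u \<in> XX L n \<Longrightarrow> (\<And>v. v \<in> XX L n \<Longrightarrow> J \<epsilon> \<delta> w0 u \<le> J \<epsilon> \<delta> w0 v) \<Longrightarrow> optimal \<epsilon> \<delta> w0 u"
  unfolding optimal_control_def is_arg_min_def by fastforce

lemma optimalD:
  assumes "optimal \<epsilon> \<delta> w0 u"
  shows "u \<in> XX L n" and "v \<in> XX L n \<Longrightarrow> J \<epsilon> \<delta> w0 u \<le> J \<epsilon> \<delta> w0 v"
  using assms unfolding optimal_control_def is_arg_min_def by (auto simp: not_less)

lemma zero_XX: "(\<lambda>_ _. 0) \<in> XX L n"
  by (simp add: XX_def)

text \<open>Without control costs the control does not enter the state system either.\<close>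

lemma optimal_if_no_control:
  assumes "Mu = 0" and u: "u \<in> XX L n"
  shows "optimal \<epsilon> \<delta> w0 u"
proof (rule optimalI[OF u])
  fix v
  have "state \<epsilon> \<delta> w0 u = state \<epsilon> \<delta> w0 v" using assms by (simp add: AC_state_def AC_solution_def)
  then show "J \<epsilon> \<delta> w0 u \<le> J \<epsilon> \<delta> w0 v" unfolding cost_eq tracking_def using assms by simp
qed

text \<open>
  Comparison with the zero control bounds the sequence. Along a weakly convergent subsequence the
  cost is lower semicontinuous, whereas the costs of each fixed competitor converge, so optimality
  passes to the limit. The tolerance \<open>1 / real (Suc k)\<close> lets the same argument serve minimizing
  sequences.
\<close>

lemma almost_optimal_controls_converge:
  assumes Mu: "Mu > 0"
    and E: "\<And>k. E k \<in> {0..1}" "E \<longlonglongrightarrow> \<epsilon>" "\<epsilon> \<in> {0..1}"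
    and D: "\<And>k. D k \<in> {0..1}" "D \<longlonglongrightarrow> \<delta>" "\<delta> \<in> {0..1}"
    and W0: "\<And>k. W0 k \<in> L2 L" "w0 \<in> L2 L" "\<And>k. L2_sq L (W0 k) \<le> B0" "L2_weak_lim L W0 w0"
    and U: "\<And>k. U k \<in> XX L n"
    and almost: "\<And>k v. v \<in> XX L n \<Longrightarrow> J (E k) (D k) (W0 k) (U k) \<le> J (E k) (D k) (W0 k) v + 1 / real (Suc k)"
  obtains r u where "strict_mono r" "u \<in> XX L n" "XX_weak_lim L n (\<lambda>k. U (r k)) u" "optimal \<epsilon> \<delta> w0 u"
proof -
  have "Bseq (\<lambda>k. J (E k) (D k) (W0 k) (\<lambda>_ _. 0))"
    using cost_tendsto[OF E D W0 zero_XX] by (intro convergent_imp_Bseq convergentI)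
  then obtain C where C: "\<And>k. \<bar>J (E k) (D k) (W0 k) (\<lambda>_ _. 0)\<bar> \<le> C" by (auto simp: Bseq_def)
  have B: "XX_inner L n (U k) (U k) \<le> (C + 1) / (Mu / 2)" for k
  proof -
    have "Mu / 2 * XX_inner L n (U k) (U k) \<le> J (E k) (D k) (W0 k) (U k)" by (rule cost_ge)
    also have "\<dots> \<le> J (E k) (D k) (W0 k) (\<lambda>_ _. 0) + 1 / real (Suc k)" by (rule almost[OF zero_XX])
    also have "\<dots> \<le> C + 1" using C[of k] by (intro add_mono) auto
    finally show ?thesis using Mu by (simp add: pos_le_divide_eq mult.commute)
  qed
  obtain r u where r: "strict_mono r" and u: "u \<in> XX L n" and weak: "XX_weak_lim L n (\<lambda>k. U (r k)) u"
    using XX.weak_sequential_compactness[of U L n "(C + 1) / (Mu / 2)"] U B unfolding XX_weakly_iff by blast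
  have Er: "(\<lambda>k. E (r k)) \<longlonglongrightarrow> \<epsilon>" and Dr: "(\<lambda>k. D (r k)) \<longlonglongrightarrow> \<delta>"
    using LIMSEQ_subseq_LIMSEQ[OF E(2) r] LIMSEQ_subseq_LIMSEQ[OF D(2) r] by (auto simp: o_def)
  note W0r = W0(1,2,3) L2_weak_lim_subseq[OF W0(4) r]
  define q where "q k = 1 / real (Suc k)" for k
  have q0: "q \<longlonglongrightarrow> 0" unfolding q_def[abs_def] using LIMSEQ_Suc[OF lim_1_over_n] by simp
  have "optimal \<epsilon> \<delta> w0 u"
  proof (rule optimalI[OF u])
    fix v assume v: "v \<in> XX L n"
    show "J \<epsilon> \<delta> w0 u \<le> J \<epsilon> \<delta> w0 v"
    proof (rule field_le_epsilon)
      fix e :: real assume e: "e > 0"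
      have "\<forall>\<^sub>F k in sequentially. J \<epsilon> \<delta> w0 u - e / 3 < J (E (r k)) (D (r k)) (W0 (r k)) (U (r k))"
        using e by (intro cost_liminf[OF E(1) Er E(3) D(1) Dr D(3) W0r U u B weak]) simp
      moreover have "\<forall>\<^sub>F k in sequentially. J (E (r k)) (D (r k)) (W0 (r k)) v < J \<epsilon> \<delta> w0 v + e / 3"
        using cost_tendsto[OF E(1) Er E(3) D(1) Dr D(3) W0r v] by (rule order_tendstoD) (use e in simp)
      moreover have "\<forall>\<^sub>F k in sequentially. q (r k) < e / 3"
        using LIMSEQ_subseq_LIMSEQ[OF q0 r] by (intro order_tendstoD(2)[of _ 0]) (use e in \<open>auto simp: o_def\<close>)
      ultimately have "\<forall>\<^sub>F k in sequentially. J \<epsilon> \<delta> w0 u \<le> J \<epsilon> \<delta> w0 v + e"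
      proof eventually_elim
        case (elim k)
        then show ?case using almost[OF v, of "r k"] unfolding q_def by linarith
      qed
      then show "J \<epsilon> \<delta> w0 u \<le> J \<epsilon> \<delta> w0 v + e" by simp
    qed
  qed
  with r u weak show ?thesis by (rule that)
qed

lemma optimal_exists:
  assumes e: "\<epsilon> \<in> {0..1}" and d: "\<delta> \<in> {0..1}" and w0: "w0 \<in> L2 L"
  shows "\<exists>u. optimal \<epsilon> \<delta> w0 u"
proof (cases "Mu = 0")
  case True
  then show ?thesis using optimal_if_no_control[OF _ zero_XX] by blast
next
  case False
  then have Mu: "Mu > 0" using Mu_nonneg by simp
  define j where "j = Inf (J \<epsilon> \<delta> w0 ` XX L n)"
  have "bdd_below (J \<epsilon> \<delta> w0 ` XX L n)" using cost_nonneg by (auto intro!: bdd_belowI2)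
  then have j: "j \<le> J \<epsilon> \<delta> w0 v" if "v \<in> XX L n" for v using that by (auto simp: j_def intro: cINF_lower)
  have "\<exists>u\<in>XX L n. J \<epsilon> \<delta> w0 u < j + 1 / real (Suc k)" for k
  proof -
    have "J \<epsilon> \<delta> w0 ` XX L n \<noteq> {}" using zero_XX by blast
    from cInf_lessD[OF this, of "j + 1 / real (Suc k)"] show ?thesis by (auto simp: j_def)
  qed
  then obtain U where U: "\<And>k. U k \<in> XX L n" "\<And>k. J \<epsilon> \<delta> w0 (U k) < j + 1 / real (Suc k)" by metis
  obtain r :: "nat \<Rightarrow> nat" and u where "optimal \<epsilon> \<delta> w0 u"
  proof (rule almost_optimal_controls_converge[OF Mu, of "\<lambda>_. \<epsilon>" \<epsilon> "\<lambda>_. \<delta>" \<delta> "\<lambda>_. w0" w0 "L2_sq L w0" U])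
    show "J \<epsilon> \<delta> w0 (U k) \<le> J \<epsilon> \<delta> w0 v + 1 / real (Suc k)" if "v \<in> XX L n" for k v
      using U(2)[of k] j[OF that] by linarith
  qed (use e d w0 U(1) in \<open>auto simp: L2_weak_lim_def\<close>)
  then show ?thesis by blast
qed

lemma optimal_controls_converge:
  assumes E: "\<And>k. E k \<in> {0..1}" "E \<longlonglongrightarrow> \<epsilon>" "\<epsilon> \<in> {0..1}"
    and D: "\<And>k. D k \<in> {0..1}" "D \<longlonglongrightarrow> \<delta>" "\<delta> \<in> {0..1}"
    and W0: "\<And>k. W0 k \<in> H1 L" "w0 \<in> H1 L" "H1_weak_lim L W0 w0"
    and U: "\<And>k. optimal (E k) (D k) (W0 k) (U k)"
  obtains r u where "strict_mono r" "u \<in> XX L n"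
    "XX_weak_lim L n (\<lambda>k i x. Mu * U (r k) i x) (\<lambda>i x. Mu * u i x)" "optimal \<epsilon> \<delta> w0 u"
proof (cases "Mu = 0")
  case True
  show ?thesis
  proof (rule that[of "\<lambda>k. k" "\<lambda>_ _. 0"])
    show "optimal \<epsilon> \<delta> w0 (\<lambda>_ _. 0)" by (rule optimal_if_no_control[OF True zero_XX])
  qed (auto simp: True zero_XX XX_weak_lim_def strict_mono_def)
next
  case False
  then have Mu: "Mu > 0" using Mu_nonneg by simp
  obtain B0 where B0: "\<And>k. L2_sq L (W0 k) \<le> B0" using H1_weak_lim_bounded[OF W0(1,3)] by blast
  have weak0: "L2_weak_lim L W0 w0" by (rule H1_weak_lim_imp_L2_weak_lim[OF W0])
  have almost: "J (E k) (D k) (W0 k) (U k) \<le> J (E k) (D k) (W0 k) v + 1 / real (Suc k)" if "v \<in> XX L n" for k v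
    using optimalD(2)[OF U that, of k] by (rule order_trans) simp
  obtain r u where r: "strict_mono r" and u: "u \<in> XX L n" and weak: "XX_weak_lim L n (\<lambda>k. U (r k)) u"
    and opt: "optimal \<epsilon> \<delta> w0 u"
    using almost_optimal_controls_converge[OF Mu E D H1_L2[OF W0(1)] H1_L2[OF W0(2)] B0 weak0 optimalD(1)[OF U] almost] by blast
  have scale: "XX_inner L n (\<lambda>i x. Mu * p i x) y = Mu * XX_inner L n p y" for p y
    by (simp add: XX_inner_def L2_inner_def sum_distrib_left mult.assoc)
  have "XX_weak_lim L n (\<lambda>k i x. Mu * U (r k) i x) (\<lambda>i x. Mu * u i x)"
    using weak by (auto simp: XX_weak_lim_def scale intro!: tendsto_mult_left)
  with r u show ?thesis using opt by (rule that)
qed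

end

theorem theorem3:
  fixes L T \<nu> Mu Mw Cg \<epsilon> \<delta> :: real and n :: nat
    and wad :: "nat \<Rightarrow> real \<Rightarrow> real" and f Kh K :: "real \<Rightarrow> real \<Rightarrow> real"
    and g w0 :: "real \<Rightarrow> real"
  assumes "0 < L" and "0 < T" and "1 \<le> n" and "0 < \<nu>" and "0 \<le> Mu" and "0 \<le> Mw"
    and "wad \<in> XX L n"
    and "f_family f" and "g_assms g Cg" and "K_family Kh K"
    and "T / real n < 1 / (8 * (Cg + 1))"
    and "\<epsilon> \<in> {0..1}" and "\<delta> \<in> {0..1}"
    and "w0 \<in> H1 L" and "Khat_integral L Kh \<delta> w0 < \<infinity>"
  shows
    "(\<exists>u. optimal_control L T n \<nu> Mu Mw wad f g Kh \<epsilon> \<delta> w0 u) \<and>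
     (\<forall>(\<epsilon>m :: nat \<Rightarrow> real) (\<delta>m :: nat \<Rightarrow> real) (w0m :: nat \<Rightarrow> real \<Rightarrow> real)
        (um :: nat \<Rightarrow> nat \<Rightarrow> real \<Rightarrow> real).
        (\<forall>m. \<epsilon>m m \<in> {0<..1}) \<longrightarrow> (\<forall>m. \<delta>m m \<in> {0<..1}) \<longrightarrow> (\<forall>m. w0m m \<in> H1 L) \<longrightarrow>
        \<epsilon>m \<longlonglongrightarrow> \<epsilon> \<longrightarrow> \<delta>m \<longlonglongrightarrow> \<delta> \<longrightarrow> H1_weak_lim L w0m w0 \<longrightarrow>
        (SUP m. Khat_integral L Kh (\<delta>m m) (w0m m)) < \<infinity> \<longrightarrow>
        (\<forall>m. optimal_control L T n \<nu> Mu Mw wad f g Kh (\<epsilon>m m) (\<delta>m m) (w0m m) (um m)) \<longrightarrow>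
        (\<exists>s uss. strict_mono (s :: nat \<Rightarrow> nat) \<and> uss \<in> XX L n \<and>
           XX_weak_lim L n (\<lambda>k i x. Mu * um (s k) i x) (\<lambda>i x. Mu * uss i x) \<and>
           optimal_control L T n \<nu> Mu Mw wad f g Kh \<epsilon> \<delta> w0 uss))"
proof -
  have Cg: "Cg > 0" using assms(9) by (simp add: g_assms_def)
  have tau: "0 < T / real n" using assms(2,3) by simp
  have "8 * (Cg + 1) < 1 / t" if "0 < t" "t < 1 / (8 * (Cg + 1))" for t
    using that Cg by (simp add: field_simps)
  then have "8 * (Cg + 1) < 1 / (T / real n)" using tau assms(11) .
  moreover have "Cg < 8 * (Cg + 1)" using Cg by simp
  ultimately have "Cg < 1 / (T / real n)" by (rule less_trans[rotated])
  then interpret control_problem L \<nu> T n Cg f Kh K g Mu Mw wad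
    using assms tau by unfold_locales auto
  show ?thesis
  proof (intro conjI allI impI)
    show "\<exists>u. optimal \<epsilon> \<delta> w0 u" by (rule optimal_exists[OF assms(12,13) H1_L2[OF assms(14)]])
  next
    fix \<epsilon>m \<delta>m :: "nat \<Rightarrow> real" and w0m and um :: "nat \<Rightarrow> nat \<Rightarrow> real \<Rightarrow> real"
    assume m: "\<forall>m. \<epsilon>m m \<in> {0<..1}" "\<forall>m. \<delta>m m \<in> {0<..1}" "\<forall>m. w0m m \<in> H1 L"
      "\<epsilon>m \<longlonglongrightarrow> \<epsilon>" "\<delta>m \<longlonglongrightarrow> \<delta>" "H1_weak_lim L w0m w0" "\<forall>m. optimal (\<epsilon>m m) (\<delta>m m) (w0m m) (um m)"
    have "\<epsilon>m m \<in> {0..1}" "\<delta>m m \<in> {0..1}" for m using m(1,2)[rule_format, of m] by auto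
    then obtain s uss where "strict_mono s" "uss \<in> XX L n"
      "XX_weak_lim L n (\<lambda>k i x. Mu * um (s k) i x) (\<lambda>i x. Mu * uss i x)" "optimal \<epsilon> \<delta> w0 uss"
      using optimal_controls_converge[OF _ m(4) assms(12) _ m(5) assms(13) _ assms(14) m(6), of um] m(3,7) by blast
    then show "\<exists>s uss. strict_mono (s :: nat \<Rightarrow> nat) \<and> uss \<in> XX L n \<and>
        XX_weak_lim L n (\<lambda>k i x. Mu * um (s k) i x) (\<lambda>i x. Mu * uss i x) \<and> optimal \<epsilon> \<delta> w0 uss"
      by blast
  qed
qed

end
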